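(* Let $v>0$, $c>0$ be constants with $\frac vc>\sqrt2$, and let $s\in\mathbb{R}$. There exists a constant $C>0$ such that for all $\gamma\ge1$ and all $g\in H^s_\gamma(\mathbb{R}^2)$ there exists a unique solution $f\in H^{s+1}_\gamma(\mathbb{R}^2)$ of the equation $$\Sigma(\tau,\eta)\,\widehat f=\widehat g,\qquad \tau=\gamma+i\delta,\ (\delta,\eta)\in\mathbb{R}^2,$$ and it satisfies $$\gamma\,\|f\|_{H^{s+1}_\gamma(\mathbb{R}^2)}\le C\,\|g\|_{H^s_\gamma(\mathbb{R}^2)} .$$
   Context: For $\Re\tau>0$ and $\eta\in\mathbb{R}$, $\mu^\pm=\mu^\pm(\tau,\eta)$ denotes the square root of $\left(\frac{\tau\pm iv\eta}{c}\right)^2+\eta^2$ with $\Re\mu^\pm>0$, and $$\Sigma(\tau,\eta)=\tau^2+v^2\eta^2\left(8\left(\frac{\tau/c}{\mu^+(\tau,\eta)+\mu^-(\tau,\eta)}\right)^2-1\right).$$ Weighted spaces: points of $\mathbb{R}^2$ are $(t,x_1)$, with Fourier dual variables $(\delta,\eta)$, and $\tau=\gamma+i\delta$. For $s\in\mathbb{R}$, $\gamma\ge1$, set $\|u\|_{s,\gamma}^2=\frac1{(2\pi)^2}\iint_{\mathbb{R}^2}(\gamma^2+\delta^2+\eta^2)^s|\widehat u(\delta,\eta)|^2\,d\delta\,d\eta$, where here $\widehat u$ is the Fourier transform of $u$; $H^s_\gamma(\mathbb{R}^2)=\{u\in\mathcal D'(\mathbb{R}^2): e^{-\gamma t}u\in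 H^s(\mathbb{R}^2)\}$ with norm $\|u\|_{H^s_\gamma(\mathbb{R}^2)}=\|e^{-\gamma t}u\|_{s,\gamma}$. In the equation $\Sigma\widehat f=\widehat g$, the symbols $\widehat f,\widehat g$ denote the Fourier transforms in $(t,x_1)$ of $e^{-\gamma t}f$ and $e^{-\gamma t}g$, and the equality is meant for almost every $(\delta,\eta)$. *)

theory Defs
  imports "HOL-Analysis.Analysis"
begin

primrec iter_deriv :: "'a::euclidean_space list \<Rightarrow> ('a \<Rightarrow> complex) \<Rightarrow> 'a \<Rightarrow> complex" where
  "iter_deriv [] \<phi> = \<phi>"
| "iter_deriv (b # bs) \<phi> = (\<lambda>x. frechet_derivative (iter_deriv bs \<phi>) (at x) b)"

text \<open>Differentiability of every iterated partial derivative forces each of them to be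
  continuous, so this is \<open>C\<^sup>\<infinity>\<close>.\<close>

definition smooth :: "('a::euclidean_space \<Rightarrow> complex) \<Rightarrow> bool" where
  "smooth \<phi> \<longleftrightarrow> (\<forall>bs x. set bs \<subseteq> Basis \<longrightarrow> iter_deriv bs \<phi> differentiable (at x))"

definition supp :: "('a::euclidean_space \<Rightarrow> complex) \<Rightarrow> 'a set" where
  "supp \<phi> = closure {x. \<phi> x \<noteq> 0}"

definition test_functions :: "('a::euclidean_space \<Rightarrow> complex) set" where
  "test_functions = {\<phi>. smooth \<phi> \<and> compact (supp \<phi>)}"

definition schwartz :: "('a::euclidean_space \<Rightarrow> complex) set" where
  "schwartz = {\<phi>. smooth \<phi> \<and>
     (\<forall>k bs. set bs \<subseteq> Basis \<longrightarrow> bounded (range (\<lambda>x. (1 + norm x) ^ k *\<^sub>R iter_deriv bs \<phi> x)))}"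

text \<open>Only applied to functions for which all the suprema are finite.\<close>

definition seminorm :: "nat \<Rightarrow> nat \<Rightarrow> ('a::euclidean_space \<Rightarrow> complex) \<Rightarrow> real" where
  "seminorm k N \<phi> = (\<Sum>bs | set bs \<subseteq> Basis \<and> length bs \<le> N.
     SUP x. (1 + norm x) ^ k * cmod (iter_deriv bs \<phi> x))"

definition linear_functional_on ::
  "('a \<Rightarrow> complex) set \<Rightarrow> (('a \<Rightarrow> complex) \<Rightarrow> complex) \<Rightarrow> bool" where
  "linear_functional_on V u \<longleftrightarrow>
     (\<forall>\<phi>\<in>V. \<forall>\<psi>\<in>V. \<forall>a b. u (\<lambda>x. a * \<phi> x + b * \<psi> x) = a * u \<phi> + b * u \<psi>)"

text \<open>Functionals are made extensional, so that two distributions are equal as HOL functions iff they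
  agree on their domain (\<open>test_functions\<close>, resp. \<open>schwartz\<close>).\<close>

definition distributions :: "(('a::euclidean_space \<Rightarrow> complex) \<Rightarrow> complex) set" where
  "distributions = {u \<in> extensional test_functions. linear_functional_on test_functions u \<and>
     (\<forall>K. compact K \<longrightarrow> (\<exists>N C. \<forall>\<phi>\<in>test_functions. supp \<phi> \<subseteq> K \<longrightarrow>
        cmod (u \<phi>) \<le> C * seminorm 0 N \<phi>))}"

definition tempered_distributions :: "(('a::euclidean_space \<Rightarrow> complex) \<Rightarrow> complex) set" where
  "tempered_distributions = {T \<in> extensional schwartz. linear_functional_on schwartz T \<and>
     (\<exists>N C. \<forall>\<phi>\<in>schwartz. cmod (T \<phi>) \<le> C * seminorm N N \<phi>)}"

text \<open>A tempered distribution is identified with its restriction to test functions; the extension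
  below is unique, since test functions are dense in the Schwartz space.\<close>

definition tempered_ext ::
  "(('a::euclidean_space \<Rightarrow> complex) \<Rightarrow> complex) \<Rightarrow> ('a \<Rightarrow> complex) \<Rightarrow> complex" where
  "tempered_ext w = (THE T. T \<in> tempered_distributions \<and> restrict T test_functions = w)"

definition fourier :: "('a::euclidean_space \<Rightarrow> complex) \<Rightarrow> 'a \<Rightarrow> complex" where
  "fourier \<phi> \<xi> = (LINT x|lborel. exp (- \<i> * complex_of_real (x \<bullet> \<xi>)) * \<phi> x)"

text \<open>Meaningful because \<open>fourier\<close> maps the Schwartz space to itself.\<close>

definition fourier_tempered ::
  "(('a::euclidean_space \<Rightarrow> complex) \<Rightarrow> complex) \<Rightarrow> ('a \<Rightarrow> complex) \<Rightarrow> complex" where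
  "fourier_tempered T = (\<lambda>\<psi>\<in>schwartz. T (fourier \<psi>))"

definition represents ::
  "('a::euclidean_space \<Rightarrow> complex) \<Rightarrow> (('a \<Rightarrow> complex) \<Rightarrow> complex) \<Rightarrow> bool" where
  "represents U T \<longleftrightarrow> U \<in> borel_measurable lborel \<and>
     (\<forall>\<psi>\<in>schwartz. integrable lborel (\<lambda>\<xi>. U \<xi> * \<psi> \<xi>) \<and> T \<psi> = (LINT \<xi>|lborel. U \<xi> * \<psi> \<xi>))"

text \<open>The Fourier transform of \<open>T\<close> as a function, when it is one. It is determined only up to null
  sets, and is used only inside integrals and almost-everywhere statements.\<close>

definition fourier_fun ::
  "(('a::euclidean_space \<Rightarrow> complex) \<Rightarrow> complex) \<Rightarrow> 'a \<Rightarrow> complex" where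
  "fourier_fun T = (SOME U. represents U (fourier_tempered T))"

definition sobolev :: "real \<Rightarrow> (('a::euclidean_space \<Rightarrow> complex) \<Rightarrow> complex) set" where
  "sobolev s = {T \<in> tempered_distributions. (\<exists>U. represents U (fourier_tempered T)) \<and>
     integrable lborel (\<lambda>\<xi>. (1 + (norm \<xi>)\<^sup>2) powr s * (cmod (fourier_fun T \<xi>))\<^sup>2)}"

definition norm_s_gamma ::
  "real \<Rightarrow> real \<Rightarrow> ((real \<times> real \<Rightarrow> complex) \<Rightarrow> complex) \<Rightarrow> real" where
  "norm_s_gamma s \<gamma> T = sqrt (1 / (2 * pi)\<^sup>2 *
     (LINT (\<delta>, \<eta>)|lborel. (\<gamma>\<^sup>2 + \<delta>\<^sup>2 + \<eta>\<^sup>2) powr s * (cmod (fourier_fun T (\<delta>, \<eta>)))\<^sup>2))"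

text \<open>The distribution \<open>exp (- \<gamma> t) u\<close>, where \<open>(t, x\<^sub>1)\<close> are the coordinates of the plane.\<close>

definition exp_weight ::
  "real \<Rightarrow> ((real \<times> real \<Rightarrow> complex) \<Rightarrow> complex) \<Rightarrow> (real \<times> real \<Rightarrow> complex) \<Rightarrow> complex" where
  "exp_weight \<gamma> u =
     (\<lambda>\<phi>\<in>test_functions. u (\<lambda>(t, x1). complex_of_real (exp (- \<gamma> * t)) * \<phi> (t, x1)))"

definition H_gamma :: "real \<Rightarrow> real \<Rightarrow> ((real \<times> real \<Rightarrow> complex) \<Rightarrow> complex) set" where
  "H_gamma s \<gamma> =
     {u \<in> distributions. \<exists>T \<in> sobolev s. restrict T test_functions = exp_weight \<gamma> u}"

definition H_gamma_norm ::
  "real \<Rightarrow> real \<Rightarrow> ((real \<times> real \<Rightarrow> complex) \<Rightarrow> complex) \<Rightarrow> real" where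
  "H_gamma_norm s \<gamma> u = norm_s_gamma s \<gamma> (tempered_ext (exp_weight \<gamma> u))"

definition hat_gamma ::
  "real \<Rightarrow> ((real \<times> real \<Rightarrow> complex) \<Rightarrow> complex) \<Rightarrow> real \<times> real \<Rightarrow> complex" where
  "hat_gamma \<gamma> u = fourier_fun (tempered_ext (exp_weight \<gamma> u))"

text \<open>Used only for \<open>Re \<tau> > 0\<close> and \<open>c > 0\<close>: then the radicand avoids the closed negative real axis,
  so exactly one root has positive real part.\<close>

definition mu_plus :: "real \<Rightarrow> real \<Rightarrow> complex \<Rightarrow> real \<Rightarrow> complex" where
  "mu_plus v c \<tau> \<eta> = (THE \<mu>.
     \<mu>\<^sup>2 = ((\<tau> + \<i> * of_real v * of_real \<eta>) / of_real c)\<^sup>2 + (of_real \<eta>)\<^sup>2 \<and> Re \<mu> > 0)"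

definition mu_minus :: "real \<Rightarrow> real \<Rightarrow> complex \<Rightarrow> real \<Rightarrow> complex" where
  "mu_minus v c \<tau> \<eta> = (THE \<mu>.
     \<mu>\<^sup>2 = ((\<tau> - \<i> * of_real v * of_real \<eta>) / of_real c)\<^sup>2 + (of_real \<eta>)\<^sup>2 \<and> Re \<mu> > 0)"

definition Sigma_symbol :: "real \<Rightarrow> real \<Rightarrow> complex \<Rightarrow> real \<Rightarrow> complex" where
  "Sigma_symbol v c \<tau> \<eta> = \<tau>\<^sup>2 + (of_real v)\<^sup>2 * (of_real \<eta>)\<^sup>2 *
     (8 * ((\<tau> / of_real c) / (mu_plus v c \<tau> \<eta> + mu_minus v c \<tau> \<eta>))\<^sup>2 - 1)"

definition solves ::
  "real \<Rightarrow> real \<Rightarrow> real \<Rightarrow> ((real \<times> real \<Rightarrow> complex) \<Rightarrow> complex) \<Rightarrow>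
   ((real \<times> real \<Rightarrow> complex) \<Rightarrow> complex) \<Rightarrow> bool" where
  "solves v c \<gamma> g f \<longleftrightarrow> (AE (\<delta>, \<eta>) in lborel.
     Sigma_symbol v c (Complex \<gamma> \<delta>) \<eta> * hat_gamma \<gamma> f (\<delta>, \<eta>) = hat_gamma \<gamma> g (\<delta>, \<eta>))"

end

theory Submission
  imports Defs "HOL-Probability.Characteristic_Functions" "HOL-Probability.Sinc_Integral"
begin

text \<open>
  Rationalising the quotient in the symbol gives \<open>\<Sigma> = c\<^sup>2 (\<mu>\<^sup>+ \<mu>\<^sup>- - \<eta>\<^sup>2)\<close>. With \<open>\<sigma> = \<tau> / c\<close> and \<open>M = v / c\<close>,
  the product of \<open>\<mu>\<^sup>+ \<mu>\<^sup>- - \<eta>\<^sup>2\<close> and \<open>\<mu>\<^sup>+ \<mu>\<^sup>- + \<eta>\<^sup>2\<close> is a quadratic polynomial in \<open>\<sigma>\<^sup>2\<close>, which for \<open>M > sqrt 2\<close>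
  factors as \<open>(\<sigma>\<^sup>2 + X\<^sup>2 \<eta>\<^sup>2) (\<sigma>\<^sup>2 + Y\<^sup>2 \<eta>\<^sup>2)\<close> with \<open>0 < X < Y\<close>. Its four linear factors in \<open>\<sigma>\<close> all have
  modulus at least \<open>\<gamma> / c\<close>, and three of them are comparable to \<open>\<Lambda> = sqrt (\<gamma>\<^sup>2 + \<delta>\<^sup>2 + \<eta>\<^sup>2)\<close>. As
  \<open>\<mu>\<^sup>+ \<mu>\<^sup>- + \<eta>\<^sup>2\<close> is at most of order \<open>\<Lambda>\<^sup>2\<close>, this yields \<open>\<bar>\<Sigma>\<bar> \<ge> K \<gamma> \<Lambda>\<close>: one power of \<open>\<Lambda>\<close> is gained and
  one factor \<open>\<gamma>\<close> is lost when dividing by \<open>\<Sigma>\<close>. Fourier inversion on the Schwartz space turns the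
  quotient \<open>V\<close> of the transforms into the tempered distribution that integrates \<open>V\<close> against the inverse
  transform of a test function. Uniqueness rests on the density of test functions among Schwartz
  functions and on the fact that a tempered distribution has, up to null sets, at most one representing
  function.
\<close>

section \<open>Iterated derivatives and smooth functions\<close>

text \<open>The norms are defined on the Fourier side, so the estimate itself is a pointwise
  comparison of squared moduli, integrated over the plane. What takes room is that the objects are
  reached through choices: \<open>tempered_ext\<close> is a definite description,
  \<open>fourier_fun\<close> an arbitrary representative, and \<open>exp_weight\<close> acts on test
  functions. Density and a.e. uniqueness make each choice harmless, and they also recover
  \<open>f\<close> from its transform. The condition \<open>M > sqrt 2\<close> enters through the
  constant coefficient \<open>M\<^sup>2 (M\<^sup>2 - 2)\<close> of the quadratic in
  \<open>\<sigma>\<^sup>2\<close>: its positivity makes both roots negative, so all four zeros in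
  \<sigma> lie on the imaginary axis. For \<open>0 < M < sqrt 2\<close> and nonzero \<eta> one root
  would be positive, and the product would vanish at some \<sigma> > 0. The constant has to be
  uniform in \<gamma>. The weight
  \<open>\<gamma>\<^sup>2 + \<delta>\<^sup>2 + \<eta>\<^sup>2\<close> is comparable to the standard
  one only with constants depending on \<gamma>; that comparison serves integrability, while the
  final constant \<open>1 / K\<close> comes from the symbol alone.\<close>

lemma iter_deriv_append: "iter_deriv (as @ bs) f = iter_deriv as (iter_deriv bs f)"
  by (induction as) auto

lemma smooth_differentiable: "smooth f \<Longrightarrow> f differentiable (at x)"
  unfolding smooth_def by (metis empty_subsetI iter_deriv.simps(1) list.set(1))

lemma smooth_iter_deriv_differentiable:
  "smooth f \<Longrightarrow> set bs \<subseteq> Basis \<Longrightarrow> iter_deriv bs f differentiable (at x)"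
  unfolding smooth_def by blast

lemma smooth_iter_deriv: "smooth f \<Longrightarrow> set bs \<subseteq> Basis \<Longrightarrow> smooth (iter_deriv bs f)"
  unfolding smooth_def by (metis Un_subset_iff iter_deriv_append set_append)

lemma continuous_on_iter_deriv:
  "smooth f \<Longrightarrow> set bs \<subseteq> Basis \<Longrightarrow> continuous_on A (iter_deriv bs f)"
  using smooth_iter_deriv_differentiable differentiable_imp_continuous_within
  by (metis continuous_at_imp_continuous_on)

lemma smooth_continuous_on: "smooth f \<Longrightarrow> continuous_on A f"
  using continuous_on_iter_deriv[of f "[]"] by simp

lemma iter_deriv_measurable [measurable_dest]:
  "smooth f \<Longrightarrow> set bs \<subseteq> Basis \<Longrightarrow> iter_deriv bs f \<in> borel_measurable borel"
  by (intro borel_measurable_continuous_onI continuous_on_iter_deriv)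

lemma smooth_has_derivative:
  "smooth f \<Longrightarrow> (f has_derivative frechet_derivative f (at x)) (at x)"
  by (simp add: smooth_differentiable frechet_derivative_works[symmetric])

lemma frechet_derivative_eq_sum_Basis:
  fixes f :: "'a::euclidean_space \<Rightarrow> complex"
  assumes "f differentiable (at x)"
  shows "frechet_derivative f (at x) h = (\<Sum>b\<in>Basis. (h \<bullet> b) *\<^sub>R iter_deriv [b] f x)"
proof -
  interpret linear "frechet_derivative f (at x)"
    using assms by (rule linear_frechet_derivative)
  have "frechet_derivative f (at x) h = frechet_derivative f (at x) (\<Sum>b\<in>Basis. (h \<bullet> b) *\<^sub>R b)"
    by (simp add: euclidean_representation)
  also have "\<dots> = (\<Sum>b\<in>Basis. (h \<bullet> b) *\<^sub>R iter_deriv [b] f x)"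
    by (simp add: sum scale)
  finally show ?thesis .
qed

text \<open>The calculus rules below follow this pattern: guess a closed form \<open>F bs\<close>
  for all iterated derivatives at once and check the one-step relation between \<open>F bs\<close>
  and \<open>F (b # bs)\<close>. Smoothness and the formula then come out together.\<close>

lemma smooth_formula:
  fixes F :: "'a::euclidean_space list \<Rightarrow> 'a \<Rightarrow> complex"
  assumes "F [] = f"
    and "\<And>b bs x. b \<in> Basis \<Longrightarrow> set bs \<subseteq> Basis \<Longrightarrow>
      \<exists>D. (F bs has_derivative D) (at x) \<and> D b = F (b # bs) x"
  shows "smooth f" and "set bs \<subseteq> Basis \<Longrightarrow> iter_deriv bs f = F bs"
proof -
  have eq: "iter_deriv bs f = F bs" if "set bs \<subseteq> Basis" for bs
    using that
  proof (induction bs)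
    case Nil
    then show ?case by (simp add: assms(1))
  next
    case (Cons b bs)
    then have b: "b \<in> Basis" "set bs \<subseteq> Basis" by auto
    show ?case
    proof
      fix x
      obtain D where D: "(F bs has_derivative D) (at x)" "D b = F (b # bs) x"
        using assms(2)[OF b] by blast
      then show "iter_deriv (b # bs) f x = F (b # bs) x"
        using Cons b frechet_derivative_at[OF D(1)] by simp
    qed
  qed
  then show "set bs \<subseteq> Basis \<Longrightarrow> iter_deriv bs f = F bs" by simp
  \<comment> \<open>The hypothesis delivers a derivative of \<open>F bs\<close> only together with a
    direction, so some basis vector has to be supplied to read off differentiability.\<close>
  obtain b0 :: 'a where b0: "b0 \<in> Basis" using nonempty_Basis by blast
  show "smooth f"
    unfolding smooth_def
  proof (intro allI impI)
    fix bs :: "'a list" and x assume bs: "set bs \<subseteq> Basis"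
    from assms(2)[OF b0 bs, of x] show "iter_deriv bs f differentiable at x"
      unfolding eq[OF bs] differentiable_def by blast
  qed
qed

lemma iter_deriv_smooth_has_derivative:
  assumes "smooth f" "set bs \<subseteq> Basis"
  shows "\<exists>D. (iter_deriv bs f has_derivative D) (at x) \<and> (\<forall>b. D b = iter_deriv (b # bs) f x)"
  using smooth_has_derivative[OF smooth_iter_deriv[OF assms]] by (metis iter_deriv.simps(2))

lemma smooth_linear_combination:
  assumes "smooth f" "smooth g"
  shows "smooth (\<lambda>x. a * f x + b * g x)"
    and "set bs \<subseteq> Basis \<Longrightarrow>
      iter_deriv bs (\<lambda>x. a * f x + b * g x) = (\<lambda>x. a * iter_deriv bs f x + b * iter_deriv bs g x)"
proof -
  let ?F = "\<lambda>bs x. a * iter_deriv bs f x + b * iter_deriv bs g x"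
  have F: "\<exists>D. (?F bs has_derivative D) (at x) \<and> D c = ?F (c # bs) x"
    if c: "c \<in> Basis" "set bs \<subseteq> Basis" for c bs x
  proof -
    obtain D E where D: "(iter_deriv bs f has_derivative D) (at x)" "\<forall>b. D b = iter_deriv (b # bs) f x"
      and E: "(iter_deriv bs g has_derivative E) (at x)" "\<forall>b. E b = iter_deriv (b # bs) g x"
      using iter_deriv_smooth_has_derivative[OF assms(1) c(2)]
        iter_deriv_smooth_has_derivative[OF assms(2) c(2)] by metis
    have "(?F bs has_derivative (\<lambda>h. a * D h + b * E h)) (at x)"
      by (intro derivative_intros D(1) E(1))
    then show ?thesis using D(2) E(2) by auto
  qed
  show "smooth (\<lambda>x. a * f x + b * g x)"
    by (rule smooth_formula(1)[of ?F]) (simp, rule F)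
  show "set bs \<subseteq> Basis \<Longrightarrow> iter_deriv bs (\<lambda>x. a * f x + b * g x) = ?F bs"
    by (rule smooth_formula(2)[of ?F]) (simp, rule F)
qed

lemma smooth_scaleR:
  fixes f :: "'a::euclidean_space \<Rightarrow> complex"
  assumes "smooth f"
  shows "smooth (\<lambda>x. f (r *\<^sub>R x))"
    and "set bs \<subseteq> Basis \<Longrightarrow>
      iter_deriv bs (\<lambda>x. f (r *\<^sub>R x)) = (\<lambda>x. r ^ length bs *\<^sub>R iter_deriv bs f (r *\<^sub>R x))"
proof -
  let ?F = "\<lambda>bs x. r ^ length bs *\<^sub>R iter_deriv bs f (r *\<^sub>R x)"
  have F: "\<exists>D. (?F bs has_derivative D) (at x) \<and> D c = ?F (c # bs) x"
    if c: "c \<in> Basis" "set bs \<subseteq> Basis" for c bs x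
  proof -
    let ?D = "frechet_derivative (iter_deriv bs f) (at (r *\<^sub>R x))"
    have D: "(iter_deriv bs f has_derivative ?D) (at (r *\<^sub>R x))"
      using smooth_has_derivative smooth_iter_deriv assms c by metis
    have "(?F bs has_derivative (\<lambda>h. r ^ length bs *\<^sub>R ?D (r *\<^sub>R h))) (at x)"
      by (rule has_derivative_scaleR_right, rule has_derivative_compose[where f = "\<lambda>x. r *\<^sub>R x", OF _ D])
        (auto intro!: derivative_eq_intros)
    moreover have "?D (r *\<^sub>R c) = r *\<^sub>R ?D c"
      using linear_scale[OF has_derivative_linear[OF D]] by blast
    ultimately show ?thesis by (auto simp: mult_ac)
  qed
  show "smooth (\<lambda>x. f (r *\<^sub>R x))"
    by (rule smooth_formula(1)[of ?F]) (simp, rule F)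
  show "set bs \<subseteq> Basis \<Longrightarrow> iter_deriv bs (\<lambda>x. f (r *\<^sub>R x)) = ?F bs"
    by (rule smooth_formula(2)[of ?F]) (simp, rule F)
qed

text \<open>\<open>H k\<close> plays the k-th derivative of \<open>H 0\<close>, and each derivative
  along \<open>b\<close> brings down the factor \<open>b \<bullet> w\<close>. The flat function, the
  coordinates, the Fourier kernel and the exponential weight are all of this form.\<close>

lemma smooth_compose_linear:
  fixes H :: "nat \<Rightarrow> real \<Rightarrow> complex" and w :: "'a::euclidean_space"
  assumes H: "\<And>k t. (H k has_vector_derivative H (Suc k) t) (at t)"
  shows "smooth (\<lambda>x. H 0 (x \<bullet> w + d))"
    and "set bs \<subseteq> Basis \<Longrightarrow> iter_deriv bs (\<lambda>x. H 0 (x \<bullet> w + d)) =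
      (\<lambda>x. prod_list (map (\<lambda>b. b \<bullet> w) bs) *\<^sub>R H (length bs) (x \<bullet> w + d))"
proof -
  let ?F = "\<lambda>bs x. prod_list (map (\<lambda>b. b \<bullet> w) bs) *\<^sub>R H (length bs) (x \<bullet> w + d)"
  have F: "\<exists>D. (?F bs has_derivative D) (at x) \<and> D c = ?F (c # bs) x"
    if c: "c \<in> Basis" "set bs \<subseteq> Basis" for c bs x
  proof -
    let ?p = "prod_list (map (\<lambda>b. b \<bullet> w) bs)"
    have D: "(H (length bs) has_derivative (\<lambda>h. h *\<^sub>R H (Suc (length bs)) (x \<bullet> w + d))) (at (x \<bullet> w + d))"
      using H by (simp add: has_vector_derivative_def)
    have "(?F bs has_derivative (\<lambda>h. ?p *\<^sub>R ((h \<bullet> w) *\<^sub>R H (Suc (length bs)) (x \<bullet> w + d)))) (at x)"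
      by (rule has_derivative_scaleR_right, rule has_derivative_compose[where f = "\<lambda>x. x \<bullet> w + d", OF _ D])
        (auto intro!: derivative_eq_intros)
    then show ?thesis by (auto simp: mult_ac)
  qed
  show "smooth (\<lambda>x. H 0 (x \<bullet> w + d))"
    by (rule smooth_formula(1)[of ?F]) (simp, rule F)
  show "set bs \<subseteq> Basis \<Longrightarrow> iter_deriv bs (\<lambda>x. H 0 (x \<bullet> w + d)) = ?F bs"
    by (rule smooth_formula(2)[of ?F]) (simp, rule F)
qed

text \<open>Index set of the Leibniz rule: every derivative in the list goes to one of the two
  factors, so a list of length n has \<open>2 ^ n\<close> splits and no binomial coefficients
  appear.\<close>

fun splits :: "'a list \<Rightarrow> ('a list \<times> 'a list) list" where
  "splits [] = [([], [])]"
| "splits (b # bs) = map (\<lambda>(as, cs). (b # as, cs)) (splits bs) @ map (\<lambda>(as, cs). (as, b # cs)) (splits bs)"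

lemma splits_subset: "(as, cs) \<in> set (splits bs) \<Longrightarrow> set as \<subseteq> set bs \<and> set cs \<subseteq> set bs"
  by (induction bs arbitrary: as cs) fastforce+

lemma splits_length: "(as, cs) \<in> set (splits bs) \<Longrightarrow> length as \<le> length bs \<and> length cs \<le> length bs"
  by (induction bs arbitrary: as cs) fastforce+

lemma has_derivative_sum_list:
  assumes "\<And>p. p \<in> set ps \<Longrightarrow> (f p has_derivative f' p) F"
  shows "((\<lambda>x. \<Sum>p\<leftarrow>ps. f p x) has_derivative (\<lambda>h. \<Sum>p\<leftarrow>ps. f' p h)) F"
  using assms by (induction ps) (auto intro!: derivative_intros)

lemma smooth_mult:
  fixes f g :: "'a::euclidean_space \<Rightarrow> complex"
  assumes f: "smooth f" and g: "smooth g"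
  shows "smooth (\<lambda>x. f x * g x)"
    and "set bs \<subseteq> Basis \<Longrightarrow> iter_deriv bs (\<lambda>x. f x * g x) =
      (\<lambda>x. \<Sum>p\<leftarrow>splits bs. iter_deriv (fst p) f x * iter_deriv (snd p) g x)"
proof -
  let ?F = "\<lambda>bs x. \<Sum>p\<leftarrow>splits bs. iter_deriv (fst p) f x * iter_deriv (snd p) g x"
  have F: "\<exists>D. (?F bs has_derivative D) (at x) \<and> D c = ?F (c # bs) x"
    if c: "c \<in> Basis" "set bs \<subseteq> Basis" for c bs x
  proof -
    let ?D = "\<lambda>as. frechet_derivative (iter_deriv as f) (at x)"
    let ?E = "\<lambda>as. frechet_derivative (iter_deriv as g) (at x)"
    have "(?F bs has_derivative (\<lambda>h. \<Sum>p\<leftarrow>splits bs. iter_deriv (fst p) f x * ?E (snd p) h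
        + ?D (fst p) h * iter_deriv (snd p) g x)) (at x)"
    proof (rule has_derivative_sum_list)
      fix p assume "p \<in> set (splits bs)"
      then have p: "set (fst p) \<subseteq> Basis" "set (snd p) \<subseteq> Basis"
        using splits_subset[of "fst p" "snd p" bs] c by auto
      show "((\<lambda>x. iter_deriv (fst p) f x * iter_deriv (snd p) g x) has_derivative
         (\<lambda>h. iter_deriv (fst p) f x * ?E (snd p) h + ?D (fst p) h * iter_deriv (snd p) g x)) (at x)"
        by (intro has_derivative_mult smooth_has_derivative smooth_iter_deriv f g p)
    qed
    moreover have "(\<Sum>p\<leftarrow>splits bs. iter_deriv (fst p) f x * ?E (snd p) c
        + ?D (fst p) c * iter_deriv (snd p) g x) = ?F (c # bs) x"
      by (simp add: sum_list_addf o_def case_prod_beta)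
    ultimately show ?thesis by blast
  qed
  show "smooth (\<lambda>x. f x * g x)"
    by (rule smooth_formula(1)[of ?F]) (simp, rule F)
  show "set bs \<subseteq> Basis \<Longrightarrow> iter_deriv bs (\<lambda>x. f x * g x) = ?F bs"
    by (rule smooth_formula(2)[of ?F]) (simp, rule F)
qed

lemma smooth_const:
  shows "smooth (\<lambda>x. c)"
    and "set bs \<subseteq> Basis \<Longrightarrow> iter_deriv bs (\<lambda>x. c) = (\<lambda>x. if bs = [] then c else 0)"
proof -
  let ?F = "\<lambda>bs x. if bs = [] then c else 0"
  show "smooth (\<lambda>x. c)"
    by (rule smooth_formula(1)[of ?F]) (auto intro!: exI[of _ "\<lambda>_. 0"])
  show "set bs \<subseteq> Basis \<Longrightarrow> iter_deriv bs (\<lambda>x. c) = ?F bs"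
    by (rule smooth_formula(2)[of ?F]) (auto intro!: exI[of _ "\<lambda>_. 0"])
qed

lemma smooth_prod:
  "(\<And>i. i \<in> I \<Longrightarrow> smooth (f i)) \<Longrightarrow> smooth (\<lambda>x. \<Prod>i\<in>I. f i x)"
  by (induction I rule: infinite_finite_induct) (auto intro: smooth_const smooth_mult)

text \<open>The complement of the support is open, so vanishing there survives
  differentiation.\<close>

lemma iter_deriv_zero_outside:
  assumes "x \<notin> supp f"
  shows "iter_deriv bs f x = 0"
  using assms
proof (induction bs arbitrary: x)
  case Nil
  then show ?case
    using closure_subset[of "{x. f x \<noteq> 0}"] by (auto simp: supp_def)
next
  case (Cons b bs)
  have "(iter_deriv bs f has_derivative (\<lambda>_. 0)) (at x)"
    by (rule has_derivative_transform_within_open[of "\<lambda>_. 0" _ _ _ "- supp f"])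
      (use Cons in \<open>auto simp: supp_def\<close>)
  then have "frechet_derivative (iter_deriv bs f) (at x) = (\<lambda>_. 0)"
    by (rule frechet_derivative_at[symmetric])
  then show ?case by simp
qed

lemma test_functions_mult:
  assumes "smooth p" "\<phi> \<in> test_functions"
  shows "(\<lambda>x. p x * \<phi> x) \<in> test_functions" "supp (\<lambda>x. p x * \<phi> x) \<subseteq> supp \<phi>"
proof -
  show s: "supp (\<lambda>x. p x * \<phi> x) \<subseteq> supp \<phi>"
    unfolding supp_def by (rule closure_mono) auto
  have "compact (supp \<phi>)" using assms by (simp add: test_functions_def)
  then have "compact (supp (\<lambda>x. p x * \<phi> x))"
    using s by (metis closed_closure compact_Int_closed inf.absorb_iff2 supp_def)
  then show "(\<lambda>x. p x * \<phi> x) \<in> test_functions"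
    using assms smooth_mult(1) by (auto simp: test_functions_def)
qed

lemma test_functions_linear_combination:
  assumes "\<phi> \<in> test_functions" "\<psi> \<in> test_functions"
  shows "(\<lambda>x. a * \<phi> x + b * \<psi> x) \<in> test_functions"
proof -
  have "supp (\<lambda>x. a * \<phi> x + b * \<psi> x) \<subseteq> supp \<phi> \<union> supp \<psi>"
    unfolding supp_def closure_Un[symmetric] by (rule closure_mono) auto
  moreover have "compact (supp \<phi> \<union> supp \<psi>)"
    using assms by (auto simp: test_functions_def)
  ultimately have "compact (supp (\<lambda>x. a * \<phi> x + b * \<psi> x))"
    by (metis closed_closure compact_Int_closed inf.absorb_iff2 supp_def)
  then show ?thesis
    using assms smooth_linear_combination(1) by (auto simp: test_functions_def)
qed

lemma test_functionsI:
  assumes "smooth f" "compact K" "\<And>x. x \<notin> K \<Longrightarrow> f x = 0"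
  shows "f \<in> test_functions"
proof -
  have "supp f \<subseteq> K"
    unfolding supp_def using assms by (intro closure_minimal) (auto intro: compact_imp_closed)
  then show ?thesis
    using assms by (metis (mono_tags, lifting) closed_closure compact_Int_closed inf.absorb_iff2
        mem_Collect_eq supp_def test_functions_def)
qed

section \<open>A smooth function that is flat at the origin\<close>

fun flat_poly :: "nat \<Rightarrow> real poly" where
  "flat_poly 0 = 1"
| "flat_poly (Suc k) = [:0, 0, 1:] * (flat_poly k - pderiv (flat_poly k))"

text \<open>\<open>flat_exp 0\<close> is the flat function \<open>exp (- 1 / t)\<close> on the positive half line and \<open>flat_exp k\<close> is its
  \<open>k\<close>-th derivative.\<close>

definition flat_exp :: "nat \<Rightarrow> real \<Rightarrow> real" where
  "flat_exp k t = (if t \<le> 0 then 0 else poly (flat_poly k) (1 / t) * exp (- 1 / t))"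

lemma flat_exp_eq_0: "t \<le> 0 \<Longrightarrow> flat_exp k t = 0"
  by (simp add: flat_exp_def)

lemma poly_exp_neg_tendsto_0: "((\<lambda>u. poly p u * exp (- u)) \<longlongrightarrow> (0::real)) at_top"
proof -
  have "((\<lambda>u. \<Sum>i\<le>degree p. coeff p i * (u ^ i / exp u)) \<longlongrightarrow> (\<Sum>i\<le>degree p. coeff p i * 0)) at_top"
    by (intro tendsto_sum tendsto_mult tendsto_const tendsto_power_div_exp_0)
  then show ?thesis
    by (simp add: poly_altdef sum_distrib_right exp_minus divide_inverse mult.assoc)
qed

text \<open>For t > 0 the substitution u = 1 / t turns the t-derivative of
  \<open>P u * exp (- u)\<close> into \<open>u\<^sup>2 * (P u - P' u) * exp (- u)\<close>, which is
  the recursion of \<open>flat_poly\<close>. At t = 0 a limit is needed.\<close>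

lemma flat_exp_has_derivative: "(flat_exp k has_real_derivative flat_exp (Suc k) t) (at t)"
proof (cases t "0::real" rule: linorder_cases)
  case less
  have "((\<lambda>_. 0) has_real_derivative flat_exp (Suc k) t) (at t)"
    using less by (simp add: flat_exp_eq_0)
  then show ?thesis
    by (rule has_field_derivative_transform_within_open[of _ _ _ "{..<0}"])
      (use less in \<open>auto simp: flat_exp_eq_0\<close>)
next
  case greater
  have "((\<lambda>t. poly (flat_poly k) (1 / t) * exp (- 1 / t)) has_real_derivative flat_exp (Suc k) t) (at t)"
    using greater
    by (auto intro!: derivative_eq_intros simp: flat_exp_def field_simps power2_eq_square)
  then show ?thesis
    by (rule has_field_derivative_transform_within_open[of _ _ _ "{0<..}"])
      (use greater in \<open>auto simp: flat_exp_def\<close>)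
next
  case equal
  have "((\<lambda>h. flat_exp k h / h) \<longlongrightarrow> 0) (at 0)"
  proof (rule filterlim_split_at)
    show "((\<lambda>h. flat_exp k h / h) \<longlongrightarrow> 0) (at_left 0)"
      by (rule tendsto_eventually) (auto simp: eventually_at_left_field flat_exp_eq_0 intro: exI[of _ "-1"])
    \<comment> \<open>With u = 1 / h the right-hand difference quotient at 0 is a polynomial in u
      times \<open>exp (- u)\<close>; the extra factor \<open>[:0,1:]\<close> is the 1 / h.\<close>
    have "((\<lambda>u. poly ([:0,1:] * flat_poly k) u * exp (- u)) \<longlongrightarrow> 0) at_top"
      by (rule poly_exp_neg_tendsto_0)
    then have "((\<lambda>h. poly ([:0,1:] * flat_poly k) (inverse h) * exp (- inverse h)) \<longlongrightarrow> 0) (at_right 0)"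
      by (rule filterlim_compose) (rule filterlim_inverse_at_top_right)
    then show "((\<lambda>h. flat_exp k h / h) \<longlongrightarrow> 0) (at_right 0)"
      by (rule Lim_transform_eventually)
        (auto simp: eventually_at_right_field flat_exp_def field_simps intro!: exI[of _ 1])
  qed
  then show ?thesis
    by (simp add: equal has_field_derivative_iff flat_exp_eq_0)
qed

section \<open>Schwartz functions and the density of test functions\<close>

lemma schwartz_smooth: "\<phi> \<in> schwartz \<Longrightarrow> smooth \<phi>"
  by (simp add: schwartz_def)

lemma schwartz_bound:
  assumes "\<phi> \<in> schwartz" "set bs \<subseteq> Basis"
  obtains C where "C \<ge> 0" "\<And>x. (1 + norm x) ^ k * cmod (iter_deriv bs \<phi> x) \<le> C"
proof -
  have "bounded (range (\<lambda>x. (1 + norm x) ^ k *\<^sub>R iter_deriv bs \<phi> x))"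
    using assms by (simp add: schwartz_def)
  then obtain C where C: "\<And>x. norm ((1 + norm x) ^ k *\<^sub>R iter_deriv bs \<phi> x) \<le> C"
    by (auto simp: bounded_iff)
  have "C \<ge> 0" using order_trans[OF norm_ge_zero C] .
  moreover have "(1 + norm x) ^ k * cmod (iter_deriv bs \<phi> x) \<le> C" for x
    using C[of x] by (simp add: abs_of_nonneg)
  ultimately show ?thesis using that by blast
qed

lemma schwartzI:
  assumes "smooth \<phi>"
    and "\<And>k bs. set bs \<subseteq> Basis \<Longrightarrow> \<exists>C. \<forall>x. (1 + norm x) ^ k * cmod (iter_deriv bs \<phi> x) \<le> C"
  shows "\<phi> \<in> schwartz"
  unfolding schwartz_def
proof (intro CollectI conjI allI impI)
  fix k and bs :: "'a list" assume "set bs \<subseteq> Basis"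
  from assms(2)[OF this, of k] obtain C
    where C: "\<forall>x. (1 + norm x) ^ k * cmod (iter_deriv bs \<phi> x) \<le> C" by blast
  show "bounded (range (\<lambda>x. (1 + norm x) ^ k *\<^sub>R iter_deriv bs \<phi> x))"
    unfolding bounded_iff using C by (auto simp: abs_of_nonneg intro!: exI[of _ C])
qed (fact assms(1))

lemma le_seminorm:
  assumes "\<phi> \<in> schwartz" "set bs \<subseteq> Basis" "length bs \<le> N" "j \<le> k"
  shows "(1 + norm x) ^ j * cmod (iter_deriv bs \<phi> x) \<le> seminorm k N \<phi>"
proof -
  let ?S = "\<lambda>bs. SUP x. (1 + norm x) ^ k * cmod (iter_deriv bs \<phi> x)"
  \<comment> \<open>The supremum of an unbounded set of reals is unspecified, so finiteness has to
    be established before the supremum bounds anything.\<close>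
  have up: "(1 + norm x) ^ k * cmod (iter_deriv cs \<phi> x) \<le> ?S cs" if cs: "set cs \<subseteq> Basis" for cs x
  proof -
    obtain C where "\<And>x. (1 + norm x) ^ k * cmod (iter_deriv cs \<phi> x) \<le> C"
      using schwartz_bound[OF assms(1) cs] by metis
    then have "bdd_above (range (\<lambda>x. (1 + norm x) ^ k * cmod (iter_deriv cs \<phi> x)))"
      by (auto intro!: bdd_aboveI2)
    then show ?thesis by (rule cSUP_upper[OF UNIV_I])
  qed
  have "(1 + norm x) ^ j * cmod (iter_deriv bs \<phi> x) \<le> (1 + norm x) ^ k * cmod (iter_deriv bs \<phi> x)"
    using assms(4) by (intro mult_right_mono power_increasing) auto
  also have "\<dots> \<le> ?S bs" using up assms by blast
  also have "\<dots> \<le> seminorm k N \<phi>"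
    unfolding seminorm_def
  proof (rule member_le_sum)
    show "finite {bs::'a list. set bs \<subseteq> Basis \<and> length bs \<le> N}"
      by (rule finite_lists_length_le) simp
    show "0 \<le> ?S cs" if "cs \<in> {bs. set bs \<subseteq> Basis \<and> length bs \<le> N} - {bs}" for cs
      by (rule order_trans[OF _ up[of cs 0]]) (use that in auto)
  qed (use assms in auto)
  finally show ?thesis .
qed

lemma seminorm_le:
  assumes "\<And>bs x. set bs \<subseteq> Basis \<Longrightarrow> length bs \<le> N \<Longrightarrow>
    (1 + norm x) ^ k * cmod (iter_deriv bs \<phi> x) \<le> B bs"
  shows "seminorm k N \<phi> \<le> (\<Sum>bs | set bs \<subseteq> Basis \<and> length bs \<le> N. B bs)"
  unfolding seminorm_def using assms by (intro sum_mono cSUP_least) auto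

lemma seminorm_nonneg: "\<phi> \<in> schwartz \<Longrightarrow> 0 \<le> seminorm k N \<phi>"
  by (rule order_trans[OF _ le_seminorm[of \<phi> "[]" N k k 0]]) auto

text \<open>A class of multipliers of the Schwartz space; the order of growth may differ from one
  derivative to the next.\<close>

definition poly_growth :: "('a::euclidean_space \<Rightarrow> complex) \<Rightarrow> bool" where
  "poly_growth p \<longleftrightarrow> smooth p \<and>
    (\<forall>bs. set bs \<subseteq> Basis \<longrightarrow> (\<exists>C m. \<forall>x. cmod (iter_deriv bs p x) \<le> C * (1 + norm x) ^ m))"

lemma norm_sum_list_le: "norm (\<Sum>q\<leftarrow>qs. f q) \<le> (\<Sum>q\<leftarrow>qs. norm (f q))"
  by (induction qs) (auto intro: norm_triangle_le)

lemma schwartz_mult: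
  assumes p: "poly_growth p" and \<phi>: "\<phi> \<in> schwartz"
  shows "(\<lambda>x. p x * \<phi> x) \<in> schwartz"
proof (rule schwartzI)
  have sp: "smooth p" using p by (simp add: poly_growth_def)
  then show "smooth (\<lambda>x. p x * \<phi> x)" using schwartz_smooth[OF \<phi>] by (rule smooth_mult)
  fix k and bs :: "'a list" assume bs: "set bs \<subseteq> Basis"
  have "\<exists>B. \<forall>x. (1 + norm x) ^ k * cmod (iter_deriv (fst q) p x * iter_deriv (snd q) \<phi> x) \<le> B"
    if "q \<in> set (splits bs)" for q
  proof -
    have q: "set (fst q) \<subseteq> Basis" "set (snd q) \<subseteq> Basis"
      using splits_subset[of "fst q" "snd q" bs] that bs by auto
    from p q obtain C m where C: "\<And>x. cmod (iter_deriv (fst q) p x) \<le> C * (1 + norm x) ^ m"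
      unfolding poly_growth_def by metis
    \<comment> \<open>The growth \<open>m\<close> of the multiplier is paid for by a stronger weight
      on \<phi>.\<close>
    obtain B where B: "\<And>x. (1 + norm x) ^ (m + k) * cmod (iter_deriv (snd q) \<phi> x) \<le> B"
      using schwartz_bound[OF \<phi> q(2)] by metis
    have C0: "0 \<le> C" using order_trans[OF norm_ge_zero C[of 0]] by simp
    have "(1 + norm x) ^ k * cmod (iter_deriv (fst q) p x * iter_deriv (snd q) \<phi> x) \<le> C * B" for x
    proof -
      have "(1 + norm x) ^ k * cmod (iter_deriv (fst q) p x * iter_deriv (snd q) \<phi> x)
          \<le> (1 + norm x) ^ k * ((C * (1 + norm x) ^ m) * cmod (iter_deriv (snd q) \<phi> x))"
        unfolding norm_mult by (intro mult_left_mono mult_right_mono C) auto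
      also have "\<dots> = C * ((1 + norm x) ^ (m + k) * cmod (iter_deriv (snd q) \<phi> x))"
        by (simp add: power_add mult_ac)
      also have "\<dots> \<le> C * B" by (intro mult_left_mono B C0)
      finally show ?thesis .
    qed
    then show ?thesis by blast
  qed
  then obtain B where B: "\<And>q x. q \<in> set (splits bs) \<Longrightarrow>
      (1 + norm x) ^ k * cmod (iter_deriv (fst q) p x * iter_deriv (snd q) \<phi> x) \<le> B q"
    by metis
  show "\<exists>C. \<forall>x. (1 + norm x) ^ k * cmod (iter_deriv bs (\<lambda>x. p x * \<phi> x) x) \<le> C"
  proof (intro exI allI)
    fix x
    have "(1 + norm x) ^ k * cmod (iter_deriv bs (\<lambda>x. p x * \<phi> x) x)
        \<le> (1 + norm x) ^ k * (\<Sum>q\<leftarrow>splits bs. cmod (iter_deriv (fst q) p x * iter_deriv (snd q) \<phi> x))"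
      unfolding smooth_mult(2)[OF sp schwartz_smooth[OF \<phi>] bs]
      by (intro mult_left_mono) (auto intro: norm_sum_list_le)
    also have "\<dots> = (\<Sum>q\<leftarrow>splits bs. (1 + norm x) ^ k * cmod (iter_deriv (fst q) p x * iter_deriv (snd q) \<phi> x))"
      by (simp add: sum_list_const_mult)
    also have "\<dots> \<le> (\<Sum>q\<leftarrow>splits bs. B q)"
      by (rule sum_list_mono) (rule B)
    finally show "(1 + norm x) ^ k * cmod (iter_deriv bs (\<lambda>x. p x * \<phi> x) x) \<le> (\<Sum>q\<leftarrow>splits bs. B q)" .
  qed
qed

lemma schwartz_iter_deriv:
  assumes "\<phi> \<in> schwartz" "set bs \<subseteq> Basis"
  shows "iter_deriv bs \<phi> \<in> schwartz"
proof (rule schwartzI)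
  show "smooth (iter_deriv bs \<phi>)" using assms by (simp add: schwartz_smooth smooth_iter_deriv)
  fix k and cs :: "'a list" assume "set cs \<subseteq> Basis"
  then have "set (cs @ bs) \<subseteq> Basis" using assms by simp
  then show "\<exists>C. \<forall>x. (1 + norm x) ^ k * cmod (iter_deriv cs (iter_deriv bs \<phi>) x) \<le> C"
    unfolding iter_deriv_append[symmetric] using schwartz_bound[OF assms(1)] by metis
qed

lemma schwartz_linear_combination:
  assumes "\<phi> \<in> schwartz" "\<psi> \<in> schwartz"
  shows "(\<lambda>x. a * \<phi> x + b * \<psi> x) \<in> schwartz"
proof (rule schwartzI)
  have s: "smooth \<phi>" "smooth \<psi>" using assms by (auto simp: schwartz_smooth)
  then show "smooth (\<lambda>x. a * \<phi> x + b * \<psi> x)" by (rule smooth_linear_combination)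
  fix k and bs :: "'a list" assume bs: "set bs \<subseteq> Basis"
  obtain A B where A: "\<And>x. (1 + norm x) ^ k * cmod (iter_deriv bs \<phi> x) \<le> A"
    and B: "\<And>x. (1 + norm x) ^ k * cmod (iter_deriv bs \<psi> x) \<le> B"
    using schwartz_bound[OF assms(1) bs] schwartz_bound[OF assms(2) bs] by metis
  show "\<exists>C. \<forall>x. (1 + norm x) ^ k * cmod (iter_deriv bs (\<lambda>x. a * \<phi> x + b * \<psi> x) x) \<le> C"
  proof (intro exI allI)
    fix x
    have "(1 + norm x) ^ k * cmod (iter_deriv bs (\<lambda>x. a * \<phi> x + b * \<psi> x) x)
      \<le> (1 + norm x) ^ k * (cmod a * cmod (iter_deriv bs \<phi> x) + cmod b * cmod (iter_deriv bs \<psi> x))"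
      unfolding smooth_linear_combination(2)[OF s bs]
      by (intro mult_left_mono) (auto simp flip: norm_mult intro: norm_triangle_ineq)
    also have "\<dots> = cmod a * ((1 + norm x) ^ k * cmod (iter_deriv bs \<phi> x))
       + cmod b * ((1 + norm x) ^ k * cmod (iter_deriv bs \<psi> x))"
      by (simp add: algebra_simps)
    also have "\<dots> \<le> cmod a * A + cmod b * B"
      by (intro add_mono mult_left_mono A B) auto
    finally show "(1 + norm x) ^ k * cmod (iter_deriv bs (\<lambda>x. a * \<phi> x + b * \<psi> x) x)
      \<le> cmod a * A + cmod b * B" .
  qed
qed

lemma schwartz_cmult: "\<phi> \<in> schwartz \<Longrightarrow> (\<lambda>x. a * \<phi> x) \<in> schwartz"
  using schwartz_linear_combination[of \<phi> \<phi> a 0] by simp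

lemma schwartz_reflect:
  assumes "\<phi> \<in> schwartz"
  shows "(\<lambda>x. \<phi> (- x)) \<in> schwartz"
proof (rule schwartzI)
  show "smooth (\<lambda>x. \<phi> (- x))"
    using smooth_scaleR(1)[OF schwartz_smooth[OF assms], of "-1"] by simp
  fix k and bs :: "'a list" assume bs: "set bs \<subseteq> Basis"
  obtain C where C: "\<And>x. (1 + norm x) ^ k * cmod (iter_deriv bs \<phi> x) \<le> C"
    using schwartz_bound[OF assms bs] by metis
  have "cmod (iter_deriv bs (\<lambda>x. \<phi> (- x)) x) = cmod (iter_deriv bs \<phi> (- x))" for x
    using smooth_scaleR(2)[OF schwartz_smooth[OF assms] bs, of "-1"] by (simp add: norm_power)
  then show "\<exists>C. \<forall>x. (1 + norm x) ^ k * cmod (iter_deriv bs (\<lambda>x. \<phi> (- x)) x) \<le> C"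
    using C[of "- x" for x] by auto
qed

lemma test_functions_subset_schwartz: "test_functions \<subseteq> schwartz"
proof
  fix \<phi> :: "'a \<Rightarrow> complex" assume "\<phi> \<in> test_functions"
  then have \<phi>: "smooth \<phi>" "compact (supp \<phi>)" by (auto simp: test_functions_def)
  show "\<phi> \<in> schwartz"
  proof (rule schwartzI[OF \<phi>(1)])
    fix k and bs :: "'a list" assume bs: "set bs \<subseteq> Basis"
    let ?g = "\<lambda>x. (1 + norm x) ^ k * cmod (iter_deriv bs \<phi> x)"
    have "continuous_on (supp \<phi>) ?g"
      by (intro continuous_intros continuous_on_iter_deriv \<phi> bs)
    then have "bounded (?g ` supp \<phi>)"
      using \<phi>(2) by (intro compact_imp_bounded compact_continuous_image)
    then obtain C where "\<And>x. x \<in> supp \<phi> \<Longrightarrow> \<bar>?g x\<bar> \<le> C"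
      by (auto simp: bounded_iff)
    then have C: "\<And>x. x \<in> supp \<phi> \<Longrightarrow> ?g x \<le> C"
      by (meson abs_ge_self order_trans)
    have "?g x \<le> max C 0" for x
      using C[of x] iter_deriv_zero_outside[of x \<phi> bs] by (cases "x \<in> supp \<phi>") auto
    then show "\<exists>C. \<forall>x. ?g x \<le> C" by blast
  qed
qed

section \<open>Bumps, cutoffs and truncation of Schwartz functions\<close>

lemma smooth_flat_exp: "smooth (\<lambda>x. complex_of_real (flat_exp 0 (x \<bullet> w + d)))"
  by (rule smooth_compose_linear(1)[of "\<lambda>k t. complex_of_real (flat_exp k t)"])
    (use flat_exp_has_derivative in
      \<open>auto intro!: has_vector_derivative_of_real simp: has_real_derivative_iff_has_vector_derivative\<close>)

text \<open>The parameter \<open>r\<close> is a steepness: \<open>r = 1\<close> gives a fixed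
  cutoff, while large \<open>r\<close> recovers the indicator of the open box from below.\<close>

definition box_bump :: "real \<Rightarrow> 'a::euclidean_space \<Rightarrow> 'a \<Rightarrow> 'a \<Rightarrow> real" where
  "box_bump r a b x = (\<Prod>i\<in>Basis. flat_exp 0 (r * (x \<bullet> i - a \<bullet> i)) * flat_exp 0 (r * (b \<bullet> i - x \<bullet> i)))"

lemma box_bump_test_function:
  assumes r: "r > 0"
  shows "(\<lambda>x. complex_of_real (box_bump r a b x)) \<in> test_functions"
proof (rule test_functionsI[where K = "cbox a b"])
  have "smooth (\<lambda>x::'a. complex_of_real (flat_exp 0 (x \<bullet> (r *\<^sub>R i) + (- (r * (a \<bullet> i))))) *
      complex_of_real (flat_exp 0 (x \<bullet> ((- r) *\<^sub>R i) + r * (b \<bullet> i))))" for i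
    by (intro smooth_mult smooth_flat_exp)
  then have "smooth (\<lambda>x::'a. complex_of_real (flat_exp 0 (r * (x \<bullet> i - a \<bullet> i)) * flat_exp 0 (r * (b \<bullet> i - x \<bullet> i))))" for i
    by (simp add: algebra_simps)
  then show "smooth (\<lambda>x. complex_of_real (box_bump r a b x))"
    unfolding box_bump_def of_real_prod by (intro smooth_prod)
  fix x :: 'a assume "x \<notin> cbox a b"
  then obtain i where i: "i \<in> Basis" "x \<bullet> i < a \<bullet> i \<or> x \<bullet> i > b \<bullet> i"
    by (auto simp: mem_box not_le)
  then have "r * (x \<bullet> i - a \<bullet> i) \<le> 0 \<or> r * (b \<bullet> i - x \<bullet> i) \<le> 0"
    using r by (auto simp: mult_le_0_iff)
  then have "flat_exp 0 (r * (x \<bullet> i - a \<bullet> i)) * flat_exp 0 (r * (b \<bullet> i - x \<bullet> i)) = 0"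
    by (auto simp: flat_exp_eq_0)
  then show "complex_of_real (box_bump r a b x) = 0"
    unfolding box_bump_def using i(1) by (auto intro!: prod_zero)
qed simp

text \<open>Each coordinate contributes \<open>exp (-1) * exp (-1)\<close> at the origin, hence the
  factor that normalises the value there to 1.\<close>

definition cutoff :: "'a::euclidean_space \<Rightarrow> complex" where
  "cutoff x = of_real (exp 2 ^ DIM('a)) * of_real (box_bump 1 (- One) One x)"

lemma cutoff_test_function: "cutoff \<in> test_functions"
  unfolding cutoff_def[abs_def]
  by (intro test_functions_mult(1) smooth_const box_bump_test_function) simp

lemma cutoff_0: "cutoff 0 = 1"
proof -
  have "box_bump 1 (- One) One (0::'a) = (exp (-1) * exp (-1)) ^ DIM('a)"
    by (simp add: box_bump_def flat_exp_def)
  then have "exp 2 ^ DIM('a) * box_bump 1 (- One) One (0::'a) = 1"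
    by (simp flip: power_mult_distrib exp_add)
  then show ?thesis by (simp only: cutoff_def of_real_mult[symmetric] of_real_1)
qed

text \<open>Bounded partial derivatives and the mean value inequality. After rescaling by 1 / n this
  yields the rate 1 / n at the price of one power of \<open>norm x\<close>.\<close>

lemma cutoff_lipschitz: obtains L where "L \<ge> 0" "\<And>x::'a::euclidean_space. cmod (cutoff x - 1) \<le> L * norm x"
proof -
  let ?\<chi> = "cutoff :: 'a \<Rightarrow> complex"
  have S: "?\<chi> \<in> schwartz" using cutoff_test_function test_functions_subset_schwartz by blast
  have "\<exists>C. \<forall>x. cmod (iter_deriv [b] ?\<chi> x) \<le> C" if "b \<in> Basis" for b
    using schwartz_bound[OF S, of "[b]" 0] that by (metis empty_set list.simps(15) mult_1
        power_0 insert_subset empty_subsetI)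
  then obtain C where C: "\<And>b x. b \<in> Basis \<Longrightarrow> cmod (iter_deriv [b] ?\<chi> x) \<le> C b" by metis
  have "norm (frechet_derivative ?\<chi> (at x) h) \<le> (\<Sum>b\<in>Basis. C b) * norm h" for x h
  proof -
    have "norm (frechet_derivative ?\<chi> (at x) h) \<le> (\<Sum>b\<in>Basis. norm ((h \<bullet> b) *\<^sub>R iter_deriv [b] ?\<chi> x))"
      unfolding frechet_derivative_eq_sum_Basis[OF smooth_differentiable[OF schwartz_smooth[OF S]]]
      by (rule norm_sum)
    also have "\<dots> \<le> (\<Sum>b\<in>Basis. norm h * C b)"
      unfolding norm_scaleR by (intro sum_mono mult_mono C) (auto simp: Basis_le_norm)
    finally show ?thesis by (simp add: sum_distrib_left mult.commute)
  qed
  then have o: "onorm (frechet_derivative ?\<chi> (at x)) \<le> (\<Sum>b\<in>Basis. C b)" for x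
    by (rule onorm_le)
  have "norm (cutoff x - cutoff (0::'a)) \<le> (\<Sum>b\<in>Basis. C b) * norm (x - (0::'a))" for x
    by (rule differentiable_bound[of UNIV ?\<chi> "\<lambda>x. frechet_derivative ?\<chi> (at x)" _ x 0])
      (auto simp: o smooth_has_derivative schwartz_smooth[OF S])
  then show ?thesis
    using that[of "\<Sum>b\<in>Basis. C b"] C order_trans[OF norm_ge_zero C]
    by (auto simp: cutoff_0 intro!: sum_nonneg)
qed

text \<open>The factor 1 / n has two sources: the Lipschitz bound when no derivative is taken, the
  chain rule as soon as there is one. In the second case \<open>1 + norm x\<close> is there to give
  both cases one form.\<close>

lemma iter_deriv_cutoff_bound:
  assumes "set bs \<subseteq> Basis"
  obtains C where "C \<ge> 0" "\<And>n x. n \<ge> 1 \<Longrightarrow>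
    cmod (iter_deriv bs (\<lambda>x::'a::euclidean_space. cutoff (inverse n *\<^sub>R x) - 1) x) \<le> C * (1 + norm x) / n"
proof (cases bs)
  case Nil
  obtain L where L: "L \<ge> 0" "\<And>x::'a. cmod (cutoff x - 1) \<le> L * norm x"
    using cutoff_lipschitz by metis
  have "cmod (cutoff (inverse n *\<^sub>R x) - 1) \<le> L * (1 + norm x) / n" if "n \<ge> 1" for x :: 'a and n
  proof -
    have "cmod (cutoff (inverse n *\<^sub>R x) - 1) \<le> L * norm x / n"
      using L(2)[of "inverse n *\<^sub>R x"] that by (simp add: divide_inverse mult_ac)
    also have "\<dots> \<le> L * (1 + norm x) / n"
      using L(1) that by (intro divide_right_mono mult_left_mono) auto
    finally show ?thesis .
  qed
  then show ?thesis using that[of L] L(1) Nil by simp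
next
  case (Cons b cs)
  let ?\<chi> = "cutoff :: 'a \<Rightarrow> complex"
  have S: "?\<chi> \<in> schwartz" using cutoff_test_function test_functions_subset_schwartz by blast
  then have sm: "smooth ?\<chi>" by (rule schwartz_smooth)
  obtain C where C: "C \<ge> 0" "\<And>x. (1 + norm x) ^ 0 * cmod (iter_deriv bs ?\<chi> x) \<le> C"
    using schwartz_bound[OF S assms] by metis
  have "cmod (iter_deriv bs (\<lambda>x::'a. cutoff (inverse n *\<^sub>R x) - 1) x) \<le> C * (1 + norm x) / n"
    if n: "n \<ge> 1" for n x
  proof -
    have "iter_deriv bs (\<lambda>x::'a. cutoff (inverse n *\<^sub>R x) - 1) x
       = inverse n ^ length bs *\<^sub>R iter_deriv bs ?\<chi> (inverse n *\<^sub>R x)"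
      using smooth_linear_combination(2)[OF smooth_scaleR(1)[OF sm, of "inverse n"] smooth_const(1)[of 1] assms, of 1 "-1"]
        smooth_scaleR(2)[OF sm assms, of "inverse n"] 
        smooth_const(2)[OF assms, of 1] Cons
      by (simp del: iter_deriv.simps)
    then have "cmod (iter_deriv bs (\<lambda>x::'a. cutoff (inverse n *\<^sub>R x) - 1) x)
       = inverse n ^ length bs * cmod (iter_deriv bs ?\<chi> (inverse n *\<^sub>R x))"
      using n by simp
    also have "\<dots> \<le> inverse n * C"
    proof (intro mult_mono)
      show "inverse n ^ length bs \<le> inverse n"
        using power_decreasing[of 1 "length bs" "inverse n"] n Cons by (simp add: field_simps)
    qed (use C n in auto)
    also have "\<dots> \<le> C * (1 + norm x) / n"
      using C n by (simp add: divide_inverse mult.commute mult_right_mono algebra_simps)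
    finally show ?thesis .
  qed
  then show ?thesis using that C(1) by blast
qed

text \<open>Quantitative density of test functions: the factor \<open>1 + norm x\<close> lost by the
  cutoff is absorbed by one more power of the weight on \<phi>, which leaves the rate 1 / n in every
  seminorm.\<close>

lemma seminorm_cutoff_le:
  assumes \<phi>: "\<phi> \<in> schwartz"
  obtains C where "\<And>n::real. n \<ge> 1 \<Longrightarrow>
    seminorm k N (\<lambda>x::'a::euclidean_space. (cutoff (inverse n *\<^sub>R x) - 1) * \<phi> x) \<le> C / n"
proof -
  let ?h = "\<lambda>n (x::'a). cutoff (inverse n *\<^sub>R x) - 1"
  have S: "cutoff \<in> schwartz" using cutoff_test_function test_functions_subset_schwartz by blast
  have sh: "smooth (?h n)" for n
    using smooth_linear_combination(1)[OF smooth_scaleR(1)[OF schwartz_smooth[OF S], of "inverse n"]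
        smooth_const(1)[of 1], of 1 "-1"] by simp
  have "\<exists>B. \<forall>n\<ge>1. \<forall>x. (1 + norm x) ^ k * cmod (iter_deriv bs (\<lambda>x. ?h n x * \<phi> x) x) \<le> B / n"
    if bs: "set bs \<subseteq> Basis" for bs
  proof -
    have "\<exists>B. \<forall>n\<ge>1. \<forall>x. (1 + norm x) ^ k * cmod (iter_deriv (fst q) (?h n) x * iter_deriv (snd q) \<phi> x) \<le> B / n"
      if "q \<in> set (splits bs)" for q
    proof -
      have q: "set (fst q) \<subseteq> Basis" "set (snd q) \<subseteq> Basis"
        using splits_subset[of "fst q" "snd q" bs] that bs by auto
      obtain C where C: "C \<ge> 0" "\<And>n x. n \<ge> 1 \<Longrightarrow> cmod (iter_deriv (fst q) (?h n) x) \<le> C * (1 + norm x) / n"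
        using iter_deriv_cutoff_bound[OF q(1)] by metis
      obtain B where B: "\<And>x. (1 + norm x) ^ Suc k * cmod (iter_deriv (snd q) \<phi> x) \<le> B"
        using schwartz_bound[OF \<phi> q(2)] by metis
      have "(1 + norm x) ^ k * cmod (iter_deriv (fst q) (?h n) x * iter_deriv (snd q) \<phi> x) \<le> C * B / n"
        if n: "n \<ge> 1" for n x
      proof -
        have "(1 + norm x) ^ k * cmod (iter_deriv (fst q) (?h n) x * iter_deriv (snd q) \<phi> x)
          \<le> (1 + norm x) ^ k * ((C * (1 + norm x) / n) * cmod (iter_deriv (snd q) \<phi> x))"
          unfolding norm_mult by (intro mult_left_mono mult_right_mono C n) auto
        also have "\<dots> = C * ((1 + norm x) ^ Suc k * cmod (iter_deriv (snd q) \<phi> x)) / n"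
          by (simp add: mult_ac)
        also have "\<dots> \<le> C * B / n" using n by (intro divide_right_mono mult_left_mono B C) auto
        finally show ?thesis .
      qed
      then show ?thesis by blast
    qed
    then obtain B where B: "\<And>q n x. q \<in> set (splits bs) \<Longrightarrow> n \<ge> 1 \<Longrightarrow>
        (1 + norm x) ^ k * cmod (iter_deriv (fst q) (?h n) x * iter_deriv (snd q) \<phi> x) \<le> B q / n"
      by metis
    have "(1 + norm x) ^ k * cmod (iter_deriv bs (\<lambda>x. ?h n x * \<phi> x) x) \<le> (\<Sum>q\<leftarrow>splits bs. B q) / n"
      if n: "n \<ge> 1" for n x
    proof -
      have "(1 + norm x) ^ k * cmod (iter_deriv bs (\<lambda>x. ?h n x * \<phi> x) x)
        \<le> (1 + norm x) ^ k * (\<Sum>q\<leftarrow>splits bs. cmod (iter_deriv (fst q) (?h n) x * iter_deriv (snd q) \<phi> x))"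
        unfolding smooth_mult(2)[OF sh schwartz_smooth[OF \<phi>] bs]
        by (intro mult_left_mono) (auto intro: norm_sum_list_le)
      also have "\<dots> = (\<Sum>q\<leftarrow>splits bs. (1 + norm x) ^ k * cmod (iter_deriv (fst q) (?h n) x * iter_deriv (snd q) \<phi> x))"
        by (simp add: sum_list_const_mult)
      also have "\<dots> \<le> (\<Sum>q\<leftarrow>splits bs. B q / n)"
        by (rule sum_list_mono) (rule B[OF _ n])
      finally show ?thesis by (simp add: divide_inverse sum_list_mult_const)
    qed
    then show ?thesis by blast
  qed
  then obtain B where B: "\<And>bs n x. set bs \<subseteq> Basis \<Longrightarrow> n \<ge> 1 \<Longrightarrow>
      (1 + norm x) ^ k * cmod (iter_deriv bs (\<lambda>x. ?h n x * \<phi> x) x) \<le> B bs / n"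
    by metis
  have "seminorm k N (\<lambda>x. ?h n x * \<phi> x) \<le> (\<Sum>bs | set bs \<subseteq> Basis \<and> length bs \<le> N. B bs) / n"
    if "n \<ge> 1" for n
    unfolding sum_divide_distrib using B that by (intro seminorm_le) auto
  then show ?thesis using that by blast
qed

text \<open>Each functional is continuous for some seminorm, so its value at \<phi> differs from its
  value at a truncation of \<phi> by O(1 / n), and truncations are test functions. This justifies
  the description in \<open>tempered_ext\<close>.\<close>

lemma tempered_eqI:
  assumes T: "T \<in> tempered_distributions" and U: "U \<in> tempered_distributions"
    and eq: "\<And>\<phi>. \<phi> \<in> test_functions \<Longrightarrow> T \<phi> = U \<phi>"
  shows "T = U"
proof (rule extensionalityI)
  show "T \<in> extensional schwartz" "U \<in> extensional schwartz"
    using T U by (auto simp: tempered_distributions_def)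
  fix \<phi> :: "'a \<Rightarrow> complex" assume \<phi>: "\<phi> \<in> schwartz"
  obtain N C where N: "\<And>\<phi>. \<phi> \<in> schwartz \<Longrightarrow> cmod (T \<phi>) \<le> C * seminorm N N \<phi>"
    using T by (auto simp: tempered_distributions_def)
  obtain M D where M: "\<And>\<phi>. \<phi> \<in> schwartz \<Longrightarrow> cmod (U \<phi>) \<le> D * seminorm M M \<phi>"
    using U by (auto simp: tempered_distributions_def)
  obtain A where A: "\<And>n. n \<ge> 1 \<Longrightarrow> seminorm N N (\<lambda>x. (cutoff (inverse n *\<^sub>R x) - 1) * \<phi> x) \<le> A / n"
    using seminorm_cutoff_le[OF \<phi>, of N N] by blast
  obtain B where B: "\<And>n. n \<ge> 1 \<Longrightarrow> seminorm M M (\<lambda>x. (cutoff (inverse n *\<^sub>R x) - 1) * \<phi> x) \<le> B / n"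
    using seminorm_cutoff_le[OF \<phi>, of M M] by blast
  have le: "cmod (T \<phi> - U \<phi>) \<le> (\<bar>C\<bar> * A + \<bar>D\<bar> * B) * inverse (real (Suc n))" for n
  proof -
    let ?n = "real (Suc n)"
    let ?c = "\<lambda>x::'a. cutoff (inverse ?n *\<^sub>R x)" let ?\<psi> = "\<lambda>x. ?c x * \<phi> x"
    let ?r = "\<lambda>x. (?c x - 1) * \<phi> x"
    have cs: "smooth ?c"
      using cutoff_test_function[where 'a='a] by (intro smooth_scaleR(1)) (simp add: test_functions_def)
    have ct: "?c \<in> test_functions"
    proof (rule test_functionsI[OF cs, where K = "(\<lambda>x. ?n *\<^sub>R x) ` supp cutoff"])
      show "compact ((\<lambda>x::'a. ?n *\<^sub>R x) ` supp cutoff)"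
        using cutoff_test_function[where 'a='a] by (intro compact_scaling) (simp add: test_functions_def)
      fix x :: 'a assume x: "x \<notin> (\<lambda>x. ?n *\<^sub>R x) ` supp cutoff"
      have "inverse ?n *\<^sub>R x \<notin> supp cutoff"
      proof
        assume "inverse ?n *\<^sub>R x \<in> supp cutoff"
        then have "?n *\<^sub>R (inverse ?n *\<^sub>R x) \<in> (\<lambda>x. ?n *\<^sub>R x) ` supp cutoff" by (rule imageI)
        moreover have "?n *\<^sub>R (inverse ?n *\<^sub>R x) = x" by (simp del: of_nat_Suc)
        ultimately show False using x by simp
      qed
      then show "?c x = 0" using iter_deriv_zero_outside[of _ cutoff "[]"] by simp
    qed
    have "(\<lambda>x. \<phi> x * ?c x) \<in> test_functions"
      by (rule test_functions_mult(1)[OF schwartz_smooth[OF \<phi>] ct])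
    then have \<psi>: "?\<psi> \<in> test_functions" by (simp add: mult.commute)
    then have \<psi>S: "?\<psi> \<in> schwartz" using test_functions_subset_schwartz by blast
    \<comment> \<open>Linearity is given for combinations
      \<open>a * \<phi> x + b * \<psi> x\<close>, so the remainder is brought into that
      shape.\<close>
    have r: "?r = (\<lambda>x. 1 * ?\<psi> x + (- 1) * \<phi> x)" by (simp add: algebra_simps)
    have rS: "?r \<in> schwartz" unfolding r by (rule schwartz_linear_combination[OF \<psi>S \<phi>])
    have "T ?r = 1 * T ?\<psi> + (- 1) * T \<phi>" "U ?r = 1 * U ?\<psi> + (- 1) * U \<phi>"
      unfolding r using T U \<phi> \<psi>S by (auto simp only: tempered_distributions_def linear_functional_on_def mem_Collect_eq)
    then have "T \<phi> - U \<phi> = U ?r - T ?r" using eq[OF \<psi>] by simp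
    then have "cmod (T \<phi> - U \<phi>) \<le> cmod (U ?r) + cmod (T ?r)" by (simp add: norm_triangle_ineq4)
    also have "\<dots> \<le> D * seminorm M M ?r + C * seminorm N N ?r" by (intro add_mono M N rS)
    also have "\<dots> \<le> \<bar>D\<bar> * (B / ?n) + \<bar>C\<bar> * (A / ?n)"
      using rS by (intro add_mono mult_mono A B) (auto simp: seminorm_nonneg)
    finally show ?thesis by (simp add: divide_inverse algebra_simps del: of_nat_Suc)
  qed
  have "(\<lambda>n. (\<bar>C\<bar> * A + \<bar>D\<bar> * B) * inverse (real (Suc n))) \<longlonglongrightarrow> (\<bar>C\<bar> * A + \<bar>D\<bar> * B) * 0"
    by (intro tendsto_intros LIMSEQ_inverse_real_of_nat)
  then have "cmod (T \<phi> - U \<phi>) \<le> (\<bar>C\<bar> * A + \<bar>D\<bar> * B) * 0"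
    by (rule LIMSEQ_le_const) (use le in blast)
  then show "T \<phi> = U \<phi>" by simp
qed

lemma tempered_ext_eq:
  assumes "T \<in> tempered_distributions" "restrict T test_functions = w"
  shows "tempered_ext w = T"
  unfolding tempered_ext_def
proof (rule the_equality)
  fix U assume "U \<in> tempered_distributions \<and> restrict U test_functions = w"
  then show "U = T"
    using assms by (intro tempered_eqI) (auto dest!: fun_cong split: if_splits)
qed (use assms in blast)

section \<open>The Fourier transform on the Schwartz space\<close>

lemma lborel_prod_coordinates:
  fixes f :: "'a::euclidean_space \<Rightarrow> real \<Rightarrow> 'b::{real_normed_field, banach, second_countable_topology}"
  assumes f: "\<And>b. b \<in> Basis \<Longrightarrow> integrable lborel (f b)"
  shows "integrable lborel (\<lambda>x::'a. \<Prod>b\<in>Basis. f b (x \<bullet> b))"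
    and "(LINT x::'a|lborel. (\<Prod>b\<in>Basis. f b (x \<bullet> b))) = (\<Prod>b\<in>Basis. LINT t|lborel. f b t)"
proof -
  interpret product_sigma_finite "\<lambda>_::'a. lborel :: real measure" ..
  have [measurable]: "f b \<in> borel_measurable borel" if "b \<in> Basis" for b
    using borel_measurable_integrable[OF f[OF that]] by simp
  have T: "(\<lambda>g. \<Sum>b\<in>Basis. g b *\<^sub>R b) \<in> measurable (Pi\<^sub>M Basis (\<lambda>_::'a. lborel :: real measure)) borel"
    by measurable
  have m: "(\<lambda>x::'a. \<Prod>b\<in>Basis. f b (x \<bullet> b)) \<in> borel_measurable borel" by measurable
  have eq: "(\<Prod>b\<in>Basis. f b ((\<Sum>i\<in>Basis. g i *\<^sub>R i) \<bullet> b)) = (\<Prod>b\<in>Basis. f b (g b))" for g :: "'a \<Rightarrow> real"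
    by (intro prod.cong) simp_all
  show "integrable lborel (\<lambda>x::'a. \<Prod>b\<in>Basis. f b (x \<bullet> b))"
    unfolding lborel_eq[where 'a='a] integrable_distr_eq[OF T m] eq
    by (intro product_integrable_prod f) auto
  show "(LINT x::'a|lborel. (\<Prod>b\<in>Basis. f b (x \<bullet> b))) = (\<Prod>b\<in>Basis. LINT t|lborel. f b t)"
    unfolding lborel_eq[where 'a='a] integral_distr[OF T m] eq
    by (subst product_integral_prod) (auto intro: f simp flip: lborel_eq)
qed

lemma lborel_integral_affine:
  fixes f :: "'a::euclidean_space \<Rightarrow> 'b::{banach, second_countable_topology}"
  assumes [measurable]: "f \<in> borel_measurable borel" and c: "c \<noteq> 0"
  shows "integral\<^sup>L lborel f = \<bar>c\<bar> ^ DIM('a) *\<^sub>R (LINT x|lborel. f (t + c *\<^sub>R x))"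
proof -
  have "integral\<^sup>L lborel f = integral\<^sup>L (density (distr lborel borel (\<lambda>x. t + c *\<^sub>R x)) (\<lambda>_. \<bar>c\<bar> ^ DIM('a))) f"
    using lborel_affine[OF c, of t] by simp
  also have "\<dots> = \<bar>c\<bar> ^ DIM('a) *\<^sub>R (LINT x|lborel. f (t + c *\<^sub>R x))"
    by (subst integral_density) (auto simp: integral_distr)
  finally show ?thesis .
qed

abbreviation decay :: "'a::euclidean_space \<Rightarrow> real" where
  "decay x \<equiv> inverse ((1 + norm x) ^ (2 * DIM('a)))"

text \<open>The majorant is a product of the one-dimensional functions
  \<open>inverse (1 + t\<^sup>2)\<close>. Each coordinate costs a factor
  \<open>(1 + norm x)\<^sup>2\<close>, which explains the generous exponent
  \<open>2 * DIM('a)\<close>.\<close>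

lemma integrable_decay: "integrable lborel (decay :: 'a::euclidean_space \<Rightarrow> real)"
proof (rule Bochner_Integration.integrable_bound)
  have "integrable lborel (\<lambda>t::real. inverse (1 + t\<^sup>2))"
    using integrable_inverse_1_plus_square by (simp add: set_integrable_def einterval_def)
  then show "integrable lborel (\<lambda>x::'a. \<Prod>b\<in>Basis. inverse (1 + (x \<bullet> b)\<^sup>2))"
    by (rule lborel_prod_coordinates(1))
  show "AE x in lborel. norm (decay x) \<le> norm (\<Prod>b\<in>Basis. inverse (1 + (x \<bullet> (b::'a))\<^sup>2))"
  proof (rule AE_I2)
    fix x :: 'a
    have "(\<Prod>b\<in>Basis. 1 + (x \<bullet> b)\<^sup>2) \<le> (\<Prod>b\<in>(Basis :: 'a set). (1 + norm x)\<^sup>2)"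
    proof (intro prod_mono conjI)
      fix b :: 'a assume "b \<in> Basis"
      then have "(x \<bullet> b)\<^sup>2 \<le> (norm x)\<^sup>2"
        by (metis Basis_le_norm abs_ge_zero power2_abs power_mono)
      also have "1 + (norm x)\<^sup>2 \<le> (1 + norm x)\<^sup>2" by (simp add: power2_sum)
      finally show "1 + (x \<bullet> b)\<^sup>2 \<le> (1 + norm x)\<^sup>2" by simp
    qed simp
    also have "\<dots> = (1 + norm x) ^ (2 * DIM('a))" by (simp add: power_mult)
    finally have le: "(\<Prod>b\<in>Basis. 1 + (x \<bullet> b)\<^sup>2) \<le> (1 + norm x) ^ (2 * DIM('a))" .
    have pos: "0 < (\<Prod>b\<in>Basis. 1 + (x \<bullet> b)\<^sup>2)" by (intro prod_pos) (auto intro: add_pos_nonneg)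
    have "decay x \<le> inverse (\<Prod>b\<in>Basis. 1 + (x \<bullet> b)\<^sup>2)"
      by (rule le_imp_inverse_le[OF le pos])
    also have "\<dots> = (\<Prod>b\<in>Basis. inverse (1 + (x \<bullet> b)\<^sup>2))" by (simp add: prod_inversef[symmetric] o_def)
    finally have "decay x \<le> (\<Prod>b\<in>Basis. inverse (1 + (x \<bullet> b)\<^sup>2))" .
    then show "norm (decay x) \<le> norm (\<Prod>b\<in>Basis. inverse (1 + (x \<bullet> b)\<^sup>2))"
      by (simp add: abs_of_nonneg prod_nonneg)
  qed
qed simp

lemma le_decay: "(1 + norm x) ^ (2 * DIM('a)) * r \<le> C \<longleftrightarrow> r \<le> C * decay (x::'a::euclidean_space)"
  by (simp add: divide_inverse[symmetric] pos_le_divide_eq mult.commute add_pos_nonneg)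

lemma integrable_decay_bound:
  fixes f :: "'a::euclidean_space \<Rightarrow> 'b::{banach, second_countable_topology}"
  assumes [measurable]: "f \<in> borel_measurable borel"
    and le: "\<And>x. (1 + norm x) ^ (2 * DIM('a)) * norm (f x) \<le> C"
  shows "integrable lborel f" and "(LINT x|lborel. norm (f x)) \<le> C * (LINT x::'a|lborel. decay x)"
proof -
  have i: "integrable lborel (\<lambda>x::'a. C * decay x)" using integrable_decay[where 'a='a] by simp
  have le': "norm (f x) \<le> C * decay x" for x using le[of x] by (simp only: le_decay)
  show f: "integrable lborel f"
    by (rule Bochner_Integration.integrable_bound[OF i]) (auto intro!: AE_I2 order_trans[OF le'])
  have "(LINT x|lborel. norm (f x)) \<le> (LINT x::'a|lborel. C * decay x)"
    by (rule integral_mono) (use f i le' in auto)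
  then show "(LINT x|lborel. norm (f x)) \<le> C * (LINT x::'a|lborel. decay x)" by simp
qed

lemma schwartz_measurable: "\<phi> \<in> schwartz \<Longrightarrow> \<phi> \<in> borel_measurable borel"
  using iter_deriv_measurable[of \<phi> "[]"] by (simp add: schwartz_smooth)

lemma schwartz_weight_integrable:
  assumes "\<phi> \<in> schwartz"
  shows "integrable lborel (\<lambda>x. (1 + norm x) ^ k * cmod (\<phi> x))"
proof -
  note [measurable] = schwartz_measurable[OF assms]
  obtain C where "\<And>x. (1 + norm x) ^ (2 * DIM('a) + k) * cmod (iter_deriv [] \<phi> x) \<le> C"
    using schwartz_bound[OF assms, of "[]"] by (metis empty_set empty_subsetI)
  then show ?thesis
    by (intro integrable_decay_bound(1)[where C = C]) (auto simp: power_add abs_mult mult_ac)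
qed

lemma schwartz_integrable: "\<phi> \<in> schwartz \<Longrightarrow> integrable lborel \<phi>"
  using schwartz_weight_integrable[of \<phi> 0] integrable_norm_iff[of \<phi> lborel] schwartz_measurable[of \<phi>]
  by simp

lemma norm_kernel [simp]: "cmod (exp (- \<i> * complex_of_real r)) = 1"
  by (simp add: norm_exp_eq_Re)

lemma fourier_integrable:
  assumes "integrable lborel f"
  shows "integrable lborel (\<lambda>x. exp (- \<i> * complex_of_real (x \<bullet> \<xi>)) * f x)"
proof -
  have [measurable]: "f \<in> borel_measurable borel" using assms by auto
  show ?thesis by (rule Bochner_Integration.integrable_bound[OF assms]) (auto simp: norm_mult)
qed

lemma norm_fourier_le: "cmod (fourier f \<xi>) \<le> (LINT x|lborel. cmod (f x))"
  unfolding fourier_def by (rule order_trans[OF integral_norm_bound]) (simp add: norm_mult)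

lemma fourier_linear_combination:
  assumes "integrable lborel f" "integrable lborel g"
  shows "fourier (\<lambda>x. a * f x + b * g x) \<xi> = a * fourier f \<xi> + b * fourier g \<xi>"
proof -
  have "fourier (\<lambda>x. a * f x + b * g x) \<xi> = (LINT x|lborel. a * (exp (- \<i> * complex_of_real (x \<bullet> \<xi>)) * f x)
      + b * (exp (- \<i> * complex_of_real (x \<bullet> \<xi>)) * g x))"
    unfolding fourier_def by (intro Bochner_Integration.integral_cong) (auto simp: algebra_simps)
  also have "\<dots> = a * fourier f \<xi> + b * fourier g \<xi>"
    unfolding fourier_def using fourier_integrable[OF assms(1)] fourier_integrable[OF assms(2)]
    by (subst Bochner_Integration.integral_add) auto
  finally show ?thesis .
qed

lemma exp_taylor_2: "cmod (exp (- \<i> * complex_of_real t) - 1 + \<i> * complex_of_real t) \<le> t\<^sup>2"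
proof -
  have "cmod (iexp (- t) - (\<Sum>k\<le>1. (\<i> * complex_of_real (- t)) ^ k / fact k)) \<le> \<bar>- t\<bar> ^ Suc 1 / fact (Suc 1)"
    by (rule iexp_approx1)
  then have "2 * cmod (exp (- \<i> * complex_of_real t) - 1 + \<i> * complex_of_real t) \<le> t\<^sup>2"
    by (simp add: power2_eq_square algebra_simps)
  then show ?thesis
    using norm_ge_zero[of "exp (- \<i> * complex_of_real t) - 1 + \<i> * complex_of_real t"] by linarith
qed

text \<open>The kernel is expanded to first order with remainder at most
  \<open>(x \<bullet> h)\<^sup>2\<close>. The second moment of \<phi> therefore bounds the error
  quadratically in the increment, and the difference quotient is squeezed to 0.\<close>

lemma fourier_has_derivative:
  fixes \<phi> :: "'a::euclidean_space \<Rightarrow> complex"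
  assumes \<phi>: "\<phi> \<in> schwartz"
  shows "(fourier \<phi> has_derivative (\<lambda>h. fourier (\<lambda>x. - \<i> * of_real (x \<bullet> h) * \<phi> x) \<xi>)) (at \<xi>)"
proof (rule has_derivativeI_sandwich[where e = 1])
  note [measurable] = schwartz_measurable[OF \<phi>]
  let ?e = "\<lambda>x \<xi>. exp (- \<i> * complex_of_real (x \<bullet> \<xi>))"
  have le1: "norm x ^ k \<le> (1 + norm x) ^ k" for x :: 'a and k by (intro power_mono) auto
  have i1: "integrable lborel (\<lambda>x. norm x ^ k * cmod (\<phi> x))" for k
    by (rule Bochner_Integration.integrable_bound[OF schwartz_weight_integrable[OF \<phi>, of k]])
      (auto intro!: mult_right_mono le1 simp: abs_mult)
  have ih: "integrable lborel (\<lambda>x. - \<i> * of_real (x \<bullet> h) * \<phi> x)" for h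
  proof (rule Bochner_Integration.integrable_bound)
    show "integrable lborel (\<lambda>x. norm h * (norm x ^ 1 * cmod (\<phi> x)))" using i1[of 1] by simp
    show "AE x in lborel. norm (- \<i> * of_real (x \<bullet> h) * \<phi> x) \<le> norm (norm h * (norm x ^ 1 * cmod (\<phi> x)))"
    proof (rule AE_I2)
      fix x
      have "\<bar>x \<bullet> h\<bar> * cmod (\<phi> x) \<le> (norm x * norm h) * cmod (\<phi> x)"
        by (intro mult_right_mono Cauchy_Schwarz_ineq2) auto
      then show "norm (- \<i> * of_real (x \<bullet> h) * \<phi> x) \<le> norm (norm h * (norm x ^ 1 * cmod (\<phi> x)))"
        by (simp add: norm_mult abs_mult mult_ac)
    qed
  qed simp
  show "bounded_linear (\<lambda>h. fourier (\<lambda>x. - \<i> * of_real (x \<bullet> h) * \<phi> x) \<xi>)"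
  proof (rule bounded_linear_intro)
    show "fourier (\<lambda>x. - \<i> * of_real (x \<bullet> (h + k)) * \<phi> x) \<xi> =
        fourier (\<lambda>x. - \<i> * of_real (x \<bullet> h) * \<phi> x) \<xi> + fourier (\<lambda>x. - \<i> * of_real (x \<bullet> k) * \<phi> x) \<xi>" for h k
      using fourier_linear_combination[OF ih[of h] ih[of k], of 1 1 \<xi>] by (simp add: inner_add_right algebra_simps)
    show "fourier (\<lambda>x. - \<i> * of_real (x \<bullet> (r *\<^sub>R h)) * \<phi> x) \<xi> =
        r *\<^sub>R fourier (\<lambda>x. - \<i> * of_real (x \<bullet> h) * \<phi> x) \<xi>" for r h
      using fourier_linear_combination[OF ih[of h] ih[of h], of r 0 \<xi>] by (simp add: scaleR_conv_of_real algebra_simps)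
    show "norm (fourier (\<lambda>x. - \<i> * of_real (x \<bullet> h) * \<phi> x) \<xi>) \<le> norm h * (LINT x|lborel. norm x ^ 1 * cmod (\<phi> x))" for h
    proof -
      have "norm (fourier (\<lambda>x. - \<i> * of_real (x \<bullet> h) * \<phi> x) \<xi>)
          \<le> (LINT x|lborel. cmod (- \<i> * of_real (x \<bullet> h) * \<phi> x))" by (rule norm_fourier_le)
      also have "\<dots> \<le> (LINT x|lborel. norm h * (norm x ^ 1 * cmod (\<phi> x)))"
      proof (rule integral_mono)
        show "integrable lborel (\<lambda>x. norm h * (norm x ^ 1 * cmod (\<phi> x)))" using i1[of 1] by simp
        fix x
        have "\<bar>x \<bullet> h\<bar> * cmod (\<phi> x) \<le> (norm x * norm h) * cmod (\<phi> x)"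
          by (intro mult_right_mono Cauchy_Schwarz_ineq2) auto
        then show "cmod (- \<i> * of_real (x \<bullet> h) * \<phi> x) \<le> norm h * (norm x ^ 1 * cmod (\<phi> x))"
          by (simp add: norm_mult mult_ac)
      qed (use ih[of h] in auto)
      finally show ?thesis by simp
    qed
  qed
  let ?K = "LINT x|lborel. norm x ^ 2 * cmod (\<phi> x)"
  show "norm (fourier \<phi> y - fourier \<phi> \<xi> - fourier (\<lambda>x. - \<i> * of_real (x \<bullet> (y - \<xi>)) * \<phi> x) \<xi>) / norm (y - \<xi>)
      \<le> norm (y - \<xi>) * ?K" if "y \<noteq> \<xi>" for y
  proof -
    have "fourier \<phi> y - fourier \<phi> \<xi> - fourier (\<lambda>x. - \<i> * of_real (x \<bullet> (y - \<xi>)) * \<phi> x) \<xi>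
      = (LINT x|lborel. ?e x y * \<phi> x - ?e x \<xi> * \<phi> x - ?e x \<xi> * (- \<i> * of_real (x \<bullet> (y - \<xi>)) * \<phi> x))"
      unfolding fourier_def using fourier_integrable[OF schwartz_integrable[OF \<phi>]] fourier_integrable[OF ih]
      by (simp add: Bochner_Integration.integral_diff)
    also have "\<dots> = (LINT x|lborel. ?e x \<xi> * \<phi> x * (?e x (y - \<xi>) - 1 + \<i> * of_real (x \<bullet> (y - \<xi>))))"
      by (intro Bochner_Integration.integral_cong)
        (auto simp: algebra_simps inner_diff_right exp_add[symmetric])
    finally have eq: "fourier \<phi> y - fourier \<phi> \<xi> - fourier (\<lambda>x. - \<i> * of_real (x \<bullet> (y - \<xi>)) * \<phi> x) \<xi>
      = (LINT x|lborel. ?e x \<xi> * \<phi> x * (?e x (y - \<xi>) - 1 + \<i> * of_real (x \<bullet> (y - \<xi>))))" .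
    have "norm (fourier \<phi> y - fourier \<phi> \<xi> - fourier (\<lambda>x. - \<i> * of_real (x \<bullet> (y - \<xi>)) * \<phi> x) \<xi>)
      \<le> (LINT x|lborel. cmod (?e x \<xi> * \<phi> x * (?e x (y - \<xi>) - 1 + \<i> * of_real (x \<bullet> (y - \<xi>)))))"
      unfolding eq by (rule integral_norm_bound)
    also have "\<dots> \<le> (LINT x|lborel. (norm (y - \<xi>))\<^sup>2 * (norm x ^ 2 * cmod (\<phi> x)))"
    proof (rule integral_mono')
      show "integrable lborel (\<lambda>x. (norm (y - \<xi>))\<^sup>2 * (norm x ^ 2 * cmod (\<phi> x)))" using i1[of 2] by simp
      fix x
      have "cmod (?e x (y - \<xi>) - 1 + \<i> * of_real (x \<bullet> (y - \<xi>))) \<le> (x \<bullet> (y - \<xi>))\<^sup>2" by (rule exp_taylor_2)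
      also have "\<dots> \<le> (norm x * norm (y - \<xi>))\<^sup>2"
        by (rule power2_le_iff_abs_le[THEN iffD2]) (auto simp: Cauchy_Schwarz_ineq2)
      finally have "cmod (\<phi> x) * cmod (?e x (y - \<xi>) - 1 + \<i> * of_real (x \<bullet> (y - \<xi>)))
          \<le> cmod (\<phi> x) * (norm x * norm (y - \<xi>))\<^sup>2" by (rule mult_left_mono) simp
      then show "cmod (?e x \<xi> * \<phi> x * (?e x (y - \<xi>) - 1 + \<i> * of_real (x \<bullet> (y - \<xi>))))
          \<le> (norm (y - \<xi>))\<^sup>2 * (norm x ^ 2 * cmod (\<phi> x))"
        by (simp add: norm_mult power_mult_distrib mult_ac)
    qed auto
    also have "\<dots> = (norm (y - \<xi>))\<^sup>2 * ?K" by simp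
    finally show ?thesis using that by (simp add: divide_simps power2_eq_square mult_ac)
  qed
  have "((\<lambda>y. norm (y - \<xi>) * ?K) \<longlongrightarrow> norm (\<xi> - \<xi>) * ?K) (at \<xi>)"
    by (intro tendsto_intros)
  then show "((\<lambda>y. norm (y - \<xi>) * ?K) \<longlongrightarrow> 0) (at \<xi>)" by simp
qed simp

section \<open>Exchange of differentiation and multiplication by coordinates\<close>

fun coord_mult :: "'a::euclidean_space list \<Rightarrow> ('a \<Rightarrow> complex) \<Rightarrow> 'a \<Rightarrow> complex" where
  "coord_mult [] \<phi> = \<phi>"
| "coord_mult (b # bs) \<phi> = (\<lambda>x. - \<i> * of_real (x \<bullet> b) * coord_mult bs \<phi> x)"

lemma poly_growth_coordinate:
  assumes "b \<in> Basis"
  shows "poly_growth (\<lambda>x::'a::euclidean_space. - \<i> * complex_of_real (x \<bullet> b))"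
proof -
  let ?H = "\<lambda>k t. if k = 0 then - \<i> * complex_of_real t else if k = 1 then - \<i> else (0::complex)"
  have H: "(?H k has_vector_derivative ?H (Suc k) t) (at t)" for k t
    by (cases k) (auto intro!: derivative_eq_intros simp: has_vector_derivative_def scaleR_conv_of_real)
  have eq: "(\<lambda>x. - \<i> * complex_of_real (x \<bullet> b)) = (\<lambda>x. ?H 0 (x \<bullet> b + 0))" by simp
  show ?thesis
    unfolding poly_growth_def
  proof (intro conjI allI impI)
    show "smooth (\<lambda>x. - \<i> * complex_of_real (x \<bullet> b))"
      using smooth_compose_linear(1)[of ?H b 0, OF H] by simp
    fix bs :: "'a list" assume bs: "set bs \<subseteq> Basis"
    have "cmod (iter_deriv bs (\<lambda>x. - \<i> * complex_of_real (x \<bullet> b)) x)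
       \<le> \<bar>prod_list (map (\<lambda>c. c \<bullet> b) bs)\<bar> * (1 + norm x) ^ 1" for x
    proof -
      have "cmod (?H k t) \<le> 1 + \<bar>t\<bar>" for k t by (auto simp: norm_mult)
      then have "cmod (?H (length bs) (x \<bullet> b + 0)) \<le> 1 + \<bar>x \<bullet> b + 0\<bar>" .
      also have "\<dots> \<le> 1 + norm x" using Basis_le_norm[OF assms] by simp
      finally show ?thesis
        using smooth_compose_linear(2)[of ?H bs b 0, OF H bs]
        by (simp add: mult_left_mono del: if_split)
    qed
    then show "\<exists>C m. \<forall>x. cmod (iter_deriv bs (\<lambda>x. - \<i> * complex_of_real (x \<bullet> b)) x) \<le> C * (1 + norm x) ^ m"
      by blast
  qed
qed

lemma coord_mult_schwartz: "\<phi> \<in> schwartz \<Longrightarrow> set bs \<subseteq> Basis \<Longrightarrow> coord_mult bs \<phi> \<in> schwartz"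
proof (induction bs)
  case (Cons b bs)
  then show ?case
    unfolding coord_mult.simps by (intro schwartz_mult poly_growth_coordinate) auto
qed simp

lemma fourier_smooth:
  assumes \<phi>: "\<phi> \<in> schwartz"
  shows "smooth (fourier \<phi>)"
    and "set bs \<subseteq> Basis \<Longrightarrow> iter_deriv bs (fourier \<phi>) = fourier (coord_mult bs \<phi>)"
proof -
  let ?F = "\<lambda>bs. fourier (coord_mult bs \<phi>)"
  have F: "\<exists>D. (?F bs has_derivative D) (at x) \<and> D c = ?F (c # bs) x"
    if c: "c \<in> Basis" "set bs \<subseteq> Basis" for c bs x
    using fourier_has_derivative[OF coord_mult_schwartz[OF \<phi> c(2)], of x] by (intro exI conjI) auto
  show "smooth (fourier \<phi>)"
    by (rule smooth_formula(1)[of ?F]) (simp, rule F)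
  show "set bs \<subseteq> Basis \<Longrightarrow> iter_deriv bs (fourier \<phi>) = ?F bs"
    by (rule smooth_formula(2)[of ?F]) (simp, rule F)
qed

text \<open>Translation invariance makes the integral of every difference quotient zero, and
  dominated convergence passes this on to the derivative. The majorant comes from the mean value
  inequality on a unit ball.\<close>

lemma integral_iter_deriv_eq_0:
  fixes \<phi> :: "'a::euclidean_space \<Rightarrow> complex"
  assumes \<phi>: "\<phi> \<in> schwartz" and b: "b \<in> Basis"
  shows "(LINT x|lborel. iter_deriv [b] \<phi> x) = 0"
proof -
  note [measurable] = schwartz_measurable[OF \<phi>]
  let ?h = "\<lambda>n. inverse (real (Suc n))"
  let ?q = "\<lambda>n x. (\<phi> (x + ?h n *\<^sub>R b) - \<phi> x) /\<^sub>R ?h n"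
  have "\<exists>C\<ge>0. \<forall>x. cmod (iter_deriv [c] \<phi> x) \<le> C * decay x" if "c \<in> Basis" for c
    using schwartz_bound[OF \<phi>, of "[c]" "2 * DIM('a)"] that by (simp add: le_decay del: iter_deriv.simps) metis
  then obtain C where C: "\<And>c. c \<in> Basis \<Longrightarrow> C c \<ge> 0" "\<And>c x. c \<in> Basis \<Longrightarrow> cmod (iter_deriv [c] \<phi> x) \<le> C c * decay x"
    by metis
  \<comment> \<open>The power of 2 pays for moving the decay from a point \<open>y\<close> of the
    unit ball around \<open>x\<close> to \<open>x\<close> itself, as
    \<open>1 + norm x \<le> 2 * (1 + norm y)\<close>.\<close>
  let ?B = "(\<Sum>c\<in>Basis. C c) * 2 ^ (2 * DIM('a))"
  have C0: "(\<Sum>c\<in>Basis. C c) \<ge> 0" by (intro sum_nonneg C)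
  have onorm: "onorm (frechet_derivative \<phi> (at y)) \<le> ?B * decay x" if "y \<in> cball x 1" for x y
  proof (rule onorm_le)
    fix k
    have "norm (frechet_derivative \<phi> (at y) k) \<le> (\<Sum>c\<in>Basis. norm ((k \<bullet> c) *\<^sub>R iter_deriv [c] \<phi> y))"
      unfolding frechet_derivative_eq_sum_Basis[OF smooth_differentiable[OF schwartz_smooth[OF \<phi>]]]
      by (rule norm_sum)
    also have "\<dots> \<le> (\<Sum>c\<in>Basis. norm k * (C c * decay y))"
      unfolding norm_scaleR by (intro sum_mono mult_mono C) (auto simp: Basis_le_norm)
    also have "\<dots> = (\<Sum>c\<in>Basis. C c) * decay y * norm k"
      by (simp add: sum_distrib_left sum_distrib_right mult_ac)
    also have "\<dots> \<le> (\<Sum>c\<in>Basis. C c) * (2 ^ (2 * DIM('a)) * decay x) * norm k"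
    proof (intro mult_right_mono mult_left_mono C0)
      have "norm x \<le> norm y + 1"
        using that norm_triangle_sub[of x y] by (simp add: dist_norm)
      then have "1 + norm x \<le> 2 * (1 + norm y)" using norm_ge_zero[of y] by argo
      then have "(1 + norm x) ^ (2 * DIM('a)) \<le> (2 * (1 + norm y)) ^ (2 * DIM('a))"
        by (rule power_mono) simp
      then have "(1 + norm x) ^ (2 * DIM('a)) * decay y \<le> (2 * (1 + norm y)) ^ (2 * DIM('a)) * decay y"
        by (rule mult_right_mono) simp
      also have "\<dots> = 2 ^ (2 * DIM('a))"
        using norm_ge_zero[of y] unfolding power_mult_distrib by (simp add: add_nonneg_eq_0_iff)
      finally show "decay y \<le> 2 ^ (2 * DIM('a)) * decay x"
        by (simp only: le_decay)
    qed auto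
    finally show "norm (frechet_derivative \<phi> (at y) k) \<le> ?B * decay x * norm k" by (simp add: mult_ac)
  qed
  have lim: "(\<lambda>n. integral\<^sup>L lborel (?q n)) \<longlonglongrightarrow> (LINT x|lborel. iter_deriv [b] \<phi> x)"
  proof (rule integral_dominated_convergence[where w = "\<lambda>x. ?B * decay x"])
    show "integrable lborel (\<lambda>x::'a. ?B * decay x)" using integrable_decay[where 'a='a] by simp
    show "iter_deriv [b] \<phi> \<in> borel_measurable lborel"
      using iter_deriv_measurable[OF schwartz_smooth[OF \<phi>], of "[b]"] b by simp
    show "AE x in lborel. (\<lambda>n. ?q n x) \<longlonglongrightarrow> iter_deriv [b] \<phi> x"
    proof (rule AE_I2)
      fix x
      let ?D = "frechet_derivative \<phi> (at x)"
      have D: "(\<phi> has_derivative ?D) (at x)" by (rule smooth_has_derivative[OF schwartz_smooth[OF \<phi>]])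
      have "(\<lambda>k. norm (\<phi> (x + k) - \<phi> x - ?D k) / norm k) \<midarrow>0\<rightarrow> 0" using D by (simp add: has_derivative_at)
      moreover have "filterlim (\<lambda>n. ?h n *\<^sub>R b) (at 0) sequentially"
        unfolding filterlim_at using b tendsto_scaleR[OF LIMSEQ_inverse_real_of_nat tendsto_const[of b]]
        by (auto simp: nonzero_Basis simp del: of_nat_Suc)
      ultimately have "(\<lambda>n. norm (\<phi> (x + ?h n *\<^sub>R b) - \<phi> x - ?D (?h n *\<^sub>R b)) / norm (?h n *\<^sub>R b)) \<longlonglongrightarrow> 0"
        by (rule filterlim_compose)
      moreover have "norm (\<phi> (x + ?h n *\<^sub>R b) - \<phi> x - ?D (?h n *\<^sub>R b)) / norm (?h n *\<^sub>R b) = norm (?q n x - ?D b)" for n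
      proof -
        have "?D (?h n *\<^sub>R b) = ?h n *\<^sub>R ?D b" using linear_scale[OF has_derivative_linear[OF D]] by blast
        then have "?q n x - ?D b = (\<phi> (x + ?h n *\<^sub>R b) - \<phi> x - ?D (?h n *\<^sub>R b)) /\<^sub>R ?h n"
          by (simp add: scaleR_diff_right del: of_nat_Suc)
        then show ?thesis using b by (simp add: divide_inverse mult.commute del: of_nat_Suc)
      qed
      ultimately have "(\<lambda>n. norm (?q n x - ?D b)) \<longlonglongrightarrow> 0" by (simp only:)
      then show "(\<lambda>n. ?q n x) \<longlonglongrightarrow> iter_deriv [b] \<phi> x"
        by (simp add: tendsto_norm_zero_iff LIM_zero_iff)
    qed
    show "AE x in lborel. norm (?q n x) \<le> ?B * decay x" for n
    proof (rule AE_I2)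
      fix x
      \<comment> \<open>The increment has length at most 1, so it stays in the ball on which the
        derivative is controlled.\<close>
      have h: "?h n > 0" "?h n \<le> 1" by (auto simp: field_simps)
      have "norm (\<phi> (x + ?h n *\<^sub>R b) - \<phi> x) \<le> (?B * decay x) * norm ((x + ?h n *\<^sub>R b) - x)"
      proof (rule differentiable_bound[of "cball x 1" \<phi> "\<lambda>x. frechet_derivative \<phi> (at x)"])
        show "(\<phi> has_derivative frechet_derivative \<phi> (at y)) (at y within cball x 1)" for y
          by (rule has_derivative_at_withinI[OF smooth_has_derivative[OF schwartz_smooth[OF \<phi>]]])
      qed (use onorm h b in \<open>auto simp: dist_norm simp del: of_nat_Suc\<close>)
      then have "norm (\<phi> (x + ?h n *\<^sub>R b) - \<phi> x) \<le> (?B * decay x) * ?h n" using b h by simp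
      moreover have "norm (inverse r *\<^sub>R d) \<le> K" if "norm d \<le> K * r" "r > 0" for d :: complex and K r :: real
        using that by (simp add: field_simps)
      ultimately show "norm (?q n x) \<le> ?B * decay x" using h(1) by blast
    qed
  qed simp
  have "integral\<^sup>L lborel (?q n) = 0" for n
  proof -
    have tr: "(LINT x|lborel. \<phi> (x + ?h n *\<^sub>R b)) = (LINT x|lborel. \<phi> x)"
      using lborel_integral_affine[of \<phi> 1 "?h n *\<^sub>R b"] by (simp add: add.commute)
    have "integrable lborel (\<lambda>x. \<phi> (x + ?h n *\<^sub>R b))"
    proof -
      have "integrable (distr lborel borel ((+) (?h n *\<^sub>R b))) \<phi>"
        using schwartz_integrable[OF \<phi>] by (simp only: lborel_distr_plus)
      then show ?thesis by (subst (asm) integrable_distr_eq) (auto simp: add.commute)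
    qed
    then show ?thesis
      using tr schwartz_integrable[OF \<phi>] by (simp add: Bochner_Integration.integral_diff)
  qed
  with lim show ?thesis by (simp add: LIMSEQ_const_iff)
qed

lemma poly_growth_kernel: "poly_growth (\<lambda>x::'a::euclidean_space. exp (- \<i> * complex_of_real (x \<bullet> \<xi>)))"
  and iter_deriv_kernel: "b \<in> Basis \<Longrightarrow> iter_deriv [b] (\<lambda>x. exp (- \<i> * complex_of_real (x \<bullet> \<xi>))) =
     (\<lambda>x. - \<i> * of_real (\<xi> \<bullet> b) * exp (- \<i> * complex_of_real (x \<bullet> \<xi>)))"
proof -
  let ?H = "\<lambda>k t. (- \<i>) ^ k * exp (- \<i> * complex_of_real t)"
  have H: "(?H k has_vector_derivative ?H (Suc k) t) (at t)" for k t
  proof -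
    have "((\<lambda>z. (- \<i>) ^ k * exp (- \<i> * z)) has_field_derivative ?H (Suc k) t) (at (complex_of_real t))"
      by (auto intro!: derivative_eq_intros)
    then show ?thesis
      by (rule has_vector_derivative_real_field)
  qed
  have eq: "(\<lambda>x::'a. exp (- \<i> * complex_of_real (x \<bullet> \<xi>))) = (\<lambda>x. ?H 0 (x \<bullet> \<xi> + 0))" by simp
  show "poly_growth (\<lambda>x::'a::euclidean_space. exp (- \<i> * complex_of_real (x \<bullet> \<xi>)))"
    unfolding poly_growth_def
  proof (intro conjI allI impI)
    show "smooth (\<lambda>x. exp (- \<i> * complex_of_real (x \<bullet> \<xi>)))"
      unfolding eq by (rule smooth_compose_linear(1)[of ?H, OF H])
    fix bs :: "'a list" assume bs: "set bs \<subseteq> Basis"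
    have "cmod (iter_deriv bs (\<lambda>x. exp (- \<i> * complex_of_real (x \<bullet> \<xi>))) x)
       \<le> \<bar>prod_list (map (\<lambda>c. c \<bullet> \<xi>) bs)\<bar> * (1 + norm x) ^ 0" for x
      unfolding eq smooth_compose_linear(2)[of ?H, OF H bs] norm_scaleR by (simp add: norm_mult norm_power)
    then show "\<exists>C m. \<forall>x. cmod (iter_deriv bs (\<lambda>x. exp (- \<i> * complex_of_real (x \<bullet> \<xi>))) x) \<le> C * (1 + norm x) ^ m"
      by blast
  qed
  show "iter_deriv [b] (\<lambda>x. exp (- \<i> * complex_of_real (x \<bullet> \<xi>))) =
     (\<lambda>x. - \<i> * of_real (\<xi> \<bullet> b) * exp (- \<i> * complex_of_real (x \<bullet> \<xi>)))" if "b \<in> Basis"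
    using smooth_compose_linear(2)[of ?H, OF H, of "[b]" \<xi> 0] that
    by (simp add: scaleR_conv_of_real inner_commute mult_ac del: iter_deriv.simps)
qed

text \<open>Integration by parts: the derivative of kernel times \<phi> has integral zero, and the
  product rule splits it into the two transforms.\<close>

lemma fourier_iter_deriv:
  assumes \<phi>: "\<phi> \<in> schwartz" and b: "b \<in> Basis"
  shows "fourier (iter_deriv [b] \<phi>) \<xi> = \<i> * of_real (\<xi> \<bullet> b) * fourier \<phi> \<xi>"
proof -
  let ?e = "\<lambda>x. exp (- \<i> * complex_of_real (x \<bullet> \<xi>))"
  have "(\<lambda>x. ?e x * \<phi> x) \<in> schwartz" by (rule schwartz_mult[OF poly_growth_kernel \<phi>])
  then have "0 = (LINT x|lborel. iter_deriv [b] (\<lambda>x. ?e x * \<phi> x) x)"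
    using integral_iter_deriv_eq_0 b by metis
  also have "\<dots> = (LINT x|lborel. - \<i> * of_real (\<xi> \<bullet> b) * (?e x * \<phi> x) + ?e x * iter_deriv [b] \<phi> x)"
    using smooth_mult(2)[OF poly_growth_kernel[unfolded poly_growth_def, THEN conjunct1] schwartz_smooth[OF \<phi>], of "[b]"] b
      iter_deriv_kernel[OF b]
    by (simp add: mult_ac del: iter_deriv.simps(2))
  also have "\<dots> = - \<i> * of_real (\<xi> \<bullet> b) * fourier \<phi> \<xi> + fourier (iter_deriv [b] \<phi>) \<xi>"
    unfolding fourier_def
    using fourier_integrable[OF schwartz_integrable[OF \<phi>]] b
      fourier_integrable[OF schwartz_integrable[OF schwartz_iter_deriv[OF \<phi>, of "[b]"]]]
    by (subst Bochner_Integration.integral_add) (auto simp del: iter_deriv.simps)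
  finally show ?thesis by (simp add: algebra_simps del: iter_deriv.simps)
qed

text \<open>A further factor \<open>1 + norm \<xi>\<close> is at most 1 plus the sum of the
  \<open>\<bar>\<xi> \<bullet> b\<bar>\<close>, and multiplication by a coordinate is, up to a
  unimodular factor, the transform of a derivative. The bound by a seminorm of \<phi>, stronger than
  mere finiteness, is what later makes the constructed functional continuous.\<close>

lemma fourier_decay:
  "\<exists>N C. \<forall>\<phi>\<in>schwartz. \<forall>\<xi>::'a::euclidean_space. (1 + norm \<xi>) ^ k * cmod (fourier \<phi> \<xi>) \<le> C * seminorm N N \<phi>"
proof (induction k)
  case 0
  let ?N = "2 * DIM('a)"
  have "(1 + norm \<xi>) ^ 0 * cmod (fourier \<phi> \<xi>) \<le> (LINT x::'a|lborel. decay x) * seminorm ?N ?N \<phi>"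
    if \<phi>: "\<phi> \<in> schwartz" for \<phi> and \<xi> :: 'a
  proof -
    have "(1 + norm x) ^ ?N * cmod (\<phi> x) \<le> seminorm ?N ?N \<phi>" for x
      using le_seminorm[OF \<phi>, of "[]" ?N ?N ?N x] by simp
    then have "(LINT x|lborel. cmod (\<phi> x)) \<le> seminorm ?N ?N \<phi> * (LINT x::'a|lborel. decay x)"
      by (rule integrable_decay_bound(2)[OF schwartz_measurable[OF \<phi>]])
    with norm_fourier_le[of \<phi> \<xi>] show ?thesis by (simp add: mult.commute[of "seminorm ?N ?N \<phi>"])
  qed
  then show ?case by blast
next
  case (Suc k)
  then obtain N C where NC: "\<And>\<phi> \<xi>. \<phi> \<in> schwartz \<Longrightarrow>
      (1 + norm (\<xi>::'a)) ^ k * cmod (fourier \<phi> \<xi>) \<le> C * seminorm N N \<phi>" by blast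
  \<comment> \<open>\<open>m\<close> counts the summands of a seminorm; each of them is bounded by
    the whole seminorm of one order more.\<close>
  define m where "m = real (card {bs::'a list. set bs \<subseteq> Basis \<and> length bs \<le> N})"
  have d: "seminorm N N (iter_deriv bs \<phi>) \<le> m * seminorm (Suc N) (Suc N) \<phi>"
    if \<phi>: "\<phi> \<in> schwartz" and bs: "set bs \<subseteq> Basis" "length bs \<le> 1" for bs and \<phi> :: "'a \<Rightarrow> complex"
  proof -
    have "seminorm N N (iter_deriv bs \<phi>) \<le> (\<Sum>cs::'a list | set cs \<subseteq> Basis \<and> length cs \<le> N. seminorm (Suc N) (Suc N) \<phi>)"
      unfolding iter_deriv_append[symmetric]
    proof (rule seminorm_le)
      fix cs :: "'a list" and x assume "set cs \<subseteq> Basis" "length cs \<le> N"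
      then show "(1 + norm x) ^ N * cmod (iter_deriv cs (iter_deriv bs \<phi>) x) \<le> seminorm (Suc N) (Suc N) \<phi>"
        unfolding iter_deriv_append[symmetric] using bs by (intro le_seminorm[OF \<phi>]) auto
    qed
    then show ?thesis by (simp add: m_def)
  qed
  have "(1 + norm \<xi>) ^ Suc k * cmod (fourier \<phi> \<xi>) \<le> ((1 + DIM('a)) * \<bar>C\<bar> * m) * seminorm (Suc N) (Suc N) \<phi>"
    if \<phi>: "\<phi> \<in> schwartz" for \<phi> and \<xi> :: 'a
  proof -
    let ?A = "\<bar>C\<bar> * (m * seminorm (Suc N) (Suc N) \<phi>)"
    have A: "(1 + norm \<xi>) ^ k * cmod (fourier (iter_deriv bs \<phi>) \<xi>) \<le> ?A"
      if bs: "set bs \<subseteq> Basis" "length bs \<le> 1" for bs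
    proof -
      have S: "iter_deriv bs \<phi> \<in> schwartz" using schwartz_iter_deriv[OF \<phi>] bs by blast
      have "(1 + norm \<xi>) ^ k * cmod (fourier (iter_deriv bs \<phi>) \<xi>) \<le> C * seminorm N N (iter_deriv bs \<phi>)"
        by (rule NC[OF S])
      also have "\<dots> \<le> ?A"
        using d[OF \<phi> bs] seminorm_nonneg[OF S] by (intro mult_mono) auto
      finally show ?thesis .
    qed
    have "1 + norm \<xi> \<le> 1 + (\<Sum>b\<in>Basis. \<bar>\<xi> \<bullet> b\<bar>)" using norm_le_l1[of \<xi>] by simp
    then have "(1 + norm \<xi>) ^ Suc k * cmod (fourier \<phi> \<xi>)
        \<le> (1 + (\<Sum>b\<in>Basis. \<bar>\<xi> \<bullet> b\<bar>)) * ((1 + norm \<xi>) ^ k * cmod (fourier \<phi> \<xi>))"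
      by (simp add: mult.assoc mult_right_mono)
    also have "\<dots> = (1 + norm \<xi>) ^ k * cmod (fourier (iter_deriv [] \<phi>) \<xi>)
        + (\<Sum>b\<in>Basis. (1 + norm \<xi>) ^ k * cmod (fourier (iter_deriv [b] \<phi>) \<xi>))"
      using fourier_iter_deriv[OF \<phi>]
      by (simp add: norm_mult algebra_simps sum_distrib_left del: iter_deriv.simps(2))
    also have "\<dots> \<le> ?A + (\<Sum>b\<in>(Basis::'a set). ?A)"
      by (intro add_mono sum_mono A) auto
    finally show ?thesis by (simp add: algebra_simps)
  qed
  then show ?case by blast
qed

lemma fourier_schwartz:
  assumes "\<phi> \<in> schwartz"
  shows "fourier \<phi> \<in> schwartz"
proof (rule schwartzI[OF fourier_smooth(1)[OF assms]])
  fix k and bs :: "'a list" assume bs: "set bs \<subseteq> Basis"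
  show "\<exists>C. \<forall>\<xi>. (1 + norm \<xi>) ^ k * cmod (iter_deriv bs (fourier \<phi>) \<xi>) \<le> C"
    unfolding fourier_smooth(2)[OF assms bs]
    using fourier_decay[of k] coord_mult_schwartz[OF assms bs] by blast
qed

section \<open>Fourier inversion\<close>

abbreviation gauss :: "'a::euclidean_space \<Rightarrow> real" where
  "gauss x \<equiv> exp (- (norm x)\<^sup>2 / 2)"

text \<open>Read off from the characteristic function of the standard normal distribution at
  \<open>- s\<close>, where the sign matches the convention of \<open>fourier\<close>.\<close>

lemma gauss_1d:
  shows "integrable lborel (\<lambda>t::real. exp (- \<i> * complex_of_real (t * s)) * complex_of_real (exp (- t\<^sup>2 / 2)))"
    and "(LINT t|lborel. exp (- \<i> * complex_of_real (t * s)) * complex_of_real (exp (- t\<^sup>2 / 2)))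
      = complex_of_real (sqrt (2 * pi) * exp (- s\<^sup>2 / 2))"
proof -
  let ?f = "\<lambda>t. exp (- \<i> * complex_of_real (t * s)) * complex_of_real (exp (- t\<^sup>2 / 2))"
  have eq: "std_normal_density t *\<^sub>R iexp (- s * t) = ?f t / complex_of_real (sqrt (2 * pi))" for t
  proof -
    have 1: "std_normal_density t = exp (- t\<^sup>2 / 2) / sqrt (2 * pi)" by (simp add: std_normal_density_def)
    have 2: "\<i> * complex_of_real (- s * t) = - \<i> * complex_of_real (t * s)" by simp
    show ?thesis unfolding 1 2 by (simp add: scaleR_conv_of_real)
  qed
  have n: "integrable lborel std_normal_density"
    using integrable_std_normal_moment[of 0] by simp
  have i: "integrable lborel (\<lambda>t. std_normal_density t *\<^sub>R iexp (- s * t))"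
    by (rule Bochner_Integration.integrable_bound[OF n]) (auto simp: norm_exp_eq_Re)
  show "integrable lborel ?f"
  proof -
    have "integrable lborel (\<lambda>t. complex_of_real (sqrt (2 * pi)) * (?f t / complex_of_real (sqrt (2 * pi))))"
      using i unfolding eq by (rule integrable_mult_right)
    then show ?thesis by simp
  qed
  have "complex_of_real (exp (- s\<^sup>2 / 2)) = char std_normal_distribution (- s)"
    by (simp add: char_std_normal_distribution)
  also have "\<dots> = (LINT t|lborel. std_normal_density t *\<^sub>R iexp (- s * t))"
    unfolding char_def by (subst integral_density) (auto simp: normal_density_nonneg)
  also have "\<dots> = (LINT t|lborel. ?f t) / complex_of_real (sqrt (2 * pi))"
    unfolding eq by simp
  finally show "(LINT t|lborel. ?f t) = complex_of_real (sqrt (2 * pi) * exp (- s\<^sup>2 / 2))"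
    by (simp add: field_simps)
qed

lemma gauss_exponent: "- (norm x)\<^sup>2 / 2 = (\<Sum>b\<in>Basis. - (x \<bullet> b)\<^sup>2 / 2)"
  for x :: "'a::euclidean_space"
  unfolding power2_norm_eq_inner
  by (subst euclidean_inner) (simp add: sum_negf sum_divide_distrib power2_eq_square)

lemma kernel_gauss_prod:
  fixes x \<xi> :: "'a::euclidean_space"
  shows "exp (- \<i> * complex_of_real (x \<bullet> \<xi>)) * complex_of_real (gauss x) =
    (\<Prod>b\<in>Basis. exp (- \<i> * complex_of_real ((x \<bullet> b) * (\<xi> \<bullet> b))) * complex_of_real (exp (- (x \<bullet> b)\<^sup>2 / 2)))"
proof -
  have "- \<i> * complex_of_real (x \<bullet> \<xi>) = (\<Sum>b\<in>Basis. - \<i> * complex_of_real ((x \<bullet> b) * (\<xi> \<bullet> b)))"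
    by (subst euclidean_inner) (simp add: sum_distrib_left sum_negf)
  then show ?thesis by (simp only: gauss_exponent) (simp add: exp_sum prod.distrib)
qed

lemma gauss_integrable: "integrable lborel (\<lambda>x::'a::euclidean_space. complex_of_real (gauss x))"
proof -
  have "integrable lborel (\<lambda>x::'a. exp (- \<i> * complex_of_real (x \<bullet> 0)) * complex_of_real (gauss x))"
    unfolding kernel_gauss_prod by (intro lborel_prod_coordinates(1) gauss_1d(1))
  then show ?thesis by simp
qed

lemma fourier_gauss:
  "fourier (\<lambda>x::'a::euclidean_space. complex_of_real (gauss x)) \<xi> = complex_of_real (sqrt (2 * pi) ^ DIM('a) * gauss \<xi>)"
proof -
  have "fourier (\<lambda>x::'a. complex_of_real (gauss x)) \<xi> =
      (\<Prod>b\<in>Basis. LINT t|lborel. exp (- \<i> * complex_of_real (t * (\<xi> \<bullet> b))) * complex_of_real (exp (- t\<^sup>2 / 2)))"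
    unfolding fourier_def kernel_gauss_prod by (intro lborel_prod_coordinates(2) gauss_1d(1))
  also have "\<dots> = (\<Prod>b\<in>Basis. complex_of_real (sqrt (2 * pi) * exp (- (\<xi> \<bullet> b)\<^sup>2 / 2)))"
    unfolding gauss_1d(2) ..
  also have "\<dots> = complex_of_real (sqrt (2 * pi) ^ DIM('a) * (\<Prod>b\<in>Basis. exp (- (\<xi> \<bullet> b)\<^sup>2 / 2)))"
    by (simp add: prod.distrib)
  also have "(\<Prod>b\<in>Basis. exp (- (\<xi> \<bullet> b)\<^sup>2 / 2)) = gauss \<xi>"
    by (simp only: gauss_exponent exp_sum finite_Basis)
  finally show ?thesis .
qed

section \<open>Multiplication formula, affine changes of variable and inversion\<close>

lemma integral_fourier_mult:
  fixes f g :: "'a::euclidean_space \<Rightarrow> complex"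
  assumes f: "integrable lborel f" and g: "integrable lborel g"
  shows "(LINT \<xi>|lborel. fourier f \<xi> * g \<xi>) = (LINT x|lborel. f x * fourier g x)"
proof -
  have [measurable]: "f \<in> borel_measurable borel" "g \<in> borel_measurable borel" using f g by auto
  let ?F = "\<lambda>x \<xi>. exp (- \<i> * complex_of_real (x \<bullet> \<xi>)) * (f x * g \<xi>)"
  have "integrable (lborel \<Otimes>\<^sub>M lborel) (case_prod ?F)"
  proof (rule lborel_pair.Fubini_integrable)
    show "case_prod ?F \<in> borel_measurable (lborel \<Otimes>\<^sub>M lborel)" by measurable
    show "integrable lborel (\<lambda>x. LINT y|lborel. norm (case (x, y) of (x, \<xi>) \<Rightarrow> ?F x \<xi>))"
      using f by (simp add: norm_mult)
    show "AE x in lborel. integrable lborel (\<lambda>y. case (x, y) of (x, \<xi>) \<Rightarrow> ?F x \<xi>)"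
    proof (rule AE_I2)
      fix x
      show "integrable lborel (\<lambda>y. case (x, y) of (x, \<xi>) \<Rightarrow> ?F x \<xi>)"
        by (rule Bochner_Integration.integrable_bound[of lborel "\<lambda>y. f x * g y"])
          (use g in \<open>auto simp: norm_mult\<close>)
    qed
  qed
  then have "(LINT \<xi>|lborel. LINT x|lborel. ?F x \<xi>) = (LINT x|lborel. LINT \<xi>|lborel. ?F x \<xi>)"
    by (rule lborel_pair.Fubini_integral)
  moreover have "(LINT x|lborel. ?F x \<xi>) = fourier f \<xi> * g \<xi>" for \<xi>
    unfolding fourier_def by (simp add: mult.assoc[symmetric])
  moreover have "(LINT \<xi>|lborel. ?F x \<xi>) = f x * fourier g x" for x
    unfolding fourier_def by (simp add: inner_commute[of x] mult.left_commute)
  ultimately show ?thesis by simp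
qed

lemma lborel_integrable_affine:
  fixes f :: "'a::euclidean_space \<Rightarrow> 'b::{banach, second_countable_topology}"
  assumes f: "integrable lborel f" and c: "c \<noteq> 0"
  shows "integrable lborel (\<lambda>x. f (t + c *\<^sub>R x))"
proof -
  have [measurable]: "f \<in> borel_measurable borel" using f by auto
  have "integrable (density (distr lborel borel (\<lambda>x. t + c *\<^sub>R x)) (\<lambda>_. \<bar>c\<bar> ^ DIM('a))) f"
    using f lborel_affine[OF c, of t] by simp
  then have "integrable lborel (\<lambda>x. \<bar>c\<bar> ^ DIM('a) *\<^sub>R f (t + c *\<^sub>R x))"
    by (subst (asm) integrable_density) (auto simp: integrable_distr_eq)
  then have "integrable lborel (\<lambda>x. inverse (\<bar>c\<bar> ^ DIM('a)) *\<^sub>R (\<bar>c\<bar> ^ DIM('a) *\<^sub>R f (t + c *\<^sub>R x)))"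
    by (rule integrable_scaleR_right)
  then show ?thesis using c by simp
qed

text \<open>A translation becomes a phase and a dilation becomes the inverse dilation. The case
  \<open>c = -1\<close> is the reflection; a small positive \<open>c\<close> is the scale of the
  Gaussian regularisation.\<close>

lemma fourier_affine:
  fixes f :: "'a::euclidean_space \<Rightarrow> complex"
  assumes [measurable]: "f \<in> borel_measurable borel" and c: "c \<noteq> 0"
  shows "\<bar>c\<bar> ^ DIM('a) *\<^sub>R fourier (\<lambda>x. f (t + c *\<^sub>R x)) \<xi> =
    exp (\<i> * complex_of_real (t \<bullet> \<xi> / c)) * fourier f (\<xi> /\<^sub>R c)"
proof -
  define F where "F y = exp (- \<i> * complex_of_real (((y - t) /\<^sub>R c) \<bullet> \<xi>)) * f y" for y
  define G where "G y = exp (- \<i> * complex_of_real (y \<bullet> (\<xi> /\<^sub>R c))) * f y" for y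
  let ?e = "exp (\<i> * complex_of_real (t \<bullet> \<xi> / c))"
  have "F \<in> borel_measurable borel" unfolding F_def by measurable
  then have "integral\<^sup>L lborel F = \<bar>c\<bar> ^ DIM('a) *\<^sub>R (LINT x|lborel. F (t + c *\<^sub>R x))"
    by (rule lborel_integral_affine[OF _ c])
  moreover have "(LINT x|lborel. F (t + c *\<^sub>R x)) = fourier (\<lambda>x. f (t + c *\<^sub>R x)) \<xi>"
    using c by (simp add: F_def fourier_def)
  moreover have "F y = ?e * G y" for y
  proof -
    have "- \<i> * complex_of_real (((y - t) /\<^sub>R c) \<bullet> \<xi>) =
        \<i> * complex_of_real (t \<bullet> \<xi> / c) + - \<i> * complex_of_real (y \<bullet> (\<xi> /\<^sub>R c))"
      by (simp add: inner_diff_left algebra_simps divide_inverse)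
    then show ?thesis unfolding F_def G_def by (simp only: exp_add mult.assoc)
  qed
  then have "F = (\<lambda>y. ?e * G y)" by blast
  then have "integral\<^sup>L lborel F = ?e * integral\<^sup>L lborel G" by (simp only: integral_mult_right_zero)
  moreover have "integral\<^sup>L lborel G = fourier f (\<xi> /\<^sub>R c)" by (simp only: G_def[abs_def] fourier_def)
  ultimately show ?thesis by simp
qed

lemma fourier_reflect:
  fixes f :: "'a::euclidean_space \<Rightarrow> complex"
  assumes "f \<in> borel_measurable borel"
  shows "fourier (\<lambda>x. f (- x)) \<xi> = fourier f (- \<xi>)"
  using fourier_affine[OF assms, of "-1" 0 \<xi>] by simp

text \<open>Gaussian regularisation: the multiplication formula is applied to a rescaled copy of \<open>\<phi>\<close>
  against a Gaussian, and the scale is sent to \<open>0\<close>.\<close>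

lemma fourier_fourier:
  fixes \<phi> :: "'a::euclidean_space \<Rightarrow> complex"
  assumes \<phi>: "\<phi> \<in> schwartz"
  shows "fourier (fourier \<phi>) (- a) = complex_of_real ((2 * pi) ^ DIM('a)) * \<phi> a"
proof -
  note [measurable] = schwartz_measurable[OF \<phi>] schwartz_measurable[OF fourier_schwartz[OF \<phi>]]
  let ?K = "complex_of_real (sqrt (2 * pi) ^ DIM('a))"
  let ?h = "\<lambda>n. inverse (real (Suc n))"
  let ?L = "\<lambda>n \<xi>. exp (\<i> * complex_of_real (a \<bullet> \<xi>)) * fourier \<phi> \<xi> * complex_of_real (gauss (?h n *\<^sub>R \<xi>))"
  let ?R = "\<lambda>n z. \<phi> (a + ?h n *\<^sub>R z) * complex_of_real (gauss z)"
  \<comment> \<open>The substitution \<zeta> = h \<xi> moves the scale from the Gaussian to \<phi>;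
    the multiplication formula then shifts the transform onto the Gaussian, which reproduces itself
    up to the constant \<open>?K\<close>.\<close>
  have eq: "integral\<^sup>L lborel (?L n) = ?K * integral\<^sup>L lborel (?R n)" for n
  proof -
    define h where "h = ?h n"
    have h: "h > 0" "h \<noteq> 0" by (auto simp: h_def)
    let ?c = "complex_of_real (h ^ DIM('a))"
    let ?f = "\<lambda>\<zeta>. exp (\<i> * complex_of_real (a \<bullet> \<zeta> / h)) * fourier \<phi> (\<zeta> /\<^sub>R h) * complex_of_real (gauss \<zeta>)"
    have F: "?c * fourier (\<lambda>z. \<phi> (a + h *\<^sub>R z)) \<zeta> = exp (\<i> * complex_of_real (a \<bullet> \<zeta> / h)) * fourier \<phi> (\<zeta> /\<^sub>R h)" for \<zeta>
      using fourier_affine[of \<phi> h a \<zeta>] h by (simp add: scaleR_conv_of_real)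
    have "?c * (LINT \<xi>|lborel. ?L n \<xi>) = integral\<^sup>L lborel ?f"
      using lborel_integral_affine[of ?f h 0] h
      by (simp add: scaleR_conv_of_real h_def[symmetric] del: of_nat_Suc)
    also have "\<dots> = ?c * (LINT \<zeta>|lborel. fourier (\<lambda>z. \<phi> (a + h *\<^sub>R z)) \<zeta> * complex_of_real (gauss \<zeta>))"
      unfolding F[symmetric] by (simp add: mult.assoc)
    also have "(LINT \<zeta>|lborel. fourier (\<lambda>z. \<phi> (a + h *\<^sub>R z)) \<zeta> * complex_of_real (gauss \<zeta>)) =
        (LINT z|lborel. \<phi> (a + h *\<^sub>R z) * (?K * complex_of_real (gauss z)))"
      unfolding integral_fourier_mult[OF lborel_integrable_affine[OF schwartz_integrable[OF \<phi>] h(2)] gauss_integrable]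
        fourier_gauss by simp
    also have "\<dots> = ?K * integral\<^sup>L lborel (?R n)"
      by (simp add: h_def mult.left_commute del: of_real_power)
    finally show ?thesis using h by simp
  qed
  have h0: "?h \<longlonglongrightarrow> 0" by (rule LIMSEQ_inverse_real_of_nat)
  have i\<phi>: "integrable lborel (\<lambda>\<xi>. cmod (fourier \<phi> \<xi>))"
    using schwartz_integrable[OF fourier_schwartz[OF \<phi>]] by simp
  have "(\<lambda>n. integral\<^sup>L lborel (?L n)) \<longlonglongrightarrow> (LINT \<xi>|lborel. exp (\<i> * complex_of_real (a \<bullet> \<xi>)) * fourier \<phi> \<xi>)"
  proof (rule integral_dominated_convergence[where w = "\<lambda>\<xi>. cmod (fourier \<phi> \<xi>)"])
    show "AE \<xi> in lborel. (\<lambda>n. ?L n \<xi>) \<longlonglongrightarrow> exp (\<i> * complex_of_real (a \<bullet> \<xi>)) * fourier \<phi> \<xi>"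
    proof (rule AE_I2)
      fix \<xi>
      have "(\<lambda>n. ?L n \<xi>) \<longlonglongrightarrow> exp (\<i> * complex_of_real (a \<bullet> \<xi>)) * fourier \<phi> \<xi> * complex_of_real (gauss (0 *\<^sub>R \<xi>))"
        by (intro tendsto_intros h0) simp
      then show "(\<lambda>n. ?L n \<xi>) \<longlonglongrightarrow> exp (\<i> * complex_of_real (a \<bullet> \<xi>)) * fourier \<phi> \<xi>" by simp
    qed
    show "AE \<xi> in lborel. norm (?L n \<xi>) \<le> cmod (fourier \<phi> \<xi>)" for n
      by (intro AE_I2) (auto simp: norm_mult norm_exp_eq_Re intro!: mult_left_le)
  qed (use i\<phi> in auto)
  moreover obtain C where C: "C \<ge> 0" "\<And>x. cmod (\<phi> x) \<le> C"
    using schwartz_bound[OF \<phi>, of "[]" 0] by auto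
  have "(\<lambda>n. integral\<^sup>L lborel (?R n)) \<longlonglongrightarrow> (LINT z|lborel. \<phi> a * complex_of_real (gauss (z::'a)))"
  proof (rule integral_dominated_convergence[where w = "\<lambda>z::'a. C * gauss z"])
    show "integrable lborel (\<lambda>z::'a. C * gauss z)"
      using integrable_norm[OF gauss_integrable[where 'a='a]] by simp
    show "AE z in lborel. (\<lambda>n. ?R n z) \<longlonglongrightarrow> \<phi> a * complex_of_real (gauss z)"
    proof (rule AE_I2)
      fix z :: 'a
      have "(\<lambda>n. a + ?h n *\<^sub>R z) \<longlonglongrightarrow> a + 0 *\<^sub>R z" by (intro tendsto_intros h0)
      then have "(\<lambda>n. \<phi> (a + ?h n *\<^sub>R z)) \<longlonglongrightarrow> \<phi> a"
        using smooth_continuous_on[OF schwartz_smooth[OF \<phi>], of UNIV]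
        by (intro continuous_on_tendsto_compose[of UNIV \<phi>]) auto
      then show "(\<lambda>n. ?R n z) \<longlonglongrightarrow> \<phi> a * complex_of_real (gauss z)" by (intro tendsto_intros)
    qed
    show "AE z in lborel. norm (?R n z) \<le> C * gauss z" for n
      by (intro AE_I2) (auto simp: norm_mult intro!: mult_right_mono C)
  qed auto
  then have "(\<lambda>n. ?K * integral\<^sup>L lborel (?R n)) \<longlonglongrightarrow> ?K * (LINT z|lborel. \<phi> a * complex_of_real (gauss (z::'a)))"
    by (intro tendsto_mult tendsto_const)
  ultimately have "(LINT \<xi>|lborel. exp (\<i> * complex_of_real (a \<bullet> \<xi>)) * fourier \<phi> \<xi>) =
      ?K * (LINT z|lborel. \<phi> a * complex_of_real (gauss (z::'a)))"
    unfolding eq by (rule LIMSEQ_unique)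
  \<comment> \<open>The mass of the Gaussian is the value of its transform at 0, which contributes
    the second factor \<open>?K\<close>.\<close>
  also have "\<dots> = ?K * (\<phi> a * ?K)"
    using fourier_gauss[where 'a='a, of 0] by (simp add: fourier_def)
  also have "\<dots> = complex_of_real ((sqrt (2 * pi) * sqrt (2 * pi)) ^ DIM('a)) * \<phi> a"
    by (simp add: power_mult_distrib del: real_sqrt_mult_self)
  also have "(LINT \<xi>|lborel. exp (\<i> * complex_of_real (a \<bullet> \<xi>)) * fourier \<phi> \<xi>) = fourier (fourier \<phi>) (- a)"
    unfolding fourier_def[of "fourier \<phi>"] by (simp add: inner_commute)
  finally show ?thesis by simp
qed

definition inv_fourier :: "('a::euclidean_space \<Rightarrow> complex) \<Rightarrow> 'a \<Rightarrow> complex" where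
  "inv_fourier \<phi> \<xi> = fourier \<phi> (- \<xi>) / complex_of_real ((2 * pi) ^ DIM('a))"

lemma inv_fourier_schwartz:
  assumes "\<phi> \<in> schwartz"
  shows "inv_fourier \<phi> \<in> schwartz"
  using schwartz_cmult[OF schwartz_reflect[OF fourier_schwartz[OF assms]], of "1 / complex_of_real ((2 * pi) ^ DIM('a))"]
  by (simp add: inv_fourier_def[abs_def])

lemma inv_fourier_fourier: "\<phi> \<in> schwartz \<Longrightarrow> inv_fourier (fourier \<phi>) = \<phi>"
  by (rule ext) (simp add: inv_fourier_def fourier_fourier)

lemma fourier_inv_fourier:
  fixes \<phi> :: "'a::euclidean_space \<Rightarrow> complex"
  assumes \<phi>: "\<phi> \<in> schwartz"
  shows "fourier (inv_fourier \<phi>) = \<phi>"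
proof
  fix x
  let ?c = "complex_of_real ((2 * pi) ^ DIM('a))"
  have i: "integrable lborel (\<lambda>\<xi>. fourier \<phi> (- \<xi>))"
    by (intro schwartz_integrable schwartz_reflect fourier_schwartz \<phi>)
  have "fourier (inv_fourier \<phi>) x = fourier (\<lambda>\<xi>. 1 / ?c * fourier \<phi> (- \<xi>) + 0 * fourier \<phi> (- \<xi>)) x"
    by (simp add: inv_fourier_def[abs_def])
  also have "\<dots> = 1 / ?c * fourier (\<lambda>\<xi>. fourier \<phi> (- \<xi>)) x"
    unfolding fourier_linear_combination[OF i i] by simp
  also have "\<dots> = \<phi> x"
    unfolding fourier_reflect[OF schwartz_measurable[OF fourier_schwartz[OF \<phi>]]] fourier_fourier[OF \<phi>] by simp
  finally show "fourier (inv_fourier \<phi>) x = \<phi> x" .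
qed

section \<open>Uniqueness of representing functions\<close>

lemma flat_exp_0_bounds: "0 \<le> flat_exp 0 t" "flat_exp 0 t \<le> 1"
  by (auto simp: flat_exp_def)

lemma flat_exp_0_ge: "1 \<le> t \<Longrightarrow> exp (-1) \<le> flat_exp 0 t"
  by (auto simp: flat_exp_def)

lemma box_bump_nonneg: "0 \<le> box_bump r a b x"
  unfolding box_bump_def by (intro prod_nonneg) (auto simp: flat_exp_0_bounds)

lemma box_bump_le_indicator:
  assumes r: "r > 0"
  shows "box_bump r a b x \<le> indicator (box a b) x"
proof (cases "x \<in> box a b")
  case True
  have "box_bump r a b x \<le> 1"
    unfolding box_bump_def by (intro prod_le_1) (auto simp: flat_exp_0_bounds mult_le_one)
  with True show ?thesis by simp
next
  case False
  then obtain i where i: "i \<in> Basis" "x \<bullet> i \<le> a \<bullet> i \<or> x \<bullet> i \<ge> b \<bullet> i"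
    by (auto simp: mem_box not_less)
  then have "r * (x \<bullet> i - a \<bullet> i) \<le> 0 \<or> r * (b \<bullet> i - x \<bullet> i) \<le> 0"
    using r by (auto simp: mult_le_0_iff)
  then have "flat_exp 0 (r * (x \<bullet> i - a \<bullet> i)) * flat_exp 0 (r * (b \<bullet> i - x \<bullet> i)) = 0"
    by (auto simp: flat_exp_eq_0)
  then have "box_bump r a b x = 0"
    unfolding box_bump_def using i(1) by (auto intro!: prod_zero)
  with False show ?thesis by simp
qed

lemma flat_exp_scaled_tendsto:
  assumes "t > 0"
  shows "(\<lambda>n. flat_exp 0 (real (Suc n) * t)) \<longlonglongrightarrow> 1"
proof -
  have "(\<lambda>n. exp (- (inverse (real (Suc n)) * inverse t))) \<longlonglongrightarrow> exp (- (0 * inverse t))"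
    by (intro tendsto_intros LIMSEQ_inverse_real_of_nat)
  moreover have "flat_exp 0 (real (Suc n) * t) = exp (- (inverse (real (Suc n)) * inverse t))" for n
    using assms by (auto simp: flat_exp_def divide_inverse mult_le_0_iff)
  ultimately show ?thesis by simp
qed

lemma box_bump_tendsto: "(\<lambda>n. box_bump (real (Suc n)) a b x) \<longlonglongrightarrow> indicator (box a b) x"
proof (cases "x \<in> box a b")
  case True
  then have "(\<lambda>n. box_bump (real (Suc n)) a b x) \<longlonglongrightarrow> (\<Prod>i\<in>(Basis::'a set). 1 * 1)"
    unfolding box_bump_def by (intro tendsto_prod tendsto_mult flat_exp_scaled_tendsto) (auto simp: mem_box)
  with True show ?thesis by simp
next
  case False
  have "box_bump (real (Suc n)) a b x = 0" for n
    using box_bump_nonneg[of "real (Suc n)" a b x] box_bump_le_indicator[of "real (Suc n)" a b x] False by simp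
  with False show ?thesis by simp
qed

lemma set_integrable_box:
  fixes U :: "'a::euclidean_space \<Rightarrow> complex"
  assumes [measurable]: "U \<in> borel_measurable borel"
    and U: "\<And>\<psi>. \<psi> \<in> test_functions \<Longrightarrow> integrable lborel (\<lambda>x. U x * \<psi> x)"
  shows "set_integrable lborel (box a b) U"
proof -
  \<comment> \<open>Enlarging the box by 1 in every direction keeps all arguments of the flat
    function at least 1 on the original box, so the bump is bounded below there by
    \<open>?c\<close>.\<close>
  let ?\<psi> = "\<lambda>x. box_bump 1 (a - One) (b + One) x" let ?c = "exp (-1) ^ (2 * DIM('a)) :: real"
  have i: "integrable lborel (\<lambda>x. U x * complex_of_real (?\<psi> x))"
    by (rule U[OF box_bump_test_function]) simp
  have "norm (indicator (box a b) x *\<^sub>R U x) \<le> norm ((1 / ?c) *\<^sub>R (U x * complex_of_real (?\<psi> x)))" for x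
  proof (cases "x \<in> box a b")
    case True
    have "(\<Prod>i\<in>(Basis :: 'a set). exp (-1) * exp (-1)) \<le> ?\<psi> x"
      unfolding box_bump_def
      by (intro prod_mono conjI mult_mono flat_exp_0_ge) (use True in \<open>auto simp: mem_box inner_simps flat_exp_0_bounds less_imp_le\<close>)
    then have "?c \<le> ?\<psi> x" by (simp add: power_mult power2_eq_square)
    then have "cmod (U x) * ?c \<le> cmod (U x) * ?\<psi> x" by (rule mult_left_mono) simp
    then show ?thesis
      using True by (simp add: norm_mult abs_of_nonneg box_bump_nonneg pos_le_divide_eq del: exp_minus)
  qed simp
  then have le: "AE x in lborel. norm (indicator (box a b) x *\<^sub>R U x) \<le> norm ((1 / ?c) *\<^sub>R (U x * complex_of_real (?\<psi> x)))"
    by (intro AE_I2)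
  have m: "(\<lambda>x. indicator (box a b) x *\<^sub>R U x) \<in> borel_measurable lborel" by measurable
  show ?thesis
    unfolding set_integrable_def
    by (rule Bochner_Integration.integrable_bound[OF integrable_scaleR_right[OF i] m le])
qed

text \<open>Steep bumps converge to the indicator of the box, and the integrands are dominated by
  the modulus of \<open>U\<close> on the box, which is integrable by
  \<open>set_integrable_box\<close>.\<close>

lemma integral_box_eq_0:
  fixes U :: "'a::euclidean_space \<Rightarrow> complex"
  assumes [measurable]: "U \<in> borel_measurable borel"
    and U: "\<And>\<psi>. \<psi> \<in> test_functions \<Longrightarrow> integrable lborel (\<lambda>x. U x * \<psi> x)"
    and 0: "\<And>\<psi>. \<psi> \<in> test_functions \<Longrightarrow> (LINT x|lborel. U x * \<psi> x) = 0"
  shows "set_lebesgue_integral lborel (box a b) U = 0"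
proof -
  have m[measurable]: "(\<lambda>x. complex_of_real (box_bump (real (Suc n)) a b x)) \<in> borel_measurable borel" for n
    by (intro schwartz_measurable subsetD[OF test_functions_subset_schwartz] box_bump_test_function) simp
  have "(\<lambda>n. LINT x|lborel. U x * complex_of_real (box_bump (real (Suc n)) a b x)) \<longlonglongrightarrow> (LINT x|lborel. indicator (box a b) x *\<^sub>R U x)"
  proof (rule integral_dominated_convergence[where w = "\<lambda>x. norm (indicator (box a b) x *\<^sub>R U x)"])
    show "integrable lborel (\<lambda>x. norm (indicator (box a b) x *\<^sub>R U x))"
      using set_integrable_box[OF assms(1) U] by (intro integrable_norm) (simp add: set_integrable_def)
    show "AE x in lborel. (\<lambda>n. U x * complex_of_real (box_bump (real (Suc n)) a b x)) \<longlonglongrightarrow> indicator (box a b) x *\<^sub>R U x"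
    proof (rule AE_I2)
      fix x
      have "(\<lambda>n. U x * complex_of_real (box_bump (real (Suc n)) a b x)) \<longlonglongrightarrow> U x * complex_of_real (indicator (box a b) x)"
        by (intro tendsto_intros box_bump_tendsto)
      then show "(\<lambda>n. U x * complex_of_real (box_bump (real (Suc n)) a b x)) \<longlonglongrightarrow> indicator (box a b) x *\<^sub>R U x"
        by (simp add: scaleR_conv_of_real mult.commute)
    qed
    show "AE x in lborel. norm (U x * complex_of_real (box_bump (real (Suc n)) a b x)) \<le> norm (indicator (box a b) x *\<^sub>R U x)" for n
    proof (rule AE_I2)
      fix x
      have "cmod (U x) * box_bump (real (Suc n)) a b x \<le> cmod (U x) * indicator (box a b) x"
        by (intro mult_left_mono box_bump_le_indicator) auto
      then show "norm (U x * complex_of_real (box_bump (real (Suc n)) a b x)) \<le> norm (indicator (box a b) x *\<^sub>R U x)"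
        by (simp add: norm_mult abs_of_nonneg box_bump_nonneg mult.commute del: of_nat_Suc)
    qed
  qed (use m in auto)
  moreover have "(LINT x|lborel. U x * complex_of_real (box_bump (real (Suc n)) a b x)) = 0" for n
    by (rule 0[OF box_bump_test_function]) simp
  ultimately show ?thesis
    by (simp add: LIMSEQ_const_iff set_lebesgue_integral_def)
qed

text \<open>Dynkin argument: open boxes are stable under intersection and generate the Borel sets,
  and the vanishing total integral handles complements.\<close>

lemma AE_eq_0_if_box_integrals_eq_0:
  fixes f :: "'a::euclidean_space \<Rightarrow> complex"
  assumes f: "integrable lborel f" and "integral\<^sup>L lborel f = 0"
    and box: "\<And>a b. set_lebesgue_integral lborel (box a b) f = 0"
  shows "AE x in lborel. f x = 0"
proof (rule sigma_finite_measure.density_zero[OF sigma_finite_lborel f])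
  have si: "set_integrable lborel A f" if "A \<in> sets borel" for A
    using f that by (simp add: set_integrable_def integrable_mult_indicator)
  fix A :: "'a set" assume "A \<in> sets lborel"
  then have A: "A \<in> sigma_sets UNIV (range (\<lambda>(a, b). box a b))" by (simp add: borel_eq_box)
  have "Int_stable (range (\<lambda>(a, b). box a b :: 'a set))" "range (\<lambda>(a, b). box a b :: 'a set) \<subseteq> Pow UNIV"
    by (auto simp: Int_stable_def box_Int_box)
  from this A show "set_lebesgue_integral lborel A f = 0"
  proof (induction rule: sigma_sets_induct_disjoint)
    case (basic A)
    then show ?case using box by auto
  next
    case empty
    then show ?case by (simp add: set_lebesgue_integral_def)
  next
    case (compl A)
    then have A: "A \<in> sets borel" by (simp add: borel_eq_box)
    have "set_lebesgue_integral lborel ((UNIV - A) \<union> A) f =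
        set_lebesgue_integral lborel (UNIV - A) f + set_lebesgue_integral lborel A f"
      using A by (intro set_integral_Un si) auto
    then show ?case using compl assms(2) by (simp add: set_lebesgue_integral_def)
  next
    case (union A)
    then have A: "\<And>i. A i \<in> sets borel" by (auto simp: borel_eq_box)
    have "set_lebesgue_integral lborel (\<Union>i. A i) f = (\<Sum>i. set_lebesgue_integral lborel (A i) f)"
      using A union(1) by (intro lebesgue_integral_countable_add si) (auto simp: disjoint_family_on_def)
    then show ?case using union by simp
  qed
qed

text \<open>\<open>U\<close> is known to be integrable only locally, so it is cut off by the boxes
  of an exhaustion of the space. The cut-off functions inherit vanishing box integrals because the
  intersection of two boxes is a box.\<close>

lemma AE_eq_0_if_test_integrals_eq_0:
  fixes U :: "'a::euclidean_space \<Rightarrow> complex"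
  assumes m [measurable]: "U \<in> borel_measurable borel"
    and U: "\<And>\<psi>. \<psi> \<in> test_functions \<Longrightarrow> integrable lborel (\<lambda>x. U x * \<psi> x)"
    and 0: "\<And>\<psi>. \<psi> \<in> test_functions \<Longrightarrow> (LINT x|lborel. U x * \<psi> x) = 0"
  shows "AE x in lborel. U x = 0"
proof -
  let ?B = "\<lambda>n. box (- real n *\<^sub>R One) (real n *\<^sub>R One) :: 'a set"
  have "AE x in lborel. indicator (?B n) x *\<^sub>R U x = 0" for n
  proof (rule AE_eq_0_if_box_integrals_eq_0)
    show "integrable lborel (\<lambda>x. indicator (?B n) x *\<^sub>R U x)"
      using set_integrable_box[OF m U] by (simp add: set_integrable_def)
    show "(LINT x|lborel. indicator (?B n) x *\<^sub>R U x) = 0"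
      using integral_box_eq_0[OF m U 0] by (simp add: set_lebesgue_integral_def)
    show "set_lebesgue_integral lborel (box a b) (\<lambda>x. indicator (?B n) x *\<^sub>R U x) = 0" for a b
    proof -
      have "set_lebesgue_integral lborel (box a b) (\<lambda>x. indicator (?B n) x *\<^sub>R U x) = set_lebesgue_integral lborel (box a b \<inter> ?B n) U"
        by (simp add: set_lebesgue_integral_def indicator_inter_arith)
      then show ?thesis unfolding box_Int_box using integral_box_eq_0[OF m U 0] by simp
    qed
  qed
  then have "AE x in lborel. \<forall>n. indicator (?B n) x *\<^sub>R U x = 0" by (subst AE_all_countable) blast
  then show ?thesis
  proof eventually_elim
    case (elim x)
    obtain n where n: "norm x < real n" using reals_Archimedean2 by blast
    then have "x \<in> ?B n"
      using Basis_le_norm[of _ x] by (force simp: mem_box)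
    then show ?case using elim by (metis indicator_simps(1) scaleR_one)
  qed
qed

text \<open>This makes the choice of a representative in \<open>fourier_fun\<close>
  harmless.\<close>

lemma represents_unique:
  assumes "represents U T" "represents V T"
  shows "AE x in lborel. U x = V x"
proof -
  have m: "U \<in> borel_measurable borel" "V \<in> borel_measurable borel"
    and i: "\<And>\<psi>. \<psi> \<in> schwartz \<Longrightarrow> integrable lborel (\<lambda>x. U x * \<psi> x)" "\<And>\<psi>. \<psi> \<in> schwartz \<Longrightarrow> integrable lborel (\<lambda>x. V x * \<psi> x)"
    and e: "\<And>\<psi>. \<psi> \<in> schwartz \<Longrightarrow> (LINT x|lborel. U x * \<psi> x) = (LINT x|lborel. V x * \<psi> x)"
    using assms by (auto simp: represents_def)
  have "AE x in lborel. U x - V x = 0"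
  proof (rule AE_eq_0_if_test_integrals_eq_0)
    show "(\<lambda>x. U x - V x) \<in> borel_measurable borel" using m by measurable
    fix \<psi> :: "'a \<Rightarrow> complex" assume "\<psi> \<in> test_functions"
    then have \<psi>: "\<psi> \<in> schwartz" using test_functions_subset_schwartz by blast
    show "integrable lborel (\<lambda>x. (U x - V x) * \<psi> x)" "(LINT x|lborel. (U x - V x) * \<psi> x) = 0"
      using i[OF \<psi>] e[OF \<psi>] by (simp_all add: left_diff_distrib Bochner_Integration.integral_diff)
  qed
  then show ?thesis by simp
qed

section \<open>The symbol\<close>

lemma csqrt_Re_pos_iff: "0 < Re (csqrt z) \<longleftrightarrow> z \<notin> \<real>\<^sub>\<le>\<^sub>0"
proof -
  have "Re (csqrt z) = 0 \<longleftrightarrow> z \<in> \<real>\<^sub>\<le>\<^sub>0"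
  proof
    assume "Re (csqrt z) = 0"
    then have "csqrt z = \<i> * of_real (Im (csqrt z))" by (simp add: complex_eq_iff)
    then have "z = (\<i> * of_real (Im (csqrt z)))\<^sup>2" by (metis power2_csqrt)
    then have "z = of_real (- (Im (csqrt z))\<^sup>2)" by (simp add: power_mult_distrib)
    then show "z \<in> \<real>\<^sub>\<le>\<^sub>0" by (metis complex_nonpos_Reals_iff Im_complex_of_real Re_complex_of_real neg_le_0_iff_le zero_le_power2)
  next
    assume "z \<in> \<real>\<^sub>\<le>\<^sub>0"
    then show "Re (csqrt z) = 0" by (auto simp: complex_nonpos_Reals_iff)
  qed
  then show ?thesis using Re_csqrt[of z] by linarith
qed

lemma the_root_Re_pos:
  assumes "z \<notin> \<real>\<^sub>\<le>\<^sub>0"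
  shows "(THE w. w\<^sup>2 = z \<and> Re w > 0) = csqrt z"
  using assms by (intro the_equality) (auto simp: csqrt_Re_pos_iff simp del: csqrt.simps intro: csqrt_unique[symmetric])

text \<open>If the sum is real then \<open>Re w * Im w = 0\<close>, so \<open>w\<close> is real and
  the sum is positive.\<close>

lemma square_add_square_not_nonpos:
  assumes "Re w > 0"
  shows "w\<^sup>2 + (of_real y)\<^sup>2 \<notin> \<real>\<^sub>\<le>\<^sub>0"
proof
  assume *: "w\<^sup>2 + (of_real y)\<^sup>2 \<in> \<real>\<^sub>\<le>\<^sub>0"
  then have "Im w = 0" using assms by (auto simp: complex_nonpos_Reals_iff power2_eq_square)
  with * have "Re w * Re w + y * y \<le> 0" by (auto simp: complex_nonpos_Reals_iff power2_eq_square)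
  moreover have "Re w * Re w > 0" "y * y \<ge> 0" using assms by simp_all
  ultimately show False by linarith
qed

lemma mu_radicand_not_nonpos:
  assumes "c > 0" "Re \<tau> > 0"
  shows "((\<tau> + \<i> * of_real v * of_real \<eta>) / of_real c)\<^sup>2 + (of_real \<eta>)\<^sup>2 \<notin> \<real>\<^sub>\<le>\<^sub>0"
    and "((\<tau> - \<i> * of_real v * of_real \<eta>) / of_real c)\<^sup>2 + (of_real \<eta>)\<^sup>2 \<notin> \<real>\<^sub>\<le>\<^sub>0"
  by (rule square_add_square_not_nonpos; use assms in simp)+

lemma mu_eq_csqrt:
  assumes "c > 0" "Re \<tau> > 0"
  shows "mu_plus v c \<tau> \<eta> = csqrt (((\<tau> + \<i> * of_real v * of_real \<eta>) / of_real c)\<^sup>2 + (of_real \<eta>)\<^sup>2)"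
    and "mu_minus v c \<tau> \<eta> = csqrt (((\<tau> - \<i> * of_real v * of_real \<eta>) / of_real c)\<^sup>2 + (of_real \<eta>)\<^sup>2)"
  unfolding mu_plus_def mu_minus_def using mu_radicand_not_nonpos[OF assms] by (auto intro: the_root_Re_pos)

lemma mu_squared:
  assumes "c > 0" "Re \<tau> > 0"
  shows "(mu_plus v c \<tau> \<eta>)\<^sup>2 = ((\<tau> + \<i> * of_real v * of_real \<eta>) / of_real c)\<^sup>2 + (of_real \<eta>)\<^sup>2"
    and "(mu_minus v c \<tau> \<eta>)\<^sup>2 = ((\<tau> - \<i> * of_real v * of_real \<eta>) / of_real c)\<^sup>2 + (of_real \<eta>)\<^sup>2"
    and "Re (mu_plus v c \<tau> \<eta>) > 0" "Re (mu_minus v c \<tau> \<eta>) > 0"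
  using mu_radicand_not_nonpos[OF assms] by (auto simp: mu_eq_csqrt[OF assms] csqrt_Re_pos_iff simp del: csqrt.simps)

text \<open>Since \<open>(\<mu>\<^sup>+ + \<mu>\<^sup>-) (\<mu>\<^sup>+ - \<mu>\<^sup>-) = 4 \<i> v \<eta> \<tau> / c\<^sup>2\<close>, the quotient in the symbol is a multiple of
  \<open>(\<mu>\<^sup>+ - \<mu>\<^sup>-)\<^sup>2\<close>.\<close>

lemma Sigma_symbol_eq:
  assumes c: "c > 0" and \<tau>: "Re \<tau> > 0"
  shows "Sigma_symbol v c \<tau> \<eta> = (of_real c)\<^sup>2 * (mu_plus v c \<tau> \<eta> * mu_minus v c \<tau> \<eta> - (of_real \<eta>)\<^sup>2)"
proof -
  define p m where "p = mu_plus v c \<tau> \<eta>" and "m = mu_minus v c \<tau> \<eta>"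
  define C V E where "C = complex_of_real c" and "V = complex_of_real v" and "E = complex_of_real \<eta>"
  have C: "C \<noteq> 0" using c by (simp add: C_def)
  have p: "C\<^sup>2 * p\<^sup>2 = (\<tau> + \<i> * V * E)\<^sup>2 + C\<^sup>2 * E\<^sup>2" and m: "C\<^sup>2 * m\<^sup>2 = (\<tau> - \<i> * V * E)\<^sup>2 + C\<^sup>2 * E\<^sup>2"
    using mu_squared(1,2)[OF c \<tau>, of v \<eta>] C
    by (simp_all add: p_def m_def C_def V_def E_def power_divide field_simps)
  have "Re (p + m) > 0" using mu_squared(3,4)[OF c \<tau>] by (simp add: p_def m_def add_pos_pos)
  then have pm: "p + m \<noteq> 0" by (metis less_irrefl zero_complex.sel(1))
  have "C\<^sup>2 * ((p + m) * (p - m)) = C\<^sup>2 * p\<^sup>2 - C\<^sup>2 * m\<^sup>2" by algebra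
  also have "\<dots> = 4 * \<i> * V * E * \<tau>" unfolding p m by algebra
  finally have pd: "C\<^sup>2 * ((p + m) * (p - m)) = 4 * \<i> * V * E * \<tau>" .
  have "C ^ 4 * ((p + m)\<^sup>2 * (p - m)\<^sup>2) = (C\<^sup>2 * ((p + m) * (p - m)))\<^sup>2" by algebra
  also have "\<dots> = - 16 * V\<^sup>2 * E\<^sup>2 * \<tau>\<^sup>2" unfolding pd by (simp add: power_mult_distrib)
  finally have sq: "C ^ 4 * ((p + m)\<^sup>2 * (p - m)\<^sup>2) = - 16 * V\<^sup>2 * E\<^sup>2 * \<tau>\<^sup>2" .
  have "V\<^sup>2 * E\<^sup>2 * (8 * (\<tau> / C / (p + m))\<^sup>2) = 8 * (V\<^sup>2 * E\<^sup>2 * \<tau>\<^sup>2) / (C\<^sup>2 * (p + m)\<^sup>2)"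
    by (simp add: power_divide power_mult_distrib)
  also have "\<dots> = - (C ^ 4 * ((p + m)\<^sup>2 * (p - m)\<^sup>2)) / 2 / (C\<^sup>2 * (p + m)\<^sup>2)"
    unfolding sq by simp
  also have "\<dots> = - (C\<^sup>2 * (p - m)\<^sup>2) / 2"
    using C pm by (simp add: divide_simps)
  finally have q: "V\<^sup>2 * E\<^sup>2 * (8 * (\<tau> / C / (p + m))\<^sup>2) = - (C\<^sup>2 * (p - m)\<^sup>2) / 2" .
  have "Sigma_symbol v c \<tau> \<eta> = \<tau>\<^sup>2 - V\<^sup>2 * E\<^sup>2 + V\<^sup>2 * E\<^sup>2 * (8 * (\<tau> / C / (p + m))\<^sup>2)"
    by (simp add: Sigma_symbol_def p_def m_def C_def V_def E_def algebra_simps)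
  \<comment> \<open>Expanding \<open>(p - m)\<^sup>2\<close> isolates the cross term
    \<open>p * m\<close>; the squares of \<open>p\<close> and \<open>m\<close> cancel the polynomial
    part except for \<open>C\<^sup>2 * E\<^sup>2\<close>.\<close>
  also have "\<dots> = \<tau>\<^sup>2 - V\<^sup>2 * E\<^sup>2 - (C\<^sup>2 * p\<^sup>2 + C\<^sup>2 * m\<^sup>2) / 2 + C\<^sup>2 * (p * m)"
    unfolding q by (simp add: power2_diff field_simps)
  also have "C\<^sup>2 * p\<^sup>2 + C\<^sup>2 * m\<^sup>2 = 2 * (\<tau>\<^sup>2 - V\<^sup>2 * E\<^sup>2 + C\<^sup>2 * E\<^sup>2)"
    unfolding p m by (simp add: power2_sum power2_diff power_mult_distrib algebra_simps)
  finally have "Sigma_symbol v c \<tau> \<eta> = C\<^sup>2 * (p * m - E\<^sup>2)"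
    by (simp add: field_simps)
  then show ?thesis by (simp add: p_def m_def C_def E_def)
qed

text \<open>Multiplying the two radicands removes the square roots. Unlike in the overview,
  \<open>M\<close> here stands for the square of \<open>v / c\<close>.\<close>

lemma mu_product_squared:
  assumes "c > 0" "Re \<tau> > 0"
  shows "(mu_plus v c \<tau> \<eta> * mu_minus v c \<tau> \<eta>)\<^sup>2 - (of_real \<eta>) ^ 4 =
    (let s = (\<tau> / of_real c)\<^sup>2; e = (of_real \<eta>)\<^sup>2; M = (of_real (v / c))\<^sup>2
     in s\<^sup>2 + 2 * (M + 1) * e * s + M * (M - 2) * e\<^sup>2)"
proof -
  define S V E where "S = \<tau> / complex_of_real c" and "V = complex_of_real (v / c)" and "E = complex_of_real \<eta>"
  have "(mu_plus v c \<tau> \<eta>)\<^sup>2 = (S + \<i> * V * E)\<^sup>2 + E\<^sup>2" "(mu_minus v c \<tau> \<eta>)\<^sup>2 = (S - \<i> * V * E)\<^sup>2 + E\<^sup>2"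
    using mu_squared(1,2)[OF assms, of v \<eta>] by (simp_all add: S_def V_def E_def add_divide_distrib diff_divide_distrib)
  then have "(mu_plus v c \<tau> \<eta> * mu_minus v c \<tau> \<eta>)\<^sup>2 - E ^ 4
      = ((S + \<i> * V * E)\<^sup>2 + E\<^sup>2) * ((S - \<i> * V * E)\<^sup>2 + E\<^sup>2) - E ^ 4"
    by (simp add: power_mult_distrib)
  also have "\<dots> = (S\<^sup>2)\<^sup>2 + 2 * (V\<^sup>2 + 1) * E\<^sup>2 * S\<^sup>2 + V\<^sup>2 * (V\<^sup>2 - 2) * (E\<^sup>2)\<^sup>2"
  proof -
    have "\<i> * \<i> = (-1 :: complex)" by simp
    then show ?thesis by algebra
  qed
  finally show ?thesis by (simp add: Let_def S_def V_def E_def)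
qed

section \<open>Lower bound for the symbol\<close>

lemma norm_add_imaginary_ge_Re: "Re z \<ge> 0 \<Longrightarrow> Re z \<le> cmod (z + \<i> * of_real r)"
  using complex_Re_le_cmod[of "z + \<i> * of_real r"] by simp

text \<open>The four factors vanish only on the imaginary axis, at distinct points when \<open>y \<noteq> 0\<close>, so at
  most one of them can be much smaller than \<open>cmod s + \<bar>y\<bar>\<close>.\<close>

lemma quartic_lower_bound:
  fixes X Y :: real
  assumes "0 < X" "X < Y"
  obtains k where "k > 0" "\<And>s y. Re s > 0 \<Longrightarrow>
    k * Re s * (cmod s + \<bar>y\<bar>) ^ 3 \<le> cmod ((s\<^sup>2 + of_real (X\<^sup>2 * y\<^sup>2)) * (s\<^sup>2 + of_real (Y\<^sup>2 * y\<^sup>2)))"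
proof -
  \<comment> \<open>Any two of the numbers X, -X, Y, -Y differ by at least \<open>d\<close>.\<close>
  define d where "d = min X (Y - X)"
  \<comment> \<open>With \<open>?m\<close> the larger of two factors, \<open>k0\<close> results from
    eliminating \<open>\<bar>y\<bar>\<close> between \<open>d * \<bar>y\<bar> \<le> 2 * ?m\<close>
    and \<open>cmod s \<le> ?m + Y * \<bar>y\<bar>\<close>.\<close>
  define k0 where "k0 = d / (d + 2 * Y + 2)"
  have d: "d > 0" "d \<le> X" "d \<le> Y - X" using assms by (auto simp: d_def)
  have k0: "k0 > 0"
    using d assms unfolding k0_def by (intro divide_pos_pos) auto
  have sep: "k0 * (cmod s + \<bar>y\<bar>) \<le> max (cmod (s - \<i> * of_real (a * y))) (cmod (s - \<i> * of_real (b * y)))"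
    if "d * \<bar>y\<bar> \<le> \<bar>(a - b) * y\<bar>" "\<bar>a\<bar> \<le> Y" for a b y :: real and s
  proof -
    let ?m = "max (cmod (s - \<i> * of_real (a * y))) (cmod (s - \<i> * of_real (b * y)))"
    have "(s - \<i> * of_real (b * y)) - (s - \<i> * of_real (a * y)) = \<i> * of_real ((a - b) * y)"
      by (simp add: algebra_simps)
    then have "\<bar>(a - b) * y\<bar> = cmod ((s - \<i> * of_real (b * y)) - (s - \<i> * of_real (a * y)))"
      by (simp add: norm_mult del: of_real_mult of_real_diff)
    also have "\<dots> \<le> 2 * ?m"
      using norm_triangle_ineq4[of "s - \<i> * of_real (b * y)" "s - \<i> * of_real (a * y)"] by linarith
    finally have 1: "d * \<bar>y\<bar> \<le> 2 * ?m" using that by linarith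
    have "cmod s \<le> cmod (s - \<i> * of_real (a * y)) + cmod (\<i> * of_real (a * y))"
      using norm_triangle_sub by (simp add: add.commute)
    also have "cmod (\<i> * of_real (a * y)) = \<bar>a\<bar> * \<bar>y\<bar>" by (simp add: norm_mult abs_mult)
    also have "\<dots> \<le> Y * \<bar>y\<bar>" using that by (intro mult_right_mono) auto
    finally have 2: "cmod s \<le> ?m + Y * \<bar>y\<bar>" by linarith
    have "d * (cmod s + \<bar>y\<bar>) \<le> d * (?m + Y * \<bar>y\<bar> + \<bar>y\<bar>)"
      using 2 d by (intro mult_left_mono) auto
    also have "\<dots> = d * ?m + (Y + 1) * (d * \<bar>y\<bar>)" by (simp add: algebra_simps)
    also have "\<dots> \<le> d * ?m + (Y + 1) * (2 * ?m)"
      using 1 assms by (intro add_left_mono mult_left_mono) auto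
    also have "\<dots> = (d + 2 * Y + 2) * ?m" by (simp add: algebra_simps)
    finally have "d * (cmod s + \<bar>y\<bar>) \<le> (d + 2 * Y + 2) * ?m" .
    then show ?thesis using d assms unfolding k0_def by (simp add: field_simps)
  qed
  have main: "k0 ^ 3 * Re s * (cmod s + \<bar>y\<bar>) ^ 3
      \<le> cmod ((s\<^sup>2 + of_real (X\<^sup>2 * y\<^sup>2)) * (s\<^sup>2 + of_real (Y\<^sup>2 * y\<^sup>2)))" if s: "Re s > 0" for s y
  proof -
    define f where "f = (\<lambda>a. cmod (s - \<i> * of_real (a * y)))"
    have "(s\<^sup>2 + of_real (X\<^sup>2 * y\<^sup>2)) * (s\<^sup>2 + of_real (Y\<^sup>2 * y\<^sup>2))
      = (s - \<i> * of_real (X * y)) * (s - \<i> * of_real (-X * y)) * ((s - \<i> * of_real (Y * y)) * (s - \<i> * of_real (-Y * y)))"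
      by (simp add: algebra_simps power2_eq_square)
    then have eq: "cmod ((s\<^sup>2 + of_real (X\<^sup>2 * y\<^sup>2)) * (s\<^sup>2 + of_real (Y\<^sup>2 * y\<^sup>2)))
        = f X * f (-X) * (f Y * f (-Y))"
      by (simp add: f_def norm_mult)
    define L where "L = k0 * (cmod s + \<bar>y\<bar>)"
    have L: "L \<ge> 0" using k0 by (simp add: L_def)
    have R: "Re s \<le> f a" for a
      using norm_add_imaginary_ge_Re[of s "- a * y"] s by (simp add: f_def)
    have pair: "L \<le> f a \<or> L \<le> f b" if "a \<in> {X, -X, Y, -Y}" "b \<in> {X, -X, Y, -Y}" "a \<noteq> b" for a b
    proof -
      have "d \<le> \<bar>a - b\<bar>" "\<bar>a\<bar> \<le> Y" using that d assms by auto
      then have "d * \<bar>y\<bar> \<le> \<bar>(a - b) * y\<bar>" "\<bar>a\<bar> \<le> Y" by (auto simp: abs_mult intro: mult_right_mono)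
      from sep[OF this, of s] show ?thesis by (auto simp: L_def f_def le_max_iff_disj)
    qed
    have step: "Re s * L ^ 3 \<le> f a * f b * (f c * f e)" if "L \<le> f b" "L \<le> f c" "L \<le> f e" for a b c e
    proof -
      have "Re s * L * (L * L) \<le> f a * f b * (f c * f e)"
        using that L R[of a] s by (intro mult_mono) (auto simp: f_def)
      then show ?thesis by (simp add: power3_eq_cube mult_ac)
    qed
    \<comment> \<open>Among any two factors one is at least \<open>L\<close>, so at most one factor
      falls below \<open>L\<close>. That one is bounded below by \<open>Re s\<close>, the other
      three by \<open>L\<close>.\<close>
    have "Re s * L ^ 3 \<le> f X * f (-X) * (f Y * f (-Y))"
    proof -
      have "(L \<le> f (-X) \<and> L \<le> f Y \<and> L \<le> f (-Y)) \<or> (L \<le> f X \<and> L \<le> f Y \<and> L \<le> f (-Y)) \<or>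
         (L \<le> f X \<and> L \<le> f (-X) \<and> L \<le> f (-Y)) \<or> (L \<le> f X \<and> L \<le> f (-X) \<and> L \<le> f Y)"
        using pair[of X "-X"] pair[of X Y] pair[of X "-Y"] pair[of "-X" Y] pair[of "-X" "-Y"] pair[of Y "-Y"] assms
        by auto
      then show ?thesis
        using step[of "-X" Y "-Y" X] step[of X Y "-Y" "-X"] step[of X "-X" "-Y" Y] step[of X "-X" Y "-Y"]
        by (auto simp: mult_ac)
    qed
    then show ?thesis unfolding eq by (simp add: L_def power_mult_distrib mult_ac)
  qed
  show ?thesis using that[of "k0 ^ 3"] main k0 by simp
qed

text \<open>Up to sign the roots are \<open>M + 1 - D\<close> and \<open>M + 1 + D\<close> with
  \<open>D = sqrt (4 * M + 1)\<close>, because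
  \<open>(M + 1)\<^sup>2 - M * (M - 2) = 4 * M + 1\<close>. From \<open>M > 2\<close> follows
  \<open>D < M + 1\<close>, so both have a positive square root.\<close>

lemma symbol_roots:
  fixes M :: real
  assumes "M > 2"
  obtains X Y where "0 < X" "X < Y"
    "\<And>s e :: complex. s\<^sup>2 + 2 * (of_real M + 1) * e * s + of_real M * (of_real M - 2) * e\<^sup>2
      = (s + of_real (X\<^sup>2) * e) * (s + of_real (Y\<^sup>2) * e)"
proof -
  define D where "D = sqrt (4 * M + 1)"
  have D: "D > 0" "D\<^sup>2 = 4 * M + 1" using assms by (auto simp: D_def)
  have "D\<^sup>2 < (M + 1)\<^sup>2" using assms D(2) by (simp add: power2_eq_square algebra_simps)
  then have lt: "D < M + 1" using assms by (auto intro: power2_less_imp_less[of D "M + 1"])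
  define X Y where "X = sqrt (M + 1 - D)" and "Y = sqrt (M + 1 + D)"
  have X: "X\<^sup>2 = M + 1 - D" "Y\<^sup>2 = M + 1 + D" using lt D assms by (auto simp: X_def Y_def)
  have "X\<^sup>2 + Y\<^sup>2 = 2 * (M + 1)" "X\<^sup>2 * Y\<^sup>2 = M * (M - 2)"
    unfolding X using D(2) by (simp_all add: power2_eq_square algebra_simps)
  then have "complex_of_real (X\<^sup>2 + Y\<^sup>2) = of_real (2 * (M + 1))"
    "complex_of_real (X\<^sup>2 * Y\<^sup>2) = of_real (M * (M - 2))"
    by (simp_all only:)
  then have "complex_of_real (X\<^sup>2) + of_real (Y\<^sup>2) = 2 * (of_real M + 1)"
    "complex_of_real (X\<^sup>2) * of_real (Y\<^sup>2) = of_real M * (of_real M - 2)"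
    by (simp_all only: of_real_add of_real_mult of_real_diff of_real_numeral of_real_1)
  then have "s\<^sup>2 + 2 * (of_real M + 1) * e * s + of_real M * (of_real M - 2) * e\<^sup>2
      = (s + of_real (X\<^sup>2) * e) * (s + of_real (Y\<^sup>2) * e)" for s e :: complex
    by algebra
  moreover have "0 < X" "X < Y" using lt D by (auto simp: X_def Y_def)
  ultimately show ?thesis using that by blast
qed

lemma Sigma_symbol_lower_bound:
  assumes v: "v > 0" and c: "c > 0" and vc: "v / c > sqrt 2"
  obtains K where "K > 0" "\<And>\<gamma> \<delta> \<eta>. \<gamma> > 0 \<Longrightarrow>
    K * \<gamma> * sqrt (\<gamma>\<^sup>2 + \<delta>\<^sup>2 + \<eta>\<^sup>2) \<le> cmod (Sigma_symbol v c (Complex \<gamma> \<delta>) \<eta>)"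
proof -
  define M where "M = (v / c)\<^sup>2"
  have "(sqrt 2)\<^sup>2 < M" unfolding M_def using vc by (intro power_strict_mono) auto
  then have "M > 2" by simp
  then obtain X Y where XY: "0 < X" "X < Y"
    and fac: "\<And>s e :: complex. s\<^sup>2 + 2 * (of_real M + 1) * e * s + of_real M * (of_real M - 2) * e\<^sup>2
      = (s + of_real (X\<^sup>2) * e) * (s + of_real (Y\<^sup>2) * e)"
    using symbol_roots by metis
  obtain k where k: "k > 0" and quart: "\<And>s y. Re s > 0 \<Longrightarrow>
    k * Re s * (cmod s + \<bar>y\<bar>) ^ 3 \<le> cmod ((s\<^sup>2 + of_real (X\<^sup>2 * y\<^sup>2)) * (s\<^sup>2 + of_real (Y\<^sup>2 * y\<^sup>2)))"
    using quartic_lower_bound[OF XY] by metis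
  \<comment> \<open>The constant in the upper bound \<open>B * L\<^sup>2\<close> for
    \<open>p * m + \<eta>\<^sup>2\<close>: both squared roots are at most
    \<open>((1 + v / c)\<^sup>2 + 1) * L\<^sup>2\<close>, and \<open>\<eta>\<^sup>2\<close> adds one
    more \<open>L\<^sup>2\<close>.\<close>
  define B where "B = (1 + v / c)\<^sup>2 + 2"
  have B: "B > 0" by (simp add: B_def add_nonneg_pos)
  \<comment> \<open>The factor \<open>c\<close> is what remains of the prefactor
    \<open>c\<^sup>2\<close> of the symbol after inserting \<open>Re s = \<gamma> / c\<close>; the
    minimum compares \<open>L\<close> with the square root of the weight.\<close>
  define K where "K = c * k * min (1 / c) 1 / B"
  have bound: "K * \<gamma> * sqrt (\<gamma>\<^sup>2 + \<delta>\<^sup>2 + \<eta>\<^sup>2) \<le> cmod (Sigma_symbol v c (Complex \<gamma> \<delta>) \<eta>)"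
    if \<gamma>: "\<gamma> > 0" for \<gamma> \<delta> \<eta>
  proof -
    define \<tau> where "\<tau> = Complex \<gamma> \<delta>"
    have \<tau>: "Re \<tau> > 0" using \<gamma> by (simp add: \<tau>_def)
    define s where "s = \<tau> / of_real c"
    have s: "Re s > 0" "Re s = \<gamma> / c" using \<tau> c by (auto simp: s_def \<tau>_def)
    define p m where "p = mu_plus v c \<tau> \<eta>" and "m = mu_minus v c \<tau> \<eta>"
    define L where "L = cmod s + \<bar>\<eta>\<bar>"
    have "cmod s > 0" using s(1) by auto
    then have L: "L > 0" by (simp add: L_def add_pos_nonneg)
    have "(p * m)\<^sup>2 - (of_real \<eta>) ^ 4 = (s\<^sup>2 + of_real (X\<^sup>2 * \<eta>\<^sup>2)) * (s\<^sup>2 + of_real (Y\<^sup>2 * \<eta>\<^sup>2))"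
      unfolding p_def m_def mu_product_squared[OF c \<tau>] Let_def s_def
      using fac[of "(\<tau> / of_real c)\<^sup>2" "(of_real \<eta>)\<^sup>2"] by (simp add: M_def)
    then have lower: "k * Re s * L ^ 3 \<le> cmod ((p * m - (of_real \<eta>)\<^sup>2) * (p * m + (of_real \<eta>)\<^sup>2))"
      using quart[OF s(1), of \<eta>] by (simp add: L_def algebra_simps power2_eq_square power4_eq_xxxx)
    have rad: "cmod ((s + w)\<^sup>2 + (of_real \<eta>)\<^sup>2) \<le> ((1 + v / c)\<^sup>2 + 1) * L\<^sup>2" if "cmod w = v / c * \<bar>\<eta>\<bar>" for w
    proof -
      have "cmod (s + w) \<le> cmod s + v / c * \<bar>\<eta>\<bar>" using norm_triangle_ineq[of s w] that by simp
      also have "\<dots> \<le> (1 + v / c) * L"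
        using v c by (simp add: L_def algebra_simps)
      finally have "(cmod (s + w))\<^sup>2 \<le> ((1 + v / c) * L)\<^sup>2" by (intro power_mono) auto
      then have "(cmod (s + w))\<^sup>2 \<le> (1 + v / c)\<^sup>2 * L\<^sup>2" by (simp only: power_mult_distrib)
      moreover have "\<bar>\<eta>\<bar>\<^sup>2 \<le> L\<^sup>2" by (intro power_mono) (auto simp: L_def)
      ultimately show ?thesis
        using norm_triangle_ineq[of "(s + w)\<^sup>2" "(of_real \<eta>)\<^sup>2"]
        by (simp add: norm_power distrib_right)
    qed
    have "p\<^sup>2 = (s + \<i> * of_real (v / c) * of_real \<eta>)\<^sup>2 + (of_real \<eta>)\<^sup>2"
      "m\<^sup>2 = (s + \<i> * of_real (v / c) * of_real (- \<eta>))\<^sup>2 + (of_real \<eta>)\<^sup>2"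
      using mu_squared(1,2)[OF c \<tau>, of v \<eta>]
      by (simp_all add: p_def m_def s_def add_divide_distrib diff_divide_distrib)
    then have "cmod (p\<^sup>2) \<le> ((1 + v / c)\<^sup>2 + 1) * L\<^sup>2" "cmod (m\<^sup>2) \<le> ((1 + v / c)\<^sup>2 + 1) * L\<^sup>2"
      using v c rad[of "\<i> * of_real (v / c) * of_real \<eta>"] rad[of "\<i> * of_real (v / c) * of_real (- \<eta>)"]
      by (simp_all add: norm_mult norm_divide)
    then have "cmod (p * m) \<le> ((1 + v / c)\<^sup>2 + 1) * L\<^sup>2"
      using sum_squares_bound[of "cmod p" "cmod m"] by (simp add: norm_mult norm_power)
    moreover have "\<bar>\<eta>\<bar>\<^sup>2 \<le> L\<^sup>2" by (intro power_mono) (auto simp: L_def)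
    ultimately have upper: "cmod (p * m + (of_real \<eta>)\<^sup>2) \<le> B * L\<^sup>2"
      using norm_triangle_ineq[of "p * m" "(of_real \<eta>)\<^sup>2"]
      by (simp add: norm_power B_def algebra_simps)
    \<comment> \<open>The cubic lower bound of the product meets the quadratic upper bound of the
      second factor, so one power of \<open>L\<close> survives.\<close>
    have "k * Re s * L ^ 3 \<le> cmod (p * m - (of_real \<eta>)\<^sup>2) * (B * L\<^sup>2)"
      using lower upper by (simp add: norm_mult) (meson mult_left_mono norm_ge_zero order_trans)
    then have "(k * Re s * L) * L\<^sup>2 \<le> (B * cmod (p * m - (of_real \<eta>)\<^sup>2)) * L\<^sup>2"
      by (simp add: power3_eq_cube power2_eq_square mult_ac)
    then have kL: "k * Re s * L \<le> B * cmod (p * m - (of_real \<eta>)\<^sup>2)"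
      using L by simp
    have Lw: "min (1 / c) 1 * sqrt (\<gamma>\<^sup>2 + \<delta>\<^sup>2 + \<eta>\<^sup>2) \<le> L"
    proof -
      have "sqrt (\<gamma>\<^sup>2 + \<delta>\<^sup>2 + \<eta>\<^sup>2) \<le> sqrt (\<gamma>\<^sup>2 + \<delta>\<^sup>2) + sqrt (\<eta>\<^sup>2)"
        by (rule sqrt_add_le_add_sqrt) auto
      also have "sqrt (\<gamma>\<^sup>2 + \<delta>\<^sup>2) = c * cmod s"
      proof -
        have "c * cmod s = cmod \<tau>" using c by (simp add: s_def norm_divide)
        then show ?thesis by (simp add: \<tau>_def complex_norm)
      qed
      finally have "min (1 / c) 1 * sqrt (\<gamma>\<^sup>2 + \<delta>\<^sup>2 + \<eta>\<^sup>2) \<le> min (1 / c) 1 * (c * cmod s + \<bar>\<eta>\<bar>)"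
        using c by (intro mult_left_mono) auto
      also have "\<dots> = (min (1 / c) 1) * (c * cmod s) + (min (1 / c) 1) * \<bar>\<eta>\<bar>" by (simp add: algebra_simps)
      also have "\<dots> \<le> 1 / c * (c * cmod s) + 1 * \<bar>\<eta>\<bar>"
        using c by (intro add_mono mult_right_mono) auto
      finally show ?thesis using c by (simp add: L_def)
    qed
    have "K * \<gamma> * sqrt (\<gamma>\<^sup>2 + \<delta>\<^sup>2 + \<eta>\<^sup>2) = c * k * \<gamma> / B * (min (1 / c) 1 * sqrt (\<gamma>\<^sup>2 + \<delta>\<^sup>2 + \<eta>\<^sup>2))"
      by (simp add: K_def)
    also have "\<dots> \<le> c * k * \<gamma> / B * L"
      using Lw c k \<gamma> B by (intro mult_left_mono) auto
    also have "\<dots> = c\<^sup>2 * (k * Re s * L) / B" using c by (simp add: s power2_eq_square)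
    also have "\<dots> \<le> c\<^sup>2 * (B * cmod (p * m - (of_real \<eta>)\<^sup>2)) / B"
      using kL B by (intro divide_right_mono mult_left_mono) auto
    also have "\<dots> = cmod (Sigma_symbol v c \<tau> \<eta>)"
      unfolding Sigma_symbol_eq[OF c \<tau>] p_def m_def using B by (simp add: norm_mult norm_power)
    finally show ?thesis by (simp add: \<tau>_def)
  qed
  have "K > 0" using c k B by (simp add: K_def)
  then show ?thesis using bound that by blast
qed

text \<open>Serves measurability of the symbol. The radicands avoid the closed negative real axis,
  off which \<open>csqrt\<close> is continuous.\<close>

lemma continuous_on_Sigma_symbol:
  assumes "c > 0" "\<gamma> > 0"
  shows "continuous_on UNIV (\<lambda>(\<delta>, \<eta>). Sigma_symbol v c (Complex \<gamma> \<delta>) \<eta>)"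
proof -
  have [continuous_intros]: "continuous_on UNIV (\<lambda>p::real \<times> real. Complex \<gamma> (fst p))"
    unfolding Complex_eq by (intro continuous_intros)
  have csqrt: "continuous_on UNIV (\<lambda>p::real \<times> real. csqrt (f p))"
    if "continuous_on UNIV f" "\<And>p. f p \<notin> \<real>\<^sub>\<le>\<^sub>0" for f
    by (rule continuous_on_compose2[OF continuous_on_csqrt that(1)]) (use that(2) in auto)
  have "continuous_on UNIV (\<lambda>p::real\<times>real. (of_real c)\<^sup>2 *
     (csqrt (((Complex \<gamma> (fst p) + \<i> * of_real v * of_real (snd p)) / of_real c)\<^sup>2 + (of_real (snd p))\<^sup>2)
    * csqrt (((Complex \<gamma> (fst p) - \<i> * of_real v * of_real (snd p)) / of_real c)\<^sup>2 + (of_real (snd p))\<^sup>2)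
    - (of_real (snd p))\<^sup>2))"
    using assms
    by (intro continuous_on_mult continuous_on_diff continuous_on_const csqrt
        mu_radicand_not_nonpos[OF assms(1)] continuous_on_add continuous_on_divide
        continuous_on_power continuous_on_of_real continuous_on_fst continuous_on_snd
        continuous_on_id continuous_intros) auto
  then show ?thesis
    using assms by (simp add: case_prod_beta Sigma_symbol_eq mu_eq_csqrt)
qed

section \<open>Weighted Sobolev spaces\<close>

text \<open>The transform of a distribution is defined by transposition, so the value of
  \<open>T\<close> at \<phi> is recovered by testing its transform against
  \<open>inv_fourier \<phi>\<close>.\<close>

lemma tempered_eq_if_fourier_AE_eq:
  assumes T: "T \<in> tempered_distributions" "represents U (fourier_tempered T)"
    and T': "T' \<in> tempered_distributions" "represents V (fourier_tempered T')"
    and UV: "AE \<xi> in lborel. U \<xi> = V \<xi>"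
  shows "T = T'"
proof (rule extensionalityI)
  show "T \<in> extensional schwartz" "T' \<in> extensional schwartz"
    using T T' by (auto simp: tempered_distributions_def)
  fix \<phi> :: "'a \<Rightarrow> complex" assume \<phi>: "\<phi> \<in> schwartz"
  note \<psi> = inv_fourier_schwartz[OF \<phi>]
  have [measurable]: "U \<in> borel_measurable borel" "V \<in> borel_measurable borel" "inv_fourier \<phi> \<in> borel_measurable borel"
    using T(2) T'(2) schwartz_measurable[OF \<psi>] by (auto simp: represents_def)
  have "T \<phi> = (LINT \<xi>|lborel. U \<xi> * inv_fourier \<phi> \<xi>)"
    using T(2) \<psi> fourier_inv_fourier[OF \<phi>] by (force simp: represents_def fourier_tempered_def)
  also have "\<dots> = (LINT \<xi>|lborel. V \<xi> * inv_fourier \<phi> \<xi>)"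
    by (rule integral_cong_AE) (use UV in auto)
  also have "\<dots> = T' \<phi>"
    using T'(2) \<psi> fourier_inv_fourier[OF \<phi>] by (force simp: represents_def fourier_tempered_def)
  finally show "T \<phi> = T' \<phi>" .
qed

lemma represents_fourier_fun:
  assumes "T \<in> sobolev s"
  shows "represents (fourier_fun T) (fourier_tempered T)"
  unfolding fourier_fun_def
  by (rule someI_ex[of "\<lambda>U. represents U (fourier_tempered T)"]) (use assms in \<open>simp add: sobolev_def\<close>)

text \<open>The sign of \<open>r\<close> decides which of the two comparisons is used;
  \<open>\<bar>r\<bar>\<close> gives one constant for both cases.\<close>

lemma powr_le_comparable:
  fixes a b c r :: real
  assumes "0 < a" "0 < b" "0 < c" "a \<le> c * b" "b \<le> c * a"
  shows "a powr r \<le> c powr \<bar>r\<bar> * b powr r"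
proof (cases "r \<ge> 0")
  case True
  then have "a powr r \<le> (c * b) powr r" using assms by (intro powr_mono2) auto
  with True show ?thesis using assms by (simp add: powr_mult)
next
  case False
  have "b / c \<le> a" using assms by (simp add: field_simps)
  then have "a powr r \<le> (b / c) powr r" using False assms by (intro powr_mono2') auto
  also have "\<dots> = c powr (- r) * b powr r" using assms by (simp add: powr_divide powr_minus field_simps)
  finally show ?thesis using False by simp
qed

text \<open>Cauchy-Schwarz in the pointwise form \<open>A * B \<le> A\<^sup>2 + B\<^sup>2\<close>:
  here \<open>A\<^sup>2\<close> is the given integrand and \<open>B\<^sup>2\<close> is at most
  \<open>decay\<close>.\<close>

lemma weighted_L2_imp_decay_integrable:
  fixes V :: "'a::euclidean_space \<Rightarrow> complex"
  assumes [measurable]: "V \<in> borel_measurable borel"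
    and i: "integrable lborel (\<lambda>\<xi>. (1 + (norm \<xi>)\<^sup>2) powr r * (cmod (V \<xi>))\<^sup>2)"
  obtains N where "integrable lborel (\<lambda>\<xi>. inverse ((1 + norm \<xi>) ^ N) * cmod (V \<xi>))"
proof -
  \<comment> \<open>\<open>m\<close> replaces the real exponent by a natural one, since
    \<open>w powr (- r) \<le> (1 + norm \<xi>) ^ (2 * m)\<close> for
    \<open>w = 1 + (norm \<xi>)\<^sup>2\<close>; the further \<open>DIM('a)\<close> powers leave
    \<open>decay\<close> as the bound of \<open>B\<^sup>2\<close>.\<close>
  define m where "m = nat \<lceil>\<bar>r\<bar>\<rceil>"
  let ?N = "m + DIM('a)"
  have "norm (inverse ((1 + norm \<xi>) ^ ?N) * cmod (V \<xi>)) \<le>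
      norm ((1 + (norm \<xi>)\<^sup>2) powr r * (cmod (V \<xi>))\<^sup>2 + decay \<xi>)" for \<xi> :: 'a
  proof -
    define w where "w = 1 + (norm \<xi>)\<^sup>2"
    have w: "w \<ge> 1" by (simp add: w_def)
    have "- r \<le> \<bar>r\<bar>" by simp
    also have "\<dots> \<le> real m" unfolding m_def by (rule real_nat_ceiling_ge)
    finally have "w powr (- r) \<le> w powr real m" using w by (rule powr_mono)
    also have "\<dots> = w ^ m" using w by (simp add: powr_realpow)
    also have "\<dots> \<le> ((1 + norm \<xi>)\<^sup>2) ^ m"
      by (intro power_mono) (auto simp: w_def power2_sum)
    finally have le: "w powr (- r) \<le> (1 + norm \<xi>) ^ (2 * m)" by (simp add: power_mult)
    define A B where "A = w powr (r / 2) * cmod (V \<xi>)" and "B = w powr (- r / 2) * inverse ((1 + norm \<xi>) ^ ?N)"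
    have "A * B = inverse ((1 + norm \<xi>) ^ ?N) * cmod (V \<xi>)"
      using w by (simp add: A_def B_def powr_minus field_simps)
    moreover have "A\<^sup>2 = w powr r * (cmod (V \<xi>))\<^sup>2"
      using w by (simp add: A_def power_mult_distrib power2_eq_square powr_add[symmetric])
    moreover have "B\<^sup>2 \<le> decay \<xi>"
    proof -
      have "B\<^sup>2 = w powr (- r) * (inverse ((1 + norm \<xi>) ^ ?N))\<^sup>2"
        using w by (simp add: B_def power_mult_distrib power2_eq_square powr_add[symmetric])
      also have "\<dots> \<le> (1 + norm \<xi>) ^ (2 * m) * (inverse ((1 + norm \<xi>) ^ ?N))\<^sup>2"
        using le by (rule mult_right_mono) simp
      also have "(1 + norm \<xi>) ^ (2 * m) * (inverse ((1 + norm \<xi>) ^ ?N))\<^sup>2 = decay \<xi>"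
      proof -
        define a where "a = 1 + norm \<xi>"
        have a: "a > 0" by (simp add: a_def add_pos_nonneg)
        have "(a ^ ?N)\<^sup>2 = a ^ (2 * m) * a ^ (2 * DIM('a))"
          by (simp only: power_mult[symmetric] power_add[symmetric]) (simp add: algebra_simps)
        then have "a ^ (2 * m) * (inverse (a ^ ?N))\<^sup>2 = inverse (a ^ (2 * DIM('a)))"
          using a by (simp only: power_inverse) (simp add: field_simps)
        then show ?thesis by (simp only: a_def)
      qed
      finally show ?thesis .
    qed
    moreover have "A * B \<le> A\<^sup>2 + B\<^sup>2"
    proof -
      have "0 \<le> A * B" by (simp add: A_def B_def)
      then show ?thesis using sum_squares_bound[of A B] by (simp add: mult.assoc)
    qed
    ultimately show ?thesis by (simp add: w_def)
  qed
  then have "integrable lborel (\<lambda>\<xi>::'a. inverse ((1 + norm \<xi>) ^ ?N) * cmod (V \<xi>))"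
    by (intro Bochner_Integration.integrable_bound[OF Bochner_Integration.integrable_add[OF i integrable_decay]] AE_I2) auto
  then show ?thesis by (rule that)
qed

lemma integrable_mult_decay:
  fixes V \<psi> :: "'a::euclidean_space \<Rightarrow> complex"
  assumes [measurable]: "V \<in> borel_measurable borel" "\<psi> \<in> borel_measurable borel"
    and i: "integrable lborel (\<lambda>\<xi>. inverse ((1 + norm \<xi>) ^ N) * cmod (V \<xi>))"
    and le: "\<And>\<xi>. (1 + norm \<xi>) ^ N * cmod (\<psi> \<xi>) \<le> C"
  shows "integrable lborel (\<lambda>\<xi>. V \<xi> * \<psi> \<xi>)"
    and "cmod (LINT \<xi>|lborel. V \<xi> * \<psi> \<xi>) \<le> C * (LINT \<xi>|lborel. inverse ((1 + norm \<xi>) ^ N) * cmod (V \<xi>))"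
proof -
  have le': "cmod (V \<xi> * \<psi> \<xi>) \<le> C * (inverse ((1 + norm \<xi>) ^ N) * cmod (V \<xi>))" for \<xi>
  proof -
    have pos: "(1 + norm \<xi>) ^ N > 0" by (simp add: add_pos_nonneg)
    have "cmod (V \<xi> * \<psi> \<xi>) = ((1 + norm \<xi>) ^ N * cmod (\<psi> \<xi>)) * (inverse ((1 + norm \<xi>) ^ N) * cmod (V \<xi>))"
      using norm_ge_zero[of \<xi>] by (simp add: norm_mult field_simps add_nonneg_eq_0_iff)
    also have "\<dots> \<le> C * (inverse ((1 + norm \<xi>) ^ N) * cmod (V \<xi>))"
      using pos by (intro mult_right_mono le) auto
    finally show ?thesis .
  qed
  have iC: "integrable lborel (\<lambda>\<xi>. C * (inverse ((1 + norm \<xi>) ^ N) * cmod (V \<xi>)))"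
    using i by (rule integrable_mult_right)
  show int: "integrable lborel (\<lambda>\<xi>. V \<xi> * \<psi> \<xi>)"
    by (rule Bochner_Integration.integrable_bound[OF iC]) (auto intro!: AE_I2 order_trans[OF le'])
  have "cmod (LINT \<xi>|lborel. V \<xi> * \<psi> \<xi>) \<le> (LINT \<xi>|lborel. cmod (V \<xi> * \<psi> \<xi>))"
    by (rule integral_norm_bound)
  also have "\<dots> \<le> (LINT \<xi>|lborel. C * (inverse ((1 + norm \<xi>) ^ N) * cmod (V \<xi>)))"
    using int iC le' by (intro integral_mono) auto
  finally show "cmod (LINT \<xi>|lborel. V \<xi> * \<psi> \<xi>) \<le> C * (LINT \<xi>|lborel. inverse ((1 + norm \<xi>) ^ N) * cmod (V \<xi>))"
    by simp
qed

lemma inv_fourier_linear_combination: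
  assumes "\<phi> \<in> schwartz" "\<psi> \<in> schwartz"
  shows "inv_fourier (\<lambda>x. a * \<phi> x + b * \<psi> x) \<xi> = a * inv_fourier \<phi> \<xi> + b * inv_fourier \<psi> \<xi>"
  unfolding inv_fourier_def
  by (subst fourier_linear_combination) (auto intro: schwartz_integrable assms simp: add_divide_distrib)

lemma sobolev_exists:
  fixes V :: "'a::euclidean_space \<Rightarrow> complex"
  assumes m: "V \<in> borel_measurable borel"
    and i: "integrable lborel (\<lambda>\<xi>. (1 + (norm \<xi>)\<^sup>2) powr r * (cmod (V \<xi>))\<^sup>2)"
  obtains T where "T \<in> sobolev r" "AE \<xi> in lborel. fourier_fun T \<xi> = V \<xi>"
proof -
  note [measurable] = m
  obtain N where N: "integrable lborel (\<lambda>\<xi>. inverse ((1 + norm \<xi>) ^ N) * cmod (V \<xi>))"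
    using weighted_L2_imp_decay_integrable[OF m i] by blast
  have int: "integrable lborel (\<lambda>\<xi>. V \<xi> * \<psi> \<xi>)" if \<psi>: "\<psi> \<in> schwartz" for \<psi>
  proof -
    obtain C where "\<And>x. (1 + norm x) ^ N * cmod (iter_deriv [] \<psi> x) \<le> C"
      using schwartz_bound[OF \<psi>, of "[]" N] by (metis empty_set empty_subsetI)
    then show ?thesis by (intro integrable_mult_decay(1)[OF m schwartz_measurable[OF \<psi>] N]) simp
  qed
  define T where "T = (\<lambda>\<phi>\<in>schwartz. LINT \<xi>|lborel. V \<xi> * inv_fourier \<phi> \<xi>)"
  have tempered: "T \<in> tempered_distributions"
    unfolding tempered_distributions_def
  proof (intro CollectI conjI)
    show "T \<in> extensional schwartz" by (simp add: T_def)
    show "linear_functional_on schwartz T"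
      unfolding linear_functional_on_def
    proof (intro ballI allI)
      fix \<phi> \<psi> :: "'a \<Rightarrow> complex" and a b assume S: "\<phi> \<in> schwartz" "\<psi> \<in> schwartz"
      have "(LINT \<xi>|lborel. V \<xi> * inv_fourier (\<lambda>x. a * \<phi> x + b * \<psi> x) \<xi>) =
          (LINT \<xi>|lborel. a * (V \<xi> * inv_fourier \<phi> \<xi>) + b * (V \<xi> * inv_fourier \<psi> \<xi>))"
        unfolding inv_fourier_linear_combination[OF S] by (simp add: algebra_simps)
      also have "\<dots> = a * (LINT \<xi>|lborel. V \<xi> * inv_fourier \<phi> \<xi>) + b * (LINT \<xi>|lborel. V \<xi> * inv_fourier \<psi> \<xi>)"
        using int[OF inv_fourier_schwartz[OF S(1)]] int[OF inv_fourier_schwartz[OF S(2)]]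
        by (subst Bochner_Integration.integral_add) auto
      finally show "T (\<lambda>x. a * \<phi> x + b * \<psi> x) = a * T \<phi> + b * T \<psi>"
        using S schwartz_linear_combination[OF S] by (simp add: T_def)
    qed
    obtain M C where MC: "\<And>\<phi> \<xi>. \<phi> \<in> schwartz \<Longrightarrow> (1 + norm (\<xi>::'a)) ^ N * cmod (fourier \<phi> \<xi>) \<le> C * seminorm M M \<phi>"
      using fourier_decay[of N] by blast
    let ?c = "(2 * pi) ^ DIM('a)" and ?I = "LINT \<xi>|lborel. inverse ((1 + norm \<xi>) ^ N) * cmod (V \<xi>)"
    have "cmod (T \<phi>) \<le> C / ?c * ?I * seminorm M M \<phi>" if \<phi>: "\<phi> \<in> schwartz" for \<phi>
    proof -
      have "(1 + norm \<xi>) ^ N * cmod (inv_fourier \<phi> \<xi>) \<le> C * seminorm M M \<phi> / ?c" for \<xi>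
        using divide_right_mono[OF MC[OF \<phi>, of "- \<xi>"], of ?c] by (simp add: inv_fourier_def norm_divide norm_power norm_mult)
      from integrable_mult_decay(2)[OF m schwartz_measurable[OF inv_fourier_schwartz[OF \<phi>]] N this]
      show ?thesis using \<phi> by (simp add: T_def mult_ac)
    qed
    then show "\<exists>N C. \<forall>\<phi>\<in>schwartz. cmod (T \<phi>) \<le> C * seminorm N N \<phi>" by blast
  qed
  have rep: "represents V (fourier_tempered T)"
    unfolding represents_def fourier_tempered_def
    using int m by (auto simp: T_def fourier_schwartz inv_fourier_fourier)
  then have rep': "represents (fourier_fun T) (fourier_tempered T)"
    unfolding fourier_fun_def by (rule someI[of "\<lambda>U. represents U (fourier_tempered T)"])
  have [measurable]: "fourier_fun T \<in> borel_measurable borel" using rep' by (simp add: represents_def)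
  have ae: "AE \<xi> in lborel. fourier_fun T \<xi> = V \<xi>" by (rule represents_unique[OF rep' rep])
  \<comment> \<open>\<open>sobolev\<close> speaks of the chosen representative
    \<open>fourier_fun T\<close>, so integrability is carried over from \<open>V\<close> along the
    a.e. equality.\<close>
  have "integrable lborel (\<lambda>\<xi>. (1 + (norm \<xi>)\<^sup>2) powr r * (cmod (fourier_fun T \<xi>))\<^sup>2)"
    by (subst integrable_cong_AE[where g = "\<lambda>\<xi>. (1 + (norm \<xi>)\<^sup>2) powr r * (cmod (V \<xi>))\<^sup>2"]) (use ae i in auto)
  then have "T \<in> sobolev r" using tempered rep by (auto simp: sobolev_def)
  then show ?thesis using ae that by blast
qed

section \<open>Multiplication of distributions by an exponential in t\<close>

abbreviation exp_mult :: "real \<Rightarrow> (real \<times> real \<Rightarrow> complex) \<Rightarrow> real \<times> real \<Rightarrow> complex" where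
  "exp_mult k \<phi> \<equiv> (\<lambda>p. complex_of_real (exp (k * fst p)) * \<phi> p)"

lemma smooth_exp_fst: "smooth (\<lambda>p::real \<times> real. complex_of_real (exp (k * fst p)))"
proof -
  let ?H = "\<lambda>j t. complex_of_real (k ^ j * exp (k * t))"
  have H: "(?H j has_vector_derivative ?H (Suc j) t) (at t)" for j t
    by (rule has_vector_derivative_of_real)
      (auto intro!: derivative_eq_intros simp flip: has_real_derivative_iff_has_vector_derivative)
  show ?thesis using smooth_compose_linear(1)[of ?H "(1, 0) :: real \<times> real" 0, OF H]
    by (simp add: inner_prod_def)
qed

lemma exp_mult_test_function: "\<phi> \<in> test_functions \<Longrightarrow> exp_mult k \<phi> \<in> test_functions"
  by (rule test_functions_mult(1)[OF smooth_exp_fst])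

lemma exp_mult_inverse: "exp_mult k (exp_mult (- k) \<phi>) = \<phi>" "exp_mult (- k) (exp_mult k \<phi>) = \<phi>"
proof -
  have "complex_of_real (exp (k * t)) * complex_of_real (exp (- k * t)) = 1" for k t
    unfolding of_real_mult[symmetric] exp_add[symmetric] by simp
  from this[of k] this[of "- k"] show "exp_mult k (exp_mult (- k) \<phi>) = \<phi>" "exp_mult (- k) (exp_mult k \<phi>) = \<phi>"
    unfolding mult.assoc[symmetric] by simp_all
qed

lemma exp_weight_eq: "exp_weight \<gamma> u = (\<lambda>\<phi>\<in>test_functions. u (exp_mult (- \<gamma>) \<phi>))"
  by (simp add: exp_weight_def case_prod_beta')

text \<open>Multiplication by an exponential is a bijection of the test functions onto
  themselves.\<close>

lemma exp_weight_inj: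
  assumes "u \<in> distributions" "w \<in> distributions" "exp_weight \<gamma> u = exp_weight \<gamma> w"
  shows "u = w"
proof (rule extensionalityI)
  show "u \<in> extensional test_functions" "w \<in> extensional test_functions"
    using assms by (auto simp: distributions_def)
  fix \<phi> :: "real \<times> real \<Rightarrow> complex" assume "\<phi> \<in> test_functions"
  then have "exp_mult \<gamma> \<phi> \<in> test_functions" by (rule exp_mult_test_function)
  then have "u (exp_mult (- \<gamma>) (exp_mult \<gamma> \<phi>)) = w (exp_mult (- \<gamma>) (exp_mult \<gamma> \<phi>))"
    using fun_cong[OF assms(3), of "exp_mult \<gamma> \<phi>"] by (simp only: exp_weight_eq restrict_apply if_True)
  then show "u \<phi> = w \<phi>" by (simp only: exp_mult_inverse)
qed

text \<open>On a compact set the polynomial weight and each derivative of \<open>p\<close> are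
  bounded, so the weight index drops to 0 on the right. This bridges the two notions of continuity:
  weighted seminorms for tempered distributions, \<open>seminorm 0 N\<close> on compact sets for
  distributions.\<close>

lemma seminorm_mult_le:
  fixes p :: "'a::euclidean_space \<Rightarrow> complex"
  assumes p: "smooth p" and K: "compact K"
  obtains B where "B \<ge> 0" "\<And>\<phi>. \<phi> \<in> test_functions \<Longrightarrow> supp \<phi> \<subseteq> K \<Longrightarrow>
    seminorm k N (\<lambda>x. p x * \<phi> x) \<le> B * seminorm 0 N \<phi>"
proof -
  have "\<exists>M\<ge>0. \<forall>x\<in>K. (1 + norm x) ^ k * cmod (iter_deriv as p x) \<le> M" if "set as \<subseteq> Basis" for as
  proof -
    have "continuous_on K (\<lambda>x. (1 + norm x) ^ k * cmod (iter_deriv as p x))"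
      by (intro continuous_intros continuous_on_iter_deriv p that)
    then have "bounded ((\<lambda>x. (1 + norm x) ^ k * cmod (iter_deriv as p x)) ` K)"
      using K by (intro compact_imp_bounded compact_continuous_image)
    then obtain M where "\<forall>x\<in>K. norm ((1 + norm x) ^ k * cmod (iter_deriv as p x)) \<le> M" "M > 0"
      unfolding bounded_pos by auto
    then show ?thesis by (intro exI[of _ M]) auto
  qed
  then obtain M where M: "\<And>as. set as \<subseteq> Basis \<Longrightarrow> M as \<ge> 0"
    "\<And>as x. set as \<subseteq> Basis \<Longrightarrow> x \<in> K \<Longrightarrow> (1 + norm x) ^ k * cmod (iter_deriv as p x) \<le> M as"
    by metis
  define B where "B = (\<Sum>bs::'a list | set bs \<subseteq> Basis \<and> length bs \<le> N. \<Sum>q\<leftarrow>splits bs. M (fst q))"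
  have sub: "set (fst q) \<subseteq> Basis" "set (snd q) \<subseteq> Basis" "length (snd q) \<le> length bs"
    if "q \<in> set (splits bs)" "set bs \<subseteq> Basis" for q and bs :: "'a list"
    using splits_subset[of "fst q" "snd q" bs] splits_length[of "fst q" "snd q" bs] that by auto
  have "B \<ge> 0" unfolding B_def
    by (intro sum_nonneg sum_list_nonneg) (use sub M(1) in auto)
  moreover have "seminorm k N (\<lambda>x. p x * \<phi> x) \<le> B * seminorm 0 N \<phi>"
    if \<phi>: "\<phi> \<in> test_functions" "supp \<phi> \<subseteq> K" for \<phi>
  proof -
    have S: "\<phi> \<in> schwartz" using \<phi> test_functions_subset_schwartz by blast
    have "seminorm k N (\<lambda>x. p x * \<phi> x) \<le>
      (\<Sum>bs::'a list | set bs \<subseteq> Basis \<and> length bs \<le> N. (\<Sum>q\<leftarrow>splits bs. M (fst q)) * seminorm 0 N \<phi>)"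
    proof (rule seminorm_le)
      fix bs :: "'a list" and x assume bs: "set bs \<subseteq> Basis" "length bs \<le> N"
      have "(1 + norm x) ^ k * cmod (iter_deriv (fst q) p x * iter_deriv (snd q) \<phi> x) \<le> M (fst q) * seminorm 0 N \<phi>"
        if q: "q \<in> set (splits bs)" for q
      proof (cases "x \<in> K")
        case True
        have "(1 + norm x) ^ k * cmod (iter_deriv (fst q) p x * iter_deriv (snd q) \<phi> x) =
            ((1 + norm x) ^ k * cmod (iter_deriv (fst q) p x)) * ((1 + norm x) ^ 0 * cmod (iter_deriv (snd q) \<phi> x))"
          by (simp add: norm_mult)
        also have "\<dots> \<le> M (fst q) * seminorm 0 N \<phi>"
          using sub[OF q bs(1)] bs(2) True by (intro mult_mono M le_seminorm[OF S]) auto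
        finally show ?thesis .
      next
        case False
        then have "iter_deriv (snd q) \<phi> x = 0" using \<phi>(2) by (intro iter_deriv_zero_outside) auto
        then show ?thesis using M(1) sub[OF q bs(1)] seminorm_nonneg[OF S] by simp
      qed
      then have "(\<Sum>q\<leftarrow>splits bs. (1 + norm x) ^ k * cmod (iter_deriv (fst q) p x * iter_deriv (snd q) \<phi> x))
          \<le> (\<Sum>q\<leftarrow>splits bs. M (fst q) * seminorm 0 N \<phi>)"
        by (rule sum_list_mono)
      moreover have "(1 + norm x) ^ k * cmod (iter_deriv bs (\<lambda>x. p x * \<phi> x) x)
          \<le> (1 + norm x) ^ k * (\<Sum>q\<leftarrow>splits bs. cmod (iter_deriv (fst q) p x * iter_deriv (snd q) \<phi> x))"
        unfolding smooth_mult(2)[OF p schwartz_smooth[OF S] bs(1)]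
        by (intro mult_left_mono) (auto intro: norm_sum_list_le)
      ultimately show "(1 + norm x) ^ k * cmod (iter_deriv bs (\<lambda>x. p x * \<phi> x) x)
          \<le> (\<Sum>q\<leftarrow>splits bs. M (fst q)) * seminorm 0 N \<phi>"
        by (simp add: sum_list_const_mult sum_list_mult_const)
    qed
    then show ?thesis by (simp add: B_def sum_distrib_right)
  qed
  ultimately show ?thesis using that by blast
qed

text \<open>Undoing the weight multiplies by \<open>exp (\<gamma> * t)\<close>, which can destroy
  temperedness. Continuity on each compact set remains, and that is what a distribution
  requires.\<close>

lemma exp_weight_surj:
  assumes T: "T \<in> tempered_distributions"
  obtains u where "u \<in> distributions" "exp_weight \<gamma> u = restrict T test_functions"
proof
  let ?u = "\<lambda>\<phi>\<in>test_functions. T (exp_mult \<gamma> \<phi>)"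
  have S: "exp_mult \<gamma> \<phi> \<in> schwartz" if "\<phi> \<in> test_functions" for \<phi>
    using exp_mult_test_function[OF that] test_functions_subset_schwartz by blast
  show "exp_weight \<gamma> ?u = restrict T test_functions"
  proof
    fix \<phi> :: "real \<times> real \<Rightarrow> complex"
    show "exp_weight \<gamma> ?u \<phi> = restrict T test_functions \<phi>"
    proof (cases "\<phi> \<in> test_functions")
      case True
      then have "exp_weight \<gamma> ?u \<phi> = T (exp_mult \<gamma> (exp_mult (- \<gamma>) \<phi>))"
        using exp_mult_test_function[OF True, of "- \<gamma>"] by (simp only: exp_weight_eq restrict_apply if_True)
      with True show ?thesis by (simp only: exp_mult_inverse restrict_apply if_True)
    qed (simp add: exp_weight_eq)
  qed
  show "?u \<in> distributions"
    unfolding distributions_def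
  proof (intro CollectI conjI allI impI)
    show "?u \<in> extensional test_functions" by simp
    show "linear_functional_on test_functions ?u"
      unfolding linear_functional_on_def
    proof (intro ballI allI)
      fix \<phi> \<psi> :: "real \<times> real \<Rightarrow> complex" and a b assume t: "\<phi> \<in> test_functions" "\<psi> \<in> test_functions"
      have "exp_mult \<gamma> (\<lambda>x. a * \<phi> x + b * \<psi> x) = (\<lambda>x. a * exp_mult \<gamma> \<phi> x + b * exp_mult \<gamma> \<psi> x)"
        by (simp add: algebra_simps)
      moreover have "T (\<lambda>x. a * exp_mult \<gamma> \<phi> x + b * exp_mult \<gamma> \<psi> x) = a * T (exp_mult \<gamma> \<phi>) + b * T (exp_mult \<gamma> \<psi>)"
        using T S[OF t(1)] S[OF t(2)] by (simp add: tempered_distributions_def linear_functional_on_def)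
      ultimately show "?u (\<lambda>x. a * \<phi> x + b * \<psi> x) = a * ?u \<phi> + b * ?u \<psi>"
        using t test_functions_linear_combination[OF t, of a b] by (simp only: restrict_apply if_True)
    qed
    fix K :: "(real \<times> real) set" assume K: "compact K"
    obtain N C where C: "\<And>\<phi>. \<phi> \<in> schwartz \<Longrightarrow> cmod (T \<phi>) \<le> C * seminorm N N \<phi>"
      using T by (auto simp: tempered_distributions_def)
    obtain B where B: "B \<ge> 0" "\<And>\<phi>. \<phi> \<in> test_functions \<Longrightarrow> supp \<phi> \<subseteq> K \<Longrightarrow>
        seminorm N N (exp_mult \<gamma> \<phi>) \<le> B * seminorm 0 N \<phi>"
      using seminorm_mult_le[OF smooth_exp_fst K] by metis
    have "cmod (?u \<phi>) \<le> (\<bar>C\<bar> * B) * seminorm 0 N \<phi>" if \<phi>: "\<phi> \<in> test_functions" "supp \<phi> \<subseteq> K" for \<phi>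
    proof -
      have "cmod (?u \<phi>) \<le> C * seminorm N N (exp_mult \<gamma> \<phi>)" using C[OF S[OF \<phi>(1)]] \<phi>(1) by simp
      also have "\<dots> \<le> \<bar>C\<bar> * (B * seminorm 0 N \<phi>)"
        using B(2)[OF \<phi>] seminorm_nonneg[OF S[OF \<phi>(1)]] by (intro mult_mono) auto
      finally show ?thesis by (simp add: mult.assoc)
    qed
    then show "\<exists>N C. \<forall>\<phi>\<in>test_functions. supp \<phi> \<subseteq> K \<longrightarrow> cmod (?u \<phi>) \<le> C * seminorm 0 N \<phi>" by blast
  qed
qed

section \<open>Weighted spaces described by the transform\<close>

lemma H_gamma_tempered_ext:
  assumes "u \<in> H_gamma s \<gamma>"
  shows "tempered_ext (exp_weight \<gamma> u) \<in> sobolev s"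
    and "restrict (tempered_ext (exp_weight \<gamma> u)) test_functions = exp_weight \<gamma> u"
proof -
  obtain T where T: "T \<in> sobolev s" "restrict T test_functions = exp_weight \<gamma> u"
    using assms by (auto simp: H_gamma_def)
  then have "tempered_ext (exp_weight \<gamma> u) = T" by (intro tempered_ext_eq) (auto simp: sobolev_def)
  with T show "tempered_ext (exp_weight \<gamma> u) \<in> sobolev s"
    "restrict (tempered_ext (exp_weight \<gamma> u)) test_functions = exp_weight \<gamma> u" by auto
qed

lemma hat_gamma_measurable:
  "u \<in> H_gamma s \<gamma> \<Longrightarrow> hat_gamma \<gamma> u \<in> borel_measurable borel"
  using represents_fourier_fun[OF H_gamma_tempered_ext(1)] by (auto simp: hat_gamma_def represents_def)

lemma hat_gamma_integrable:
  "u \<in> H_gamma s \<gamma> \<Longrightarrow> integrable lborel (\<lambda>\<xi>. (1 + (norm \<xi>)\<^sup>2) powr s * (cmod (hat_gamma \<gamma> u \<xi>))\<^sup>2)"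
  using H_gamma_tempered_ext(1) by (auto simp: hat_gamma_def sobolev_def)

text \<open>The a.e. equality passes to the tempered distributions by inversion, to their
  restrictions to test functions, and through the invertible exponential weight. The two orders
  \<open>s\<close> and \<open>r\<close> may differ.\<close>

lemma H_gamma_eqI:
  assumes u: "u \<in> H_gamma s \<gamma>" and w: "w \<in> H_gamma r \<gamma>"
    and ae: "AE \<xi> in lborel. hat_gamma \<gamma> u \<xi> = hat_gamma \<gamma> w \<xi>"
  shows "u = w"
proof (rule exp_weight_inj)
  show "u \<in> distributions" "w \<in> distributions" using u w by (auto simp: H_gamma_def)
  have "tempered_ext (exp_weight \<gamma> u) = tempered_ext (exp_weight \<gamma> w)"
    using H_gamma_tempered_ext(1)[OF u] H_gamma_tempered_ext(1)[OF w] ae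
    by (intro tempered_eq_if_fourier_AE_eq[OF _ represents_fourier_fun _ represents_fourier_fun])
      (auto simp: hat_gamma_def sobolev_def)
  then show "exp_weight \<gamma> u = exp_weight \<gamma> w"
    using H_gamma_tempered_ext(2)[OF u] H_gamma_tempered_ext(2)[OF w] by metis
qed

lemma H_gamma_exists:
  assumes "V \<in> borel_measurable borel"
    and "integrable lborel (\<lambda>\<xi>. (1 + (norm \<xi>)\<^sup>2) powr r * (cmod (V \<xi>))\<^sup>2)"
  obtains u where "u \<in> H_gamma r \<gamma>" "AE \<xi> in lborel. hat_gamma \<gamma> u \<xi> = V \<xi>"
proof -
  obtain T where T: "T \<in> sobolev r" "AE \<xi> in lborel. fourier_fun T \<xi> = V \<xi>"
    using sobolev_exists[OF assms] by blast
  then have temp: "T \<in> tempered_distributions" by (simp add: sobolev_def)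
  obtain u where u: "u \<in> distributions" "exp_weight \<gamma> u = restrict T test_functions"
    using exp_weight_surj[OF temp] by blast
  have "tempered_ext (exp_weight \<gamma> u) = T" using u temp by (intro tempered_ext_eq) auto
  moreover have "u \<in> H_gamma r \<gamma>" using u T by (auto simp: H_gamma_def)
  ultimately show ?thesis using that[of u] T(2) by (simp add: hat_gamma_def)
qed

section \<open>The weight in the plane and division by the symbol\<close>

definition weight :: "real \<Rightarrow> real \<times> real \<Rightarrow> real" where
  "weight \<gamma> p = \<gamma>\<^sup>2 + (fst p)\<^sup>2 + (snd p)\<^sup>2"

lemma weight_measurable [measurable]: "weight \<gamma> \<in> borel_measurable borel"
  unfolding weight_def[abs_def] by (intro borel_measurable_continuous_onI continuous_intros)

lemma norm_sq_prod: "(norm p)\<^sup>2 = (fst p)\<^sup>2 + (snd p)\<^sup>2" for p :: "real \<times> real"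
  by (cases p) (simp add: norm_Pair)

lemma weight_pos: "\<gamma> \<ge> 1 \<Longrightarrow> weight \<gamma> p > 0"
  unfolding weight_def by (intro add_pos_nonneg) auto

text \<open>The constants depend on \<gamma>, so this comparison transfers integrability and does
  not enter the final estimate.\<close>

lemma weight_powr_comparable:
  assumes \<gamma>: "\<gamma> \<ge> 1"
  shows "(1 + (norm p)\<^sup>2) powr r \<le> (\<gamma>\<^sup>2) powr \<bar>r\<bar> * weight \<gamma> p powr r"
    and "weight \<gamma> p powr r \<le> (\<gamma>\<^sup>2) powr \<bar>r\<bar> * (1 + (norm p)\<^sup>2) powr r"
proof -
  have g: "1 \<le> \<gamma>\<^sup>2" using \<gamma> by simp
  have w: "1 + (norm p)\<^sup>2 \<le> weight \<gamma> p" using g by (simp add: norm_sq_prod weight_def)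
  have n: "(norm p)\<^sup>2 \<le> \<gamma>\<^sup>2 * (norm p)\<^sup>2" using mult_right_mono[OF g, of "(norm p)\<^sup>2"] by simp
  then have w': "weight \<gamma> p \<le> \<gamma>\<^sup>2 * (1 + (norm p)\<^sup>2)" by (simp add: norm_sq_prod weight_def algebra_simps)
  have pos: "0 < 1 + (norm p)\<^sup>2" "0 < weight \<gamma> p" "0 < \<gamma>\<^sup>2"
    using weight_pos[OF \<gamma>] g by (auto intro: add_pos_nonneg)
  have 1: "1 + (norm p)\<^sup>2 \<le> \<gamma>\<^sup>2 * weight \<gamma> p"
    using order_trans[OF w mult_right_mono[OF g less_imp_le[OF pos(2)], unfolded mult_1]] .
  show "(1 + (norm p)\<^sup>2) powr r \<le> (\<gamma>\<^sup>2) powr \<bar>r\<bar> * weight \<gamma> p powr r"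
    by (rule powr_le_comparable[OF pos(1,2,3) 1 w'])
  show "weight \<gamma> p powr r \<le> (\<gamma>\<^sup>2) powr \<bar>r\<bar> * (1 + (norm p)\<^sup>2) powr r"
    by (rule powr_le_comparable[OF pos(2,1,3) w' 1])
qed

lemma H_gamma_norm_eq:
  "H_gamma_norm s \<gamma> u = sqrt (1 / (2 * pi)\<^sup>2 * (LINT p|lborel. weight \<gamma> p powr s * (cmod (hat_gamma \<gamma> u p))\<^sup>2))"
  by (simp add: H_gamma_norm_def norm_s_gamma_def hat_gamma_def weight_def case_prod_beta')

lemma integrable_weight_iff:
  assumes \<gamma>: "\<gamma> \<ge> 1" and [measurable]: "V \<in> borel_measurable borel"
  shows "integrable lborel (\<lambda>p. weight \<gamma> p powr r * (cmod (V p))\<^sup>2) \<longleftrightarrow>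
    integrable lborel (\<lambda>p. (1 + (norm p)\<^sup>2) powr r * (cmod (V p))\<^sup>2)"
proof
  let ?c = "(\<gamma>\<^sup>2) powr \<bar>r\<bar>"
  assume "integrable lborel (\<lambda>p. weight \<gamma> p powr r * (cmod (V p))\<^sup>2)"
  then have "integrable lborel (\<lambda>p. ?c * (weight \<gamma> p powr r * (cmod (V p))\<^sup>2))" by (rule integrable_mult_right)
  then show "integrable lborel (\<lambda>p. (1 + (norm p)\<^sup>2) powr r * (cmod (V p))\<^sup>2)"
    by (rule Bochner_Integration.integrable_bound)
      (use weight_powr_comparable(1)[OF \<gamma>] in \<open>auto intro!: AE_I2 simp: mult.assoc[symmetric] mult_right_mono\<close>)
next
  let ?c = "(\<gamma>\<^sup>2) powr \<bar>r\<bar>"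
  assume "integrable lborel (\<lambda>p. (1 + (norm p)\<^sup>2) powr r * (cmod (V p))\<^sup>2)"
  then have "integrable lborel (\<lambda>p. ?c * ((1 + (norm p)\<^sup>2) powr r * (cmod (V p))\<^sup>2))" by (rule integrable_mult_right)
  then show "integrable lborel (\<lambda>p. weight \<gamma> p powr r * (cmod (V p))\<^sup>2)"
    by (rule Bochner_Integration.integrable_bound)
      (use weight_powr_comparable(2)[OF \<gamma>] in \<open>auto intro!: AE_I2 simp: mult.assoc[symmetric] mult_right_mono\<close>)
qed

text \<open>\<open>weight\<close> is the square of \<Lambda>, so squaring the lower bound for the
  symbol yields one full power of \<open>weight\<close>: the order \<open>s\<close> becomes
  \<open>s + 1\<close>, and \<open>\<gamma>\<^sup>2\<close> stays on the left.\<close>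

lemma weight_symbol_le:
  assumes K: "K > 0" and \<gamma>: "\<gamma> \<ge> 1"
    and lower: "K * \<gamma> * sqrt (weight \<gamma> p) \<le> cmod \<sigma>" and eq: "\<sigma> * V = U"
  shows "\<gamma>\<^sup>2 * (weight \<gamma> p powr (s + 1) * (cmod V)\<^sup>2) \<le> (1 / K)\<^sup>2 * (weight \<gamma> p powr s * (cmod U)\<^sup>2)"
proof -
  have w: "weight \<gamma> p > 0" using \<gamma> by (rule weight_pos)
  have "(K * \<gamma> * sqrt (weight \<gamma> p))\<^sup>2 \<le> (cmod \<sigma>)\<^sup>2"
    using K \<gamma> w by (intro power_mono[OF lower]) auto
  then have "K\<^sup>2 * \<gamma>\<^sup>2 * weight \<gamma> p \<le> (cmod \<sigma>)\<^sup>2"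
    using w by (simp add: power_mult_distrib)
  then have "(K\<^sup>2 * \<gamma>\<^sup>2 * weight \<gamma> p) * (cmod V)\<^sup>2 \<le> (cmod \<sigma>)\<^sup>2 * (cmod V)\<^sup>2"
    by (rule mult_right_mono) simp
  also have "\<dots> = (cmod U)\<^sup>2" by (simp add: eq[symmetric] norm_mult power_mult_distrib)
  finally have "weight \<gamma> p powr s * ((K\<^sup>2 * \<gamma>\<^sup>2 * weight \<gamma> p) * (cmod V)\<^sup>2) \<le> weight \<gamma> p powr s * (cmod U)\<^sup>2"
    by (rule mult_left_mono) simp
  moreover have "weight \<gamma> p powr (s + 1) = weight \<gamma> p powr s * weight \<gamma> p" using w by (simp add: powr_add)
  ultimately have "K\<^sup>2 * (\<gamma>\<^sup>2 * (weight \<gamma> p powr (s + 1) * (cmod V)\<^sup>2)) \<le> weight \<gamma> p powr s * (cmod U)\<^sup>2"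
    by (simp add: mult_ac)
  then show ?thesis using K by (simp add: power_divide field_simps)
qed

theorem theorem6p2:
  fixes v c s :: real
  assumes "v > 0" and "c > 0" and "v / c > sqrt 2"
  shows "\<exists>C>0. \<forall>\<gamma>\<ge>1. \<forall>g \<in> H_gamma s \<gamma>.
    (\<exists>!f. f \<in> H_gamma (s + 1) \<gamma> \<and> solves v c \<gamma> g f) \<and>
    (\<forall>f \<in> H_gamma (s + 1) \<gamma>. solves v c \<gamma> g f \<longrightarrow>
       \<gamma> * H_gamma_norm (s + 1) \<gamma> f \<le> C * H_gamma_norm s \<gamma> g)"
proof -
  obtain K where K: "K > 0" "\<And>\<gamma> \<delta> \<eta>. \<gamma> > 0 \<Longrightarrow>
      K * \<gamma> * sqrt (\<gamma>\<^sup>2 + \<delta>\<^sup>2 + \<eta>\<^sup>2) \<le> cmod (Sigma_symbol v c (Complex \<gamma> \<delta>) \<eta>)"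
    using Sigma_symbol_lower_bound[OF assms] by metis
  have main: "(\<exists>!f. f \<in> H_gamma (s + 1) \<gamma> \<and> solves v c \<gamma> g f) \<and>
    (\<forall>f \<in> H_gamma (s + 1) \<gamma>. solves v c \<gamma> g f \<longrightarrow>
       \<gamma> * H_gamma_norm (s + 1) \<gamma> f \<le> 1 / K * H_gamma_norm s \<gamma> g)"
    if \<gamma>: "\<gamma> \<ge> 1" and g: "g \<in> H_gamma s \<gamma>" for \<gamma> g
  proof -
    define S where "S p = Sigma_symbol v c (Complex \<gamma> (fst p)) (snd p)" for p
    let ?U = "hat_gamma \<gamma> g"
    have lower: "K * \<gamma> * sqrt (weight \<gamma> p) \<le> cmod (S p)" for p
      unfolding S_def weight_def using \<gamma> by (intro K(2)) simp
    have "K * \<gamma> * sqrt (weight \<gamma> p) > 0" for p using K(1) \<gamma> weight_pos[OF \<gamma>, of p] by simp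
    \<comment> \<open>The bound holds at every point of the plane, so division by the symbol is
      legitimate everywhere.\<close>
    then have S0: "S p \<noteq> 0" for p using lower[of p] by (metis norm_zero not_less)
    have [measurable]: "S \<in> borel_measurable borel"
    proof -
      have "continuous_on UNIV S"
        using continuous_on_Sigma_symbol[OF assms(2), of \<gamma> v] \<gamma> by (simp add: S_def[abs_def] case_prod_beta')
      then show ?thesis by (rule borel_measurable_continuous_onI)
    qed
    have solves_iff: "solves v c \<gamma> g f \<longleftrightarrow> (AE p in lborel. S p * hat_gamma \<gamma> f p = ?U p)" for f
      by (simp add: solves_def S_def case_prod_beta')
    have [measurable]: "?U \<in> borel_measurable borel" by (rule hat_gamma_measurable[OF g])
    have iU: "integrable lborel (\<lambda>p. (1 / K)\<^sup>2 * (weight \<gamma> p powr s * (cmod (?U p))\<^sup>2))"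
      using hat_gamma_integrable[OF g] integrable_weight_iff[OF \<gamma>, of ?U s] by simp
    have "\<exists>f. f \<in> H_gamma (s + 1) \<gamma> \<and> solves v c \<gamma> g f"
    proof -
      let ?V = "\<lambda>p. ?U p / S p"
      \<comment> \<open>The pointwise inequality compares \<open>?V\<close> with \<open>?U\<close>
        directly in the \<gamma>-dependent weight; only the membership in \<open>H_gamma\<close>
        below is phrased with \<open>1 + (norm p)\<^sup>2\<close>.\<close>
      have "integrable lborel (\<lambda>p. \<gamma>\<^sup>2 * (weight \<gamma> p powr (s + 1) * (cmod (?V p))\<^sup>2))"
      proof (rule Bochner_Integration.integrable_bound[OF iU])
        show "AE p in lborel. norm (\<gamma>\<^sup>2 * (weight \<gamma> p powr (s + 1) * (cmod (?V p))\<^sup>2))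
            \<le> norm ((1 / K)\<^sup>2 * (weight \<gamma> p powr s * (cmod (?U p))\<^sup>2))"
          using weight_symbol_le[OF K(1) \<gamma> lower, of _ "?V p" "?U p" for p] S0
          by (intro AE_I2) (simp add: abs_mult)
      qed measurable
      then have "integrable lborel (\<lambda>p. weight \<gamma> p powr (s + 1) * (cmod (?V p))\<^sup>2)"
        using \<gamma> by simp
      then have "integrable lborel (\<lambda>p. (1 + (norm p)\<^sup>2) powr (s + 1) * (cmod (?V p))\<^sup>2)"
        by (subst integrable_weight_iff[OF \<gamma>, symmetric]) measurable
      then obtain f where f: "f \<in> H_gamma (s + 1) \<gamma>" "AE p in lborel. hat_gamma \<gamma> f p = ?V p"
        using H_gamma_exists[of ?V "s + 1" \<gamma>] by auto
      have "solves v c \<gamma> g f"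
        unfolding solves_iff using f(2) by eventually_elim (simp add: S0)
      with f show ?thesis by blast
    qed
    moreover have "f = f'" if "f \<in> H_gamma (s + 1) \<gamma>" "solves v c \<gamma> g f" "f' \<in> H_gamma (s + 1) \<gamma>" "solves v c \<gamma> g f'" for f f'
    proof (rule H_gamma_eqI[OF that(1,3)])
      show "AE p in lborel. hat_gamma \<gamma> f p = hat_gamma \<gamma> f' p"
        using that(2,4) unfolding solves_iff
      proof eventually_elim
        case (elim p)
        then have "S p * hat_gamma \<gamma> f p = S p * hat_gamma \<gamma> f' p" by simp
        then show ?case using S0[of p] by simp
      qed
    qed
    moreover have "\<gamma> * H_gamma_norm (s + 1) \<gamma> f \<le> 1 / K * H_gamma_norm s \<gamma> g"
      if f: "f \<in> H_gamma (s + 1) \<gamma>" "solves v c \<gamma> g f" for f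
    proof -
      let ?V = "hat_gamma \<gamma> f"
      have [measurable]: "?V \<in> borel_measurable borel" by (rule hat_gamma_measurable[OF f(1)])
      \<comment> \<open>A non-integrable function would have integral 0, so integrability is secured
        on both sides before the integrals are compared.\<close>
      have iV: "integrable lborel (\<lambda>p. \<gamma>\<^sup>2 * (weight \<gamma> p powr (s + 1) * (cmod (?V p))\<^sup>2))"
        using hat_gamma_integrable[OF f(1)] integrable_weight_iff[OF \<gamma>, of ?V "s + 1"] by simp
      have "AE p in lborel. \<gamma>\<^sup>2 * (weight \<gamma> p powr (s + 1) * (cmod (?V p))\<^sup>2) \<le> (1 / K)\<^sup>2 * (weight \<gamma> p powr s * (cmod (?U p))\<^sup>2)"
        using f(2) unfolding solves_iff
        by eventually_elim (rule weight_symbol_le[OF K(1) \<gamma> lower])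
      then have "(LINT p|lborel. \<gamma>\<^sup>2 * (weight \<gamma> p powr (s + 1) * (cmod (?V p))\<^sup>2))
          \<le> (LINT p|lborel. (1 / K)\<^sup>2 * (weight \<gamma> p powr s * (cmod (?U p))\<^sup>2))"
        by (rule integral_mono_AE[OF iV iU])
      then have le: "\<gamma>\<^sup>2 * (LINT p|lborel. weight \<gamma> p powr (s + 1) * (cmod (?V p))\<^sup>2)
          \<le> (1 / K)\<^sup>2 * (LINT p|lborel. weight \<gamma> p powr s * (cmod (?U p))\<^sup>2)" by simp
      have "\<gamma> * H_gamma_norm (s + 1) \<gamma> f =
          sqrt (1 / (2 * pi)\<^sup>2 * (\<gamma>\<^sup>2 * (LINT p|lborel. weight \<gamma> p powr (s + 1) * (cmod (?V p))\<^sup>2)))"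
        unfolding H_gamma_norm_eq using \<gamma> by (simp add: real_sqrt_mult real_sqrt_divide)
      also have "\<dots> \<le> sqrt (1 / (2 * pi)\<^sup>2 * ((1 / K)\<^sup>2 * (LINT p|lborel. weight \<gamma> p powr s * (cmod (?U p))\<^sup>2)))"
        using le by (intro real_sqrt_le_mono mult_left_mono) auto
      also have "\<dots> = 1 / K * H_gamma_norm s \<gamma> g"
        unfolding H_gamma_norm_eq using K(1) by (simp add: real_sqrt_mult real_sqrt_divide)
      finally show ?thesis .
    qed
    ultimately show ?thesis by blast
  qed
  show ?thesis
    by (rule exI[of _ "1 / K"]) (use main K(1) in auto)
qed

end
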